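(* Let $\bm{z}_1,\dots,\bm{z}_n\in\mathbb{R}^d$ arrive one at a time in a stream, and suppose every coordinate of every $\bm{z}_i$ is an integer in $\{-N,-N+1,\dots,N-1,N\}$. There exists a streaming algorithm that, for every timestep $t$, maintains an ellipsoid $\mathcal{E}_t$ (origin-centered), a center $\bm{c}_t\in\mathbb{R}^d$ and an approximation factor $\alpha_t\in(0,1]$ such that \[\bm{c}_t+\alpha_t\cdot\mathcal{E}_t\subseteq \mathrm{conv}\{\bm{z}_1,\dots,\bm{z}_t\}\subseteq \bm{c}_t+\mathcal{E}_t,\] and, with $d_t=\dim\big(\mathrm{aff}\{\bm{z}_1,\dots,\bm{z}_t\}\big)$, for all timesteps $t$, \[\frac{1}{\alpha_t}=O\big(d_t\log(dN)\big).\] The algorithm runs in time $\widetilde{O}(nd^2)$ and stores $O(d^2)$ floating point numbers.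
   Context: $\mathrm{aff}$ denotes affine span. An origin-centered ellipsoid is the image of a Euclidean ball (possibly of a lower-dimensional subspace) under a linear map. In the streaming model the algorithm receives the points one at a time and updates its output after each point, without knowing $n$ in advance. $O(\cdot)$ hides absolute constants; $\widetilde{O}$ also hides logarithmic factors.
   Formalization: The bound is proved as 1/α_t = O(max(1, d_t log(dN))), since O(d_t log(dN)) cannot hold literally when d_t = 0 (always at t = 1) or dN = 1; for d_t ≥ 1 and dN ≥ 2 the two bounds agree up to a constant. *)

theory Defs
  imports "HOL-Analysis.Analysis" "HOL-Library.Function_Algebras"
begin

section \<open>Euclidean space of variable dimension\<close>

text \<open>
  The algorithm and the hidden constants must not depend on the dimension, so the dimension has to
  be quantified inside the statement and cannot be a type.  A vector of dimension \<open>d\<close> is a function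
  from indices to reals that vanishes at all indices from \<open>d\<close> on.  With the pointwise vector space
  structure on functions, the convex and affine hulls and \<open>dim\<close> are those of the library.
\<close>

instantiation "fun" :: (type, real_vector) real_vector
begin

definition scaleR_fun :: "real \<Rightarrow> ('a \<Rightarrow> 'b) \<Rightarrow> 'a \<Rightarrow> 'b"
  where "scaleR_fun r f = (\<lambda>x. r *\<^sub>R f x)"

instance
  by standard (auto simp: scaleR_fun_def fun_eq_iff scaleR_add_right scaleR_add_left)

end

type_synonym vect = "nat \<Rightarrow> real"

definition Rspace :: "nat \<Rightarrow> vect set"
  where "Rspace d = {x. \<forall>i\<ge>d. x i = 0}"

text \<open>
  The dimension of the affine hull.  The library's \<open>aff_dim\<close> is restricted to the class
  \<open>euclidean_space\<close>; for nonempty \<open>S\<close> the set of differences below is the direction space of the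
  affine hull, so its linear dimension is the affine dimension.
\<close>

definition affine_dim :: "vect set \<Rightarrow> nat"
  where "affine_dim S = dim {x - y |x y. x \<in> affine hull S \<and> y \<in> affine hull S}"

text \<open>A possibly degenerate ellipsoid centered at the origin of \<open>d\<close>-space.\<close>

definition origin_ellipsoid :: "nat \<Rightarrow> vect set \<Rightarrow> bool"
  where "origin_ellipsoid d E \<longleftrightarrow>
    (\<exists>V r f. subspace V \<and> V \<subseteq> Rspace d \<and> 0 \<le> r \<and> linear f \<and> f ` V \<subseteq> Rspace d \<and>
             E = f ` {v \<in> V. sqrt (\<Sum>i<d. (v i)\<^sup>2) \<le> r})"

definition mat_apply :: "nat \<Rightarrow> (nat \<Rightarrow> nat \<Rightarrow> real) \<Rightarrow> vect \<Rightarrow> vect"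
  where "mat_apply d M v = (\<lambda>i. if i < d then \<Sum>j<d. M i j * v j else 0)"

definition mat_ellipsoid :: "nat \<Rightarrow> (nat \<Rightarrow> nat \<Rightarrow> real) \<Rightarrow> vect set"
  where "mat_ellipsoid d M = mat_apply d M ` {v \<in> Rspace d. sqrt (\<Sum>i<d. (v i)\<^sup>2) \<le> 1}"

lemma linear_mat_apply: "linear (mat_apply d M)"
  by (rule linearI)
     (auto simp: mat_apply_def fun_eq_iff scaleR_fun_def sum.distrib sum_distrib_left algebra_simps)

lemma origin_ellipsoid_mat_ellipsoid: "origin_ellipsoid d (mat_ellipsoid d M)"
proof -
  have "subspace (Rspace d)"
    by (auto simp: subspace_def Rspace_def scaleR_fun_def)
  moreover have "mat_apply d M ` Rspace d \<subseteq> Rspace d"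
    by (auto simp: Rspace_def mat_apply_def)
  ultimately show ?thesis
    unfolding origin_ellipsoid_def mat_ellipsoid_def
    by (intro exI[of _ "Rspace d"] exI[of _ 1] exI[of _ "mat_apply d M"])
       (simp add: linear_mat_apply)
qed


section \<open>A real random access machine\<close>

text \<open>
  Algorithms are programs for a unit-cost real RAM.  A state consists of a memory whose cells hold
  real numbers, and of index registers that hold natural numbers and are used to address the
  memory.  Since a program is a fixed finite text, it uses a constant number of registers.  There is
  no conversion between indices and reals (in particular no rounding), and the only literals are
  integers, so neither a program nor a single real can act as a table.  The expression \<open>Dim\<close>
  denotes the dimension of the input points; it is the only parameter a program can read.
\<close>

datatype iexp = INum nat | Dim | Reg nat | IAdd iexp iexp | IMul iexp iexp | IMonus iexp iexp

datatype rexp = RNum int | Cell iexp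
  | RAdd rexp rexp | RSub rexp rexp | RMul rexp rexp | RDiv rexp rexp | RSqrt rexp

datatype bexp = RLess rexp rexp | ILess iexp iexp | BNot bexp | BAnd bexp bexp

datatype com = Skip
  | SetReg nat iexp
  | SetCell iexp rexp
  | Seq com com
  | IfElse bexp com com
  | WhileDo bexp com

record state =
  regs :: "nat \<Rightarrow> nat"
  mem :: "nat \<Rightarrow> real"

primrec ival :: "nat \<Rightarrow> state \<Rightarrow> iexp \<Rightarrow> nat" where
  "ival d \<sigma> (INum m) = m"
| "ival d \<sigma> Dim = d"
| "ival d \<sigma> (Reg x) = regs \<sigma> x"
| "ival d \<sigma> (IAdd a b) = ival d \<sigma> a + ival d \<sigma> b"
| "ival d \<sigma> (IMul a b) = ival d \<sigma> a * ival d \<sigma> b"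
| "ival d \<sigma> (IMonus a b) = ival d \<sigma> a - ival d \<sigma> b"

primrec rval :: "nat \<Rightarrow> state \<Rightarrow> rexp \<Rightarrow> real" where
  "rval d \<sigma> (RNum m) = real_of_int m"
| "rval d \<sigma> (Cell a) = mem \<sigma> (ival d \<sigma> a)"
| "rval d \<sigma> (RAdd a b) = rval d \<sigma> a + rval d \<sigma> b"
| "rval d \<sigma> (RSub a b) = rval d \<sigma> a - rval d \<sigma> b"
| "rval d \<sigma> (RMul a b) = rval d \<sigma> a * rval d \<sigma> b"
| "rval d \<sigma> (RDiv a b) = rval d \<sigma> a / rval d \<sigma> b"
| "rval d \<sigma> (RSqrt a) = sqrt (rval d \<sigma> a)"

primrec bval :: "nat \<Rightarrow> state \<Rightarrow> bexp \<Rightarrow> bool" where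
  "bval d \<sigma> (RLess a b) = (rval d \<sigma> a < rval d \<sigma> b)"
| "bval d \<sigma> (ILess a b) = (ival d \<sigma> a < ival d \<sigma> b)"
| "bval d \<sigma> (BNot b) = (\<not> bval d \<sigma> b)"
| "bval d \<sigma> (BAnd a b) = (bval d \<sigma> a \<and> bval d \<sigma> b)"

text \<open>
  Evaluation is admissible in space \<open>s\<close> if every index that occurs, in particular every address, is
  below \<open>s\<close>.  Hence at most \<open>s\<close> memory cells are ever used, and index registers cannot serve as
  additional storage for large numbers.  Division by zero and square roots of negative numbers are
  not admissible, so that the totalised library operations play no role.
\<close>

primrec iok :: "nat \<Rightarrow> nat \<Rightarrow> state \<Rightarrow> iexp \<Rightarrow> bool" where
  "iok d s \<sigma> (INum m) = (m < s)"
| "iok d s \<sigma> Dim = (d < s)"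
| "iok d s \<sigma> (Reg x) = (regs \<sigma> x < s)"
| "iok d s \<sigma> (IAdd a b) = (iok d s \<sigma> a \<and> iok d s \<sigma> b \<and> ival d \<sigma> a + ival d \<sigma> b < s)"
| "iok d s \<sigma> (IMul a b) = (iok d s \<sigma> a \<and> iok d s \<sigma> b \<and> ival d \<sigma> a * ival d \<sigma> b < s)"
| "iok d s \<sigma> (IMonus a b) = (iok d s \<sigma> a \<and> iok d s \<sigma> b)"

primrec rok :: "nat \<Rightarrow> nat \<Rightarrow> state \<Rightarrow> rexp \<Rightarrow> bool" where
  "rok d s \<sigma> (RNum m) = True"
| "rok d s \<sigma> (Cell a) = iok d s \<sigma> a"
| "rok d s \<sigma> (RAdd a b) = (rok d s \<sigma> a \<and> rok d s \<sigma> b)"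
| "rok d s \<sigma> (RSub a b) = (rok d s \<sigma> a \<and> rok d s \<sigma> b)"
| "rok d s \<sigma> (RMul a b) = (rok d s \<sigma> a \<and> rok d s \<sigma> b)"
| "rok d s \<sigma> (RDiv a b) = (rok d s \<sigma> a \<and> rok d s \<sigma> b \<and> rval d \<sigma> b \<noteq> 0)"
| "rok d s \<sigma> (RSqrt a) = (rok d s \<sigma> a \<and> 0 \<le> rval d \<sigma> a)"

primrec bok :: "nat \<Rightarrow> nat \<Rightarrow> state \<Rightarrow> bexp \<Rightarrow> bool" where
  "bok d s \<sigma> (RLess a b) = (rok d s \<sigma> a \<and> rok d s \<sigma> b)"
| "bok d s \<sigma> (ILess a b) = (iok d s \<sigma> a \<and> iok d s \<sigma> b)"
| "bok d s \<sigma> (BNot b) = bok d s \<sigma> b"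
| "bok d s \<sigma> (BAnd a b) = (bok d s \<sigma> a \<and> bok d s \<sigma> b)"

text \<open>The cost of an expression is its number of nodes.\<close>

primrec icost :: "iexp \<Rightarrow> nat" where
  "icost (INum m) = 1"
| "icost Dim = 1"
| "icost (Reg x) = 1"
| "icost (IAdd a b) = icost a + icost b + 1"
| "icost (IMul a b) = icost a + icost b + 1"
| "icost (IMonus a b) = icost a + icost b + 1"

primrec rcost :: "rexp \<Rightarrow> nat" where
  "rcost (RNum m) = 1"
| "rcost (Cell a) = icost a + 1"
| "rcost (RAdd a b) = rcost a + rcost b + 1"
| "rcost (RSub a b) = rcost a + rcost b + 1"
| "rcost (RMul a b) = rcost a + rcost b + 1"
| "rcost (RDiv a b) = rcost a + rcost b + 1"
| "rcost (RSqrt a) = rcost a + 1"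

primrec bcost :: "bexp \<Rightarrow> nat" where
  "bcost (RLess a b) = rcost a + rcost b + 1"
| "bcost (ILess a b) = icost a + icost b + 1"
| "bcost (BNot b) = bcost b + 1"
| "bcost (BAnd a b) = bcost a + bcost b + 1"

text \<open>
  \<open>exec d s c \<sigma> T \<tau>\<close>: in dimension \<open>d\<close>, the program \<open>c\<close> started in state \<open>\<sigma>\<close> terminates in state
  \<open>\<tau>\<close> after time \<open>T\<close>, and stays within space \<open>s\<close>.
\<close>

inductive exec :: "nat \<Rightarrow> nat \<Rightarrow> com \<Rightarrow> state \<Rightarrow> nat \<Rightarrow> state \<Rightarrow> bool" for d s :: nat where
  Skip: "exec d s Skip \<sigma> 1 \<sigma>"
| SetReg: "iok d s \<sigma> e \<Longrightarrow>
    exec d s (SetReg x e) \<sigma> (icost e + 1) (\<sigma>\<lparr>regs := (regs \<sigma>)(x := ival d \<sigma> e)\<rparr>)"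
| SetCell: "iok d s \<sigma> a \<Longrightarrow> rok d s \<sigma> e \<Longrightarrow>
    exec d s (SetCell a e) \<sigma> (icost a + rcost e + 1)
      (\<sigma>\<lparr>mem := (mem \<sigma>)(ival d \<sigma> a := rval d \<sigma> e)\<rparr>)"
| Seq: "exec d s c\<^sub>1 \<sigma> T\<^sub>1 \<sigma>' \<Longrightarrow> exec d s c\<^sub>2 \<sigma>' T\<^sub>2 \<sigma>'' \<Longrightarrow>
    exec d s (Seq c\<^sub>1 c\<^sub>2) \<sigma> (T\<^sub>1 + T\<^sub>2) \<sigma>''"
| IfTrue: "bok d s \<sigma> b \<Longrightarrow> bval d \<sigma> b \<Longrightarrow> exec d s c\<^sub>1 \<sigma> T \<sigma>' \<Longrightarrow>
    exec d s (IfElse b c\<^sub>1 c\<^sub>2) \<sigma> (bcost b + 1 + T) \<sigma>'"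
| IfFalse: "bok d s \<sigma> b \<Longrightarrow> \<not> bval d \<sigma> b \<Longrightarrow> exec d s c\<^sub>2 \<sigma> T \<sigma>' \<Longrightarrow>
    exec d s (IfElse b c\<^sub>1 c\<^sub>2) \<sigma> (bcost b + 1 + T) \<sigma>'"
| WhileFalse: "bok d s \<sigma> b \<Longrightarrow> \<not> bval d \<sigma> b \<Longrightarrow>
    exec d s (WhileDo b c) \<sigma> (bcost b + 1) \<sigma>"
| WhileTrue: "bok d s \<sigma> b \<Longrightarrow> bval d \<sigma> b \<Longrightarrow> exec d s c \<sigma> T\<^sub>1 \<sigma>' \<Longrightarrow>
    exec d s (WhileDo b c) \<sigma>' T\<^sub>2 \<sigma>'' \<Longrightarrow>
    exec d s (WhileDo b c) \<sigma> (bcost b + 1 + T\<^sub>1 + T\<^sub>2) \<sigma>''"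

inductive_cases exec_cases:
  "exec d s Skip \<sigma> T \<tau>"
  "exec d s (SetReg x e) \<sigma> T \<tau>"
  "exec d s (SetCell a e) \<sigma> T \<tau>"
  "exec d s (Seq c\<^sub>1 c\<^sub>2) \<sigma> T \<tau>"
  "exec d s (IfElse b c\<^sub>1 c\<^sub>2) \<sigma> T \<tau>"
  "exec d s (WhileDo b c) \<sigma> T \<tau>"

lemma exec_deterministic:
  "exec d s c \<sigma> T \<tau> \<Longrightarrow> exec d s c \<sigma> T' \<tau>' \<Longrightarrow> T' = T \<and> \<tau>' = \<tau>"
proof (induction arbitrary: T' \<tau>' rule: exec.induct)
  case (Skip \<sigma>)
  from Skip show ?case by (rule exec_cases(1)) simp
next
  case (SetReg \<sigma> e x)
  from SetReg.prems show ?case by (rule exec_cases(2)) simp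
next
  case (SetCell \<sigma> a e)
  from SetCell.prems show ?case by (rule exec_cases(3)) simp
next
  case (Seq c\<^sub>1 \<sigma> T\<^sub>1 \<sigma>' c\<^sub>2 T\<^sub>2 \<sigma>'')
  from Seq.prems obtain U\<^sub>1 U\<^sub>2 \<rho> where *: "T' = U\<^sub>1 + U\<^sub>2"
      "exec d s c\<^sub>1 \<sigma> U\<^sub>1 \<rho>" "exec d s c\<^sub>2 \<rho> U\<^sub>2 \<tau>'"
    by (rule exec_cases(4))
  from Seq.IH(1)[OF *(2)] Seq.IH(2) * show ?case by simp
next
  case (IfTrue \<sigma> b c\<^sub>1 T \<sigma>' c\<^sub>2)
  from IfTrue.prems obtain U where *: "T' = bcost b + 1 + U" "exec d s c\<^sub>1 \<sigma> U \<tau>'"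
    by (rule exec_cases(5)) (simp_all add: IfTrue.hyps(2))
  from IfTrue.IH[OF *(2)] *(1) show ?case by simp
next
  case (IfFalse \<sigma> b c\<^sub>2 T \<sigma>' c\<^sub>1)
  from IfFalse.prems obtain U where *: "T' = bcost b + 1 + U" "exec d s c\<^sub>2 \<sigma> U \<tau>'"
    by (rule exec_cases(5)) (simp_all add: IfFalse.hyps(2))
  from IfFalse.IH[OF *(2)] *(1) show ?case by simp
next
  case (WhileFalse \<sigma> b c)
  from WhileFalse.prems show ?case by (rule exec_cases(6)) (simp_all add: WhileFalse.hyps(2))
next
  case (WhileTrue \<sigma> b c T\<^sub>1 \<sigma>' T\<^sub>2 \<sigma>'')
  from WhileTrue.prems obtain U\<^sub>1 U\<^sub>2 \<rho> where *: "T' = bcost b + 1 + U\<^sub>1 + U\<^sub>2"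
      "exec d s c \<sigma> U\<^sub>1 \<rho>" "exec d s (WhileDo b c) \<rho> U\<^sub>2 \<tau>'"
    by (rule exec_cases(6)) (simp_all add: WhileTrue.hyps(2))
  from WhileTrue.IH(1)[OF *(2)] WhileTrue.IH(2) * show ?case by simp
qed


section \<open>Streaming algorithms for ellipsoidal rounding\<close>

text \<open>
  A streaming algorithm consists of an initialisation program and of an update program, which is
  run once per arriving point.  The machine writes the coordinates of the arriving point into cells
  \<open>0, \<dots>, d - 1\<close>, overwriting the previous point; the algorithm has no other access to the
  stream and is not told its length.
\<close>

record streaming_alg =
  init_prog :: com
  update_prog :: com

definition start_state :: state
  where "start_state = \<lparr>regs = (\<lambda>_. 0), mem = (\<lambda>_. 0)\<rparr>"

definition feed :: "nat \<Rightarrow> vect \<Rightarrow> state \<Rightarrow> state"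
  where "feed d x \<sigma> = \<sigma>\<lparr>mem := (\<lambda>i. if i < d then x i else mem \<sigma> i)\<rparr>"

text \<open>
  Running \<open>A\<close> in space \<open>s\<close> on the points \<open>z 1, \<dots>, z n\<close>: \<open>\<sigma> 0\<close> is the state after initialisation
  and \<open>\<sigma> t\<close> the state after the update for \<open>z t\<close>; \<open>T 0\<close> and \<open>T t\<close> are the corresponding times.
\<close>

definition stream_run ::
  "streaming_alg \<Rightarrow> nat \<Rightarrow> nat \<Rightarrow> (nat \<Rightarrow> vect) \<Rightarrow> nat \<Rightarrow> (nat \<Rightarrow> nat) \<Rightarrow> (nat \<Rightarrow> state) \<Rightarrow> bool"
  where "stream_run A d s z n T \<sigma> \<longleftrightarrow> d \<le> s \<and>
    exec d s (init_prog A) start_state (T 0) (\<sigma> 0) \<and>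
    (\<forall>t<n. exec d s (update_prog A) (feed d (z (Suc t)) (\<sigma> t)) (T (Suc t)) (\<sigma> (Suc t)))"

text \<open>Reading an arriving point is charged \<open>d\<close> steps.\<close>

definition total_time :: "nat \<Rightarrow> nat \<Rightarrow> (nat \<Rightarrow> nat) \<Rightarrow> nat"
  where "total_time d n T = T 0 + (\<Sum>t=1..n. d + T t)"

text \<open>
  Output layout: the center occupies the \<open>d\<close> cells after the input, followed by a \<open>d\<times>d\<close> matrix in
  row-major order whose image of the unit ball is the ellipsoid, followed by the approximation
  factor.
\<close>

definition out_center :: "nat \<Rightarrow> state \<Rightarrow> vect"
  where "out_center d \<sigma> = (\<lambda>i. if i < d then mem \<sigma> (d + i) else 0)"

definition out_ellipsoid :: "nat \<Rightarrow> state \<Rightarrow> vect set"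
  where "out_ellipsoid d \<sigma> = mat_ellipsoid d (\<lambda>i j. mem \<sigma> (2 * d + i * d + j))"

definition out_factor :: "nat \<Rightarrow> state \<Rightarrow> real"
  where "out_factor d \<sigma> = mem \<sigma> (2 * d + d * d)"

end

theory Submission
  imports Defs "Jordan_Normal_Form.Determinant"
begin

text \<open>
  The algorithm keeps a few of the points, in number \<open>W\<close>, through their mean \<open>c\<close> and a factor \<open>L\<close>
  of their scatter matrix \<open>\<Sum> (y - c) (y - c)\<^sup>T = L L\<^sup>T\<close>, and outputs the center \<open>c\<close>, the
  ellipsoid \<open>L B\<close> for the unit ball \<open>B\<close> and \<open>\<alpha> = 1 / W\<close>.  An arriving point \<open>z\<close> is kept if it is
  outside the affine hull of the kept points or if its leverage \<open>|p|\<^sup>2 + 1 / W\<close>, where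
  \<open>z - c = L p\<close>, exceeds 1; this is a rank-one update.

  Rounding.  All points \<open>z\<close> seen so far satisfy \<open>f(z)\<^sup>2 \<le> \<Sum> f(y)\<^sup>2\<close> for every affine functional
  \<open>f\<close>, where \<open>y\<close> ranges over the kept points; this is preserved by keeping further points and says
  that all leverages are at most 1.  Hence \<open>z \<in> c + L B\<close>.  Conversely
  \<open>c + L v / W = \<Sum> (1 + v \<bullet> p\<^sub>y) / W y\<close>, where \<open>y - c = L p\<^sub>y\<close>, is a convex
  combination for \<open>|v| \<le> 1\<close> since \<open>|p\<^sub>y| \<le> 1\<close>.

  Counting.  Complete the \<open>k = d\<^sub>t\<close> nonzero columns of \<open>L\<close> by unit vectors to an invertible matrix
  \<open>H\<close>, and write \<open>H = B T\<close> with an integer matrix \<open>B\<close> whose columns are differences of points or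
  unit vectors, so that \<open>|det B| \<ge> 1\<close>.  A point outside the affine hull multiplies \<open>(det T)\<^sup>2\<close> by
  \<open>W / (W + 1)\<close>, every other kept point by at least \<open>2 W / (W + 1)\<close>, so
  \<open>(det H)\<^sup>2 \<ge> 2 ^ (W - 1 - k) / W\<close>.  As the entries of \<open>L\<close> are at most \<open>\<surd>W N\<close>, also
  \<open>|det H| \<le> k! (\<surd>W N) ^ k\<close>, and \<open>W = O(k log (d N))\<close> follows.
\<close>

section \<open>Determinants: product rule, integrality, rank-one perturbation, upper bound\<close>

section \<open>Determinants\<close>

definition kron :: "nat \<Rightarrow> nat \<Rightarrow> real"
  where "kron i j = (if i = j then 1 else 0)"

lemma sum_kron [simp]:
  assumes "i < d"
  shows "(\<Sum>l<d. kron i l * f l) = f i" "(\<Sum>l<d. f l * kron l i) = f i"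
    "(\<Sum>l<d. kron l i * f l) = f i" "(\<Sum>l<d. f l * kron i l) = f i"
  using assms
  by (simp_all add: kron_def if_distrib[where f = "\<lambda>x. x * _"] if_distrib[where f = "\<lambda>x. _ * x"]
      cong: if_cong)

text \<open>Only the entries with both indices below \<open>d\<close> count. Matrices as functions
  fit the variable dimension, and sums over \<open>l<d\<close> can be read directly as matrix
  products.\<close>

definition fdet :: "nat \<Rightarrow> (nat \<Rightarrow> nat \<Rightarrow> real) \<Rightarrow> real"
  where "fdet d A = det (Matrix.mat d d (\<lambda>(i, j). A i j))"

lemma fdet_cong:
  assumes "\<And>i j. i < d \<Longrightarrow> j < d \<Longrightarrow> A i j = B i j"
  shows "fdet d A = fdet d B"
proof -
  have "Matrix.mat d d (\<lambda>(i, j). A i j) = Matrix.mat d d (\<lambda>(i, j). B i j)"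
    using assms by (intro eq_matI) auto
  then show ?thesis by (simp add: fdet_def)
qed

lemma fdet_id: "fdet d kron = 1"
proof -
  have "Matrix.mat d d (\<lambda>(i, j). kron i j) = 1\<^sub>m d"
    by (intro eq_matI) (auto simp: kron_def)
  then show ?thesis by (simp add: fdet_def)
qed

lemma fdet_mult: "fdet d (\<lambda>i j. \<Sum>l<d. A i l * B l j) = fdet d A * fdet d B"
proof -
  have "Matrix.mat d d (\<lambda>(i, j). \<Sum>l<d. A i l * B l j)
      = Matrix.mat d d (\<lambda>(i, j). A i j) * Matrix.mat d d (\<lambda>(i, j). B i j)"
    by (intro eq_matI) (auto simp: scalar_prod_def lessThan_atLeast0 intro!: sum.cong)
  then show ?thesis
    unfolding fdet_def by (simp add: det_mult[of _ d])
qed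

text \<open>By the Leibniz formula. A nonzero determinant of an integer matrix then has absolute
  value at least 1, which is how the integrality of the input enters the count.\<close>

lemma fdet_Ints:
  assumes "\<And>i j. i < d \<Longrightarrow> j < d \<Longrightarrow> A i j \<in> \<int>"
  shows "fdet d A \<in> \<int>"
proof -
  have "Matrix.mat d d (\<lambda>(i, j). A i j) $$ (i, p i) \<in> \<int>"
    if "p permutes {0..<d}" "i < d" for p i
    using that assms permutes_in_image[OF that(1), of i] by simp
  then show ?thesis
    unfolding fdet_def det_def by (auto simp: sign_def intro!: Ints_sum Ints_mult Ints_prod)
qed

text \<open>Block elimination in dimension \<open>d + 1\<close>.\<close>

lemma fdet_id_plus_outer:
  "fdet d (\<lambda>i j. kron i j + a i * b j) = 1 + (\<Sum>i<d. a i * b i)"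
proof -
  define A where "A = Matrix.mat d d (\<lambda>(i, j). kron i j + a i * b j)"
  define ca where "ca = Matrix.mat d 1 (\<lambda>(i, j). a i)"
  define rb where "rb = Matrix.mat 1 d (\<lambda>(i, j). b j)"
  define rA where "rA = Matrix.mat 1 d (\<lambda>(i, j). - b j)"
  have [simp]: "A \<in> carrier_mat d d" "ca \<in> carrier_mat d (Suc 0)"
      "rb \<in> carrier_mat (Suc 0) d" "rA \<in> carrier_mat (Suc 0) d"
    by (auto simp: A_def ca_def rb_def rA_def)
  \<comment> \<open>\<open>U\<close> and \<open>U'\<close> are unit triangular. Multiplying
    \<open>V\<close> by \<open>U'\<close> on the right removes the outer product from the upper left
    block and leaves the row \<open>- b\<close> below; \<open>U\<close> on the left clears this row
    and puts the Schur complement in the corner.\<close>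
  define U where "U = four_block_mat (1\<^sub>m d) (0\<^sub>m d 1) rb (1\<^sub>m 1)"
  define V where "V = four_block_mat A ca (0\<^sub>m 1 d) (1\<^sub>m 1)"
  define U' where "U' = four_block_mat (1\<^sub>m d) (0\<^sub>m d 1) rA (1\<^sub>m 1)"
  define D where "D = Matrix.mat 1 1 (\<lambda>(i, j). 1 + (\<Sum>i<d. a i * b i))"
  define Z where "Z = four_block_mat (1\<^sub>m d) ca (0\<^sub>m 1 d) D"
  have [simp]: "D \<in> carrier_mat (Suc 0) (Suc 0)" by (simp add: D_def)
  have UC: "U \<in> carrier_mat (d + 1) (d + 1)" "V \<in> carrier_mat (d + 1) (d + 1)" "U' \<in> carrier_mat (d + 1) (d + 1)"
    unfolding U_def V_def U'_def by (intro four_block_carrier_mat; simp)+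
  have UV: "V * U' = four_block_mat (1\<^sub>m d) ca rA (1\<^sub>m 1)"
  proof -
    have "A + ca * rA = 1\<^sub>m d"
      by (intro eq_matI) (auto simp: A_def ca_def rA_def scalar_prod_def kron_def)
    moreover have "A * 1\<^sub>m d = A" "ca * 1\<^sub>m (Suc 0) = ca" "A * 0\<^sub>m d (Suc 0) = 0\<^sub>m d (Suc 0)"
        "1\<^sub>m (Suc 0) * rA = rA" "0\<^sub>m d (Suc 0) + ca = ca" "0\<^sub>m (Suc 0) d + rA = rA"
      by (simp_all add: right_mult_one_mat[of A d d] right_mult_one_mat[of ca d "Suc 0"]
          right_mult_zero_mat[of A d d] left_mult_one_mat[of rA "Suc 0" d]
          left_add_zero_mat[of ca d "Suc 0"] left_add_zero_mat[of rA "Suc 0" d])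
    ultimately show ?thesis
      unfolding V_def U'_def
      by (subst mult_four_block_mat[of _ d d _ 1 _ 1 _ _ d _ 1]) simp_all
  qed
  have "U * (V * U') = Z"
  proof -
    have "rb * 1\<^sub>m d + 1\<^sub>m 1 * rA = 0\<^sub>m 1 d"
      by (intro eq_matI) (auto simp: rb_def rA_def)
    moreover have "rb * ca + 1\<^sub>m 1 * 1\<^sub>m 1 = D"
      by (intro eq_matI) (auto simp: rb_def ca_def D_def scalar_prod_def lessThan_atLeast0 mult.commute)
    moreover have "1\<^sub>m d + 0\<^sub>m d (Suc 0) * rA = 1\<^sub>m d" "1\<^sub>m d * ca + 0\<^sub>m d (Suc 0) = ca"
      by (simp_all add: left_mult_zero_mat[of rA "Suc 0" d] left_mult_one_mat[of ca d "Suc 0"]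
          right_add_zero_mat[of ca d "Suc 0"] right_add_zero_mat[of "1\<^sub>m d" d d])
    ultimately show ?thesis
      unfolding UV U_def Z_def
      by (subst mult_four_block_mat[of _ d d _ 1 _ 1 _ _ d _ 1]) simp_all
  qed
  moreover have "det U = 1" "det U' = 1"
    unfolding U_def U'_def by (simp_all add: det_four_block_mat_upper_right_zero[of _ d _ 1])
  moreover have "det V = det A"
    unfolding V_def by (simp add: det_four_block_mat_lower_left_zero[of _ d _ 1])
  moreover have "det Z = 1 + (\<Sum>i<d. a i * b i)"
    unfolding Z_def by (simp add: det_four_block_mat_lower_left_zero[of _ d _ 1] det_single D_def)
  moreover have "det (U * (V * U')) = det U * (det V * det U')"
    using UC by (simp add: det_mult[of _ "d + 1"])
  ultimately show ?thesis
    by (simp add: fdet_def A_def)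
qed

text \<open>Row \<open>j\<close> of both matrices is a multiple of the unit row, so expansion along
  it sees only the common minor, and column \<open>j\<close> may differ arbitrarily off the
  diagonal.\<close>

lemma fdet_replace_col:
  assumes j: "j < d"
    and A: "\<And>i. i < d \<Longrightarrow> A j i = kron j i"
    and B: "\<And>i. i < d \<Longrightarrow> B j i = r * kron j i"
    and AB: "\<And>i l. i < d \<Longrightarrow> l < d \<Longrightarrow> i \<noteq> j \<Longrightarrow> l \<noteq> j \<Longrightarrow> B i l = A i l"
  shows "fdet d B = r * fdet d A"
proof -
  define MA where "MA = Matrix.mat d d (\<lambda>(i, j). A i j)"
  define MB where "MB = Matrix.mat d d (\<lambda>(i, j). B i j)"
  have cofeq: "cofactor MB j j = cofactor MA j j"
  proof -
    have "mat_delete MB j j = mat_delete MA j j"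
      unfolding mat_delete_def MA_def MB_def using j by (intro eq_matI) (auto intro!: AB)
    then show ?thesis by (simp add: cofactor_def)
  qed
  have "det MA = (\<Sum>i<d. MA $$ (j, i) * cofactor MA j i)"
    using laplace_expansion_row[of MA d j] j by (simp add: MA_def)
  also have "\<dots> = (\<Sum>i<d. if i = j then cofactor MA j j else 0)"
    using j A by (intro sum.cong) (auto simp: MA_def kron_def)
  finally have a: "det MA = cofactor MA j j" using j by simp
  have "det MB = (\<Sum>i<d. MB $$ (j, i) * cofactor MB j i)"
    using laplace_expansion_row[of MB d j] j by (simp add: MB_def)
  also have "\<dots> = (\<Sum>i<d. if i = j then r * cofactor MB j j else 0)"
    using j B by (intro sum.cong) (auto simp: MB_def kron_def)
  finally have "det MB = r * cofactor MB j j" using j by simp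
  with a cofeq show ?thesis by (simp add: fdet_def MA_def MB_def)
qed

text \<open>The columns outside \<open>F\<close> are unit vectors, so only permutations that fix
  every index outside \<open>F\<close> contribute to the Leibniz formula, and there are
  \<open>fact (card F)\<close> of them. The factorial costs a term \<open>k ln k\<close> later on,
  which is within the final bound.\<close>

lemma fdet_bound:
  assumes F: "F \<subseteq> {..<d}"
    and unit: "\<And>i j. i < d \<Longrightarrow> j < d \<Longrightarrow> j \<notin> F \<Longrightarrow> A i j = kron i j"
    and bound: "\<And>i j. i < d \<Longrightarrow> j \<in> F \<Longrightarrow> \<bar>A i j\<bar> \<le> C"
  shows "\<bar>fdet d A\<bar> \<le> fact (card F) * C ^ card F"
proof -
  have finF: "finite F" using F finite_subset by blast
  let ?M = "Matrix.mat d d (\<lambda>(i, j). A i j)"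
  let ?t = "\<lambda>p. \<Prod>j = 0..<d. A (p j) j"
  have "fdet d A = (\<Sum>p | p permutes {0..<d}. signof p * (\<Prod>j = 0..<d. ?M $$ (p j, j)))"
    unfolding fdet_def using det_col[of ?M d] by (simp add: atLeast0LessThan)
  also have "\<dots> = (\<Sum>p | p permutes {0..<d}. signof p * ?t p)"
    by (intro sum.cong refl arg_cong2[where f = "(*)"] prod.cong)
       (auto dest: permutes_in_image)
  also have "\<dots> = (\<Sum>p | p permutes F. signof p * ?t p)"
  proof (rule sum.mono_neutral_right)
    show "finite {p. p permutes {0..<d}}" by (simp add: finite_permutations)
    show "{p. p permutes F} \<subseteq> {p. p permutes {0..<d}}"
      using F permutes_subset[of _ F "{0..<d}"] by (auto simp: atLeast0LessThan)
    show "\<forall>p\<in>{p. p permutes {0..<d}} - {p. p permutes F}. signof p * ?t p = 0"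
    proof
      fix p assume p: "p \<in> {p. p permutes {0..<d}} - {p. p permutes F}"
      then have pd: "p permutes {0..<d}" by simp
      \<comment> \<open>A permutation that is not one of \<open>F\<close> moves some
        \<open>j\<close> outside \<open>F\<close>; the unit column \<open>j\<close> then has a zero
        in row \<open>p j\<close>.\<close>
      have "\<exists>j. j \<notin> F \<and> p j \<noteq> j"
        using p pd by (auto simp: permutes_def)
      then obtain j where j: "j \<notin> F" "p j \<noteq> j" by blast
      then have "j < d" using pd by (metis atLeastLessThan_iff le0 permutes_not_in)
      then have "A (p j) j = 0"
        using unit[of "p j" j] j permutes_in_image[OF pd, of j] by (simp add: kron_def)
      then have "?t p = 0" using \<open>j < d\<close> by (intro prod_zero) auto
      then show "signof p * ?t p = 0" by simp
    qed
  qed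
  finally have eq: "fdet d A = (\<Sum>p | p permutes F. signof p * ?t p)" .
  have le: "\<bar>?t p\<bar> \<le> C ^ card F" if p: "p permutes F" for p
  proof -
    have "?t p = (\<Prod>j\<in>F. A (p j) j)"
    proof (rule prod.mono_neutral_right)
      show "\<forall>j\<in>{0..<d} - F. A (p j) j = 1"
        using p unit by (auto simp: permutes_not_in kron_def)
    qed (use F in auto)
    then have "\<bar>?t p\<bar> = (\<Prod>j\<in>F. \<bar>A (p j) j\<bar>)" by (simp add: abs_prod)
    also have "\<dots> \<le> (\<Prod>j\<in>F. C)"
      using bound F permutes_in_image[OF p] by (intro prod_mono) (auto intro!: bound)
    finally show ?thesis by simp
  qed
  have "\<bar>fdet d A\<bar> \<le> (\<Sum>p | p permutes F. \<bar>signof p * ?t p\<bar>)"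
    unfolding eq by (rule sum_abs)
  also have "\<dots> \<le> (\<Sum>p | p permutes F. C ^ card F)"
    using le by (intro sum_mono) (auto simp: abs_mult sign_def)
  also have "\<dots> = fact (card F) * C ^ card F"
    using card_permutations[OF refl finF] by simp
  finally show ?thesis .
qed

section \<open>Weighted Cauchy-Schwarz inequality and rank-one updates of an inverse\<close>

section \<open>Rounding by a subset of the points\<close>

lemma sum_square_product:
  fixes f :: "'a \<Rightarrow> real"
  shows "(\<Sum>i\<in>A. f i)\<^sup>2 = (\<Sum>i\<in>A. \<Sum>l\<in>A. f i * f l)"
  by (simp add: power2_eq_square sum_product)

lemma sum_vect_apply: "(\<Sum>m\<in>A. f m) i = (\<Sum>m\<in>A. (f m :: vect) i)"
  by (induction A rule: infinite_finite_induct) simp_all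

text \<open>The Cauchy-Schwarz inequality for \<open>p\<close> extended by \<open>1 / sqrt w\<close>
  and \<open>h\<close> extended by \<open>sqrt w * s\<close>. With \<open>w\<close> the number of
  kept points, the first factor is a leverage and the second the right-hand side of
  \<open>quadratic_form\<close>.\<close>

lemma cauchy_schwarz_plus:
  fixes p h :: "'a \<Rightarrow> real"
  assumes "0 < w"
  shows "((\<Sum>j\<in>A. p j * h j) + s)\<^sup>2 \<le> ((\<Sum>j\<in>A. (p j)\<^sup>2) + 1 / w) * ((\<Sum>j\<in>A. (h j)\<^sup>2) + w * s\<^sup>2)"
proof -
  define P Q R where "P = (\<Sum>j\<in>A. (p j)\<^sup>2)" and "Q = (\<Sum>j\<in>A. (h j)\<^sup>2)" and "R = (\<Sum>j\<in>A. p j * h j)"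
  \<comment> \<open>This square bounds the mixed term: divided by \<open>w\<close> it reads
    \<open>2 s R <= w s^2 P + Q / w\<close>.\<close>
  have "0 \<le> (\<Sum>j\<in>A. (w * s * p j - h j)\<^sup>2)"
    by (simp add: sum_nonneg)
  also have "\<dots> = (w * s)\<^sup>2 * P - 2 * (w * s) * R + Q"
    by (simp add: P_def Q_def R_def power2_eq_square algebra_simps sum.distrib sum_subtractf
        sum_distrib_left)
  finally have "2 * (w * s) * R \<le> (w * s)\<^sup>2 * P + Q" by simp
  then have "2 * (w * s) * R / w \<le> ((w * s)\<^sup>2 * P + Q) / w"
    using assms by (intro divide_right_mono) auto
  then have "2 * s * R \<le> w * s\<^sup>2 * P + Q / w"
    using assms by (simp add: field_simps power2_eq_square)
  moreover have "R\<^sup>2 \<le> P * Q"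
    unfolding P_def Q_def R_def by (rule Cauchy_Schwarz_ineq_sum)
  moreover have "(P + 1 / w) * (Q + w * s\<^sup>2) = P * Q + w * s\<^sup>2 * P + Q / w + s\<^sup>2"
    using assms by (simp add: field_simps)
  moreover have "(R + s)\<^sup>2 = R\<^sup>2 + 2 * s * R + s\<^sup>2"
    by (simp add: power2_eq_square algebra_simps)
  ultimately show ?thesis
    by (simp add: P_def Q_def R_def)
qed

text \<open>The Sherman-Morrison formula for \<open>H + h b\<close> with a row vector
  \<open>b\<close>: \<open>\<gamma>\<close> stands for \<open>1 + b G h\<close>, \<open>r\<close>
  for \<open>b G\<close>, and \<open>\<alpha>'\<close> for entry \<open>i\<close> of
  \<open>G h / \<gamma>\<close>. It is stated for a single row \<open>i\<close>.\<close>

lemma rank_one_left_inverse: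
  assumes GH: "\<And>j. j < d \<Longrightarrow> (\<Sum>l<d. G i l * H l j) = kron i j"
    and Gh: "(\<Sum>l<d. G i l * h l) = \<alpha>"
    and rH: "\<And>j. j < d \<Longrightarrow> (\<Sum>l<d. r l * H l j) = b j"
    and rh: "(\<Sum>l<d. r l * h l) = \<gamma> - 1"
    and \<alpha>: "\<alpha> = \<gamma> * \<alpha>'" and j: "j < d"
  shows "(\<Sum>l<d. (G i l - \<alpha>' * r l) * (H l j + h l * b j)) = kron i j"
proof -
  have "(\<Sum>l<d. (G i l - \<alpha>' * r l) * (H l j + h l * b j))
      = (\<Sum>l<d. G i l * H l j) + (\<Sum>l<d. G i l * h l) * b j
        - \<alpha>' * (\<Sum>l<d. r l * H l j) - \<alpha>' * (\<Sum>l<d. r l * h l) * b j"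
  proof -
    have "(G i l - \<alpha>' * r l) * (H l j + h l * b j)
        = G i l * H l j + b j * (G i l * h l) - \<alpha>' * (r l * H l j) - \<alpha>' * b j * (r l * h l)" for l
      by (simp add: algebra_simps)
    then show ?thesis
      by (simp add: sum.distrib sum_subtractf sum_distrib_left[symmetric])
  qed
  also have "\<dots> = kron i j"
    unfolding GH[OF j] Gh rH[OF j] rh \<alpha> by (simp add: algebra_simps)
  finally show ?thesis .
qed

text \<open>The same update as a right inverse. The invariant keeps both sides: the left inverse
  gives the uniqueness of coordinates, the right one their existence.\<close>

lemma rank_one_right_inverse:
  assumes HG: "\<And>j. j < d \<Longrightarrow> (\<Sum>l<d. H i l * G l j) = kron i j"
    and Ha: "(\<Sum>l<d. H i l * a' l) * \<gamma> = h i"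
    and br: "\<And>j. j < d \<Longrightarrow> (\<Sum>l<d. b l * G l j) = r j"
    and ba: "(\<Sum>l<d. b l * a' l) * \<gamma> = \<gamma> - 1"
    and \<gamma>: "\<gamma> \<noteq> 0" and j: "j < d"
  shows "(\<Sum>l<d. (H i l + h i * b l) * (G l j - a' l * r j)) = kron i j"
proof -
  have Ha': "(\<Sum>l<d. H i l * a' l) = h i / \<gamma>"
    using Ha \<gamma> by (simp add: field_simps)
  have ba': "(\<Sum>l<d. b l * a' l) = 1 - 1 / \<gamma>"
    using ba \<gamma> by (simp add: field_simps)
  have "(\<Sum>l<d. (H i l + h i * b l) * (G l j - a' l * r j))
      = (\<Sum>l<d. H i l * G l j) - (\<Sum>l<d. H i l * a' l) * r j
        + h i * (\<Sum>l<d. b l * G l j) - h i * (\<Sum>l<d. b l * a' l) * r j"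
  proof -
    have "(H i l + h i * b l) * (G l j - a' l * r j)
        = H i l * G l j - r j * (H i l * a' l) + h i * (b l * G l j) - h i * r j * (b l * a' l)" for l
      by (simp add: algebra_simps)
    then show ?thesis
      by (simp add: sum.distrib sum_subtractf sum_distrib_left[symmetric])
  qed
  also have "\<dots> = kron i j"
    unfolding HG[OF j] Ha' br[OF j] ba' by (simp add: algebra_simps)
  finally show ?thesis .
qed

section \<open>The invariant of the algorithm and the two inclusions\<close>

definition completed :: "nat set \<Rightarrow> (nat \<Rightarrow> nat \<Rightarrow> real) \<Rightarrow> nat \<Rightarrow> nat \<Rightarrow> real"
  where "completed F L i j = (if j \<in> F then L i j else kron i j)"

text \<open>\<open>completed F L\<close> is the matrix \<open>H\<close> of the overview,
  \<open>G\<close> is its inverse, and \<open>F\<close> holds the indices of the nonzero columns of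
  \<open>L\<close>. The condition \<open>dominated\<close> says that leverages are at most 1, but
  mentions neither \<open>c\<close> nor \<open>L\<close>: it only compares points, hence it survives
  when the kept family grows and the ellipsoid changes.\<close>

locale rounding =
  fixes d :: nat and S :: "vect set" and W :: nat and y :: "nat \<Rightarrow> vect"
    and c :: vect and L G :: "nat \<Rightarrow> nat \<Rightarrow> real" and F :: "nat set"
  assumes S_Rspace: "S \<subseteq> Rspace d"
    and W_pos: "0 < W"
    and y_in_S: "m < W \<Longrightarrow> y m \<in> S"
    and F_sub: "F \<subseteq> {..<d}"
    and center: "c i = (\<Sum>m<W. y m i) / real W"
    and L_inactive: "i < d \<Longrightarrow> j < d \<Longrightarrow> j \<notin> F \<Longrightarrow> L i j = 0"
    and scatter: "i < d \<Longrightarrow> l < d \<Longrightarrow>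
      (\<Sum>m<W. (y m i - c i) * (y m l - c l)) = (\<Sum>j\<in>F. L i j * L l j)"
    and left_inverse: "i < d \<Longrightarrow> j < d \<Longrightarrow> (\<Sum>l<d. G i l * completed F L l j) = kron i j"
    and right_inverse: "i < d \<Longrightarrow> j < d \<Longrightarrow> (\<Sum>l<d. completed F L i l * G l j) = kron i j"
    and dominated: "z \<in> S \<Longrightarrow>
      ((\<Sum>i<d. g i * z i) + s)\<^sup>2 \<le> (\<Sum>m<W. ((\<Sum>i<d. g i * y m i) + s)\<^sup>2)"
begin

text \<open>The vector \<open>p\<close> of the overview, the solution of \<open>H p = z - c\<close>.
  The point \<open>z\<close> is in the affine hull of the kept points exactly if its coordinates
  outside \<open>F\<close> vanish.\<close>

definition coord :: "vect \<Rightarrow> vect"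
  where "coord z j = (if j < d then \<Sum>l<d. G j l * (z l - c l) else 0)"

lemma finite_F [simp]: "finite F"
  using F_sub finite_subset by blast

lemma F_less: "j \<in> F \<Longrightarrow> j < d"
  using F_sub by blast

lemma sum_points: "(\<Sum>m<W. y m i) = real W * c i"
  using W_pos by (simp add: center)

lemma sum_deviation: "(\<Sum>m<W. y m i - c i) = 0"
  by (simp add: sum_subtractf sum_points)

text \<open>Decomposition into variance and squared mean: the deviations from the center sum to
  zero, so the mixed terms vanish, and the scatter matrix contributes the squared norm of
  \<open>g L\<close>.\<close>

lemma quadratic_form:
  "(\<Sum>m<W. ((\<Sum>i<d. g i * y m i) + s)\<^sup>2)
    = (\<Sum>j\<in>F. (\<Sum>i<d. g i * L i j)\<^sup>2) + real W * ((\<Sum>i<d. g i * c i) + s)\<^sup>2"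
proof -
  define \<sigma> where "\<sigma> = (\<Sum>i<d. g i * c i) + s"
  define e where "e m = (\<Sum>i<d. g i * (y m i - c i))" for m
  have "(\<Sum>m<W. e m) = (\<Sum>i<d. g i * (\<Sum>m<W. y m i - c i))"
    unfolding e_def by (subst sum.swap) (simp add: sum_distrib_left)
  then have e0: "(\<Sum>m<W. e m) = 0"
    by (simp add: sum_deviation)
  have "(\<Sum>m<W. (e m)\<^sup>2)
      = (\<Sum>m<W. \<Sum>i<d. \<Sum>l<d. g i * g l * ((y m i - c i) * (y m l - c l)))"
    unfolding e_def sum_square_product by (simp add: algebra_simps)
  also have "\<dots> = (\<Sum>i<d. \<Sum>m<W. \<Sum>l<d. g i * g l * ((y m i - c i) * (y m l - c l)))"
    by (rule sum.swap)
  also have "\<dots> = (\<Sum>i<d. \<Sum>l<d. \<Sum>m<W. g i * g l * ((y m i - c i) * (y m l - c l)))"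
    by (intro sum.cong refl sum.swap)
  also have "\<dots> = (\<Sum>i<d. \<Sum>l<d. g i * g l * (\<Sum>j\<in>F. L i j * L l j))"
    by (intro sum.cong refl) (simp add: scatter sum_distrib_left[symmetric])
  also have "\<dots> = (\<Sum>i<d. \<Sum>l<d. \<Sum>j\<in>F. (g i * L i j) * (g l * L l j))"
    by (simp add: sum_distrib_left algebra_simps)
  also have "\<dots> = (\<Sum>i<d. \<Sum>j\<in>F. \<Sum>l<d. (g i * L i j) * (g l * L l j))"
    by (intro sum.cong refl sum.swap)
  also have "\<dots> = (\<Sum>j\<in>F. \<Sum>i<d. \<Sum>l<d. (g i * L i j) * (g l * L l j))"
    by (rule sum.swap)
  finally have e2: "(\<Sum>m<W. (e m)\<^sup>2) = (\<Sum>j\<in>F. (\<Sum>i<d. g i * L i j)\<^sup>2)"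
    by (simp add: sum_square_product)
  have "(\<Sum>i<d. g i * y m i) + s = e m + \<sigma>" for m
    by (simp add: e_def \<sigma>_def right_diff_distrib sum_subtractf)
  then have "(\<Sum>m<W. ((\<Sum>i<d. g i * y m i) + s)\<^sup>2) = (\<Sum>m<W. (e m)\<^sup>2 + 2 * \<sigma> * e m + \<sigma>\<^sup>2)"
    by (simp add: power2_sum algebra_simps)
  also have "\<dots> = (\<Sum>m<W. (e m)\<^sup>2) + 2 * \<sigma> * (\<Sum>m<W. e m) + real W * \<sigma>\<^sup>2"
    by (simp add: sum.distrib sum_distrib_left)
  finally show ?thesis
    by (simp add: e0 e2 \<sigma>_def)
qed

lemma reconstruct: "i < d \<Longrightarrow> (\<Sum>j<d. completed F L i j * coord z j) = z i - c i"
proof -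
  assume i: "i < d"
  have "(\<Sum>j<d. completed F L i j * coord z j)
      = (\<Sum>j<d. \<Sum>l<d. completed F L i j * G j l * (z l - c l))"
    by (simp add: coord_def sum_distrib_left algebra_simps)
  also have "\<dots> = (\<Sum>l<d. (\<Sum>j<d. completed F L i j * G j l) * (z l - c l))"
    by (subst sum.swap) (simp add: sum_distrib_right)
  also have "\<dots> = (\<Sum>l<d. kron i l * (z l - c l))"
    using i by (intro sum.cong) (auto simp: right_inverse)
  finally show ?thesis using i by simp
qed

lemma sum_active: "(\<And>j. j < d \<Longrightarrow> j \<notin> F \<Longrightarrow> f j = 0) \<Longrightarrow> (\<Sum>j<d. f j) = (\<Sum>j\<in>F. f j)"
  using F_sub by (intro sum.mono_neutral_right) auto

lemma reconstruct_active:
  assumes "\<And>j. j < d \<Longrightarrow> j \<notin> F \<Longrightarrow> coord z j = 0" and i: "i < d"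
  shows "(\<Sum>j\<in>F. L i j * coord z j) = z i - c i"
proof -
  have "z i - c i = (\<Sum>j\<in>F. completed F L i j * coord z j)"
    using sum_active[of "\<lambda>j. completed F L i j * coord z j"] reconstruct[OF i, of z] assms by simp
  then show ?thesis by (simp add: completed_def)
qed

text \<open>The functional \<open>g\<close>, which is \<open>a G\<close>, has the value
  \<open>a j\<close> on the active column \<open>j\<close> of \<open>L\<close>, so
  \<open>quadratic_form\<close> turns the domination of \<open>z\<close> into an inequality about
  its coordinates.\<close>

lemma coord_quadratic:
  assumes z: "z \<in> S"
  shows "((\<Sum>j<d. a j * coord z j) + s)\<^sup>2 \<le> (\<Sum>j\<in>F. (a j)\<^sup>2) + real W * s\<^sup>2"
proof -
  define g where "g l = (\<Sum>j<d. a j * G j l)" for l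
  have eq: "(\<Sum>j<d. a j * (\<Sum>l<d. G j l * x l)) = (\<Sum>l<d. g l * x l)" for x :: vect
  proof -
    have "(\<Sum>j<d. a j * (\<Sum>l<d. G j l * x l)) = (\<Sum>j<d. \<Sum>l<d. a j * G j l * x l)"
      by (simp add: sum_distrib_left algebra_simps)
    also have "\<dots> = (\<Sum>l<d. g l * x l)"
      unfolding g_def by (subst sum.swap) (simp add: sum_distrib_right)
    finally show ?thesis .
  qed
  have gL: "(\<Sum>l<d. g l * L l j) = a j" if j: "j \<in> F" for j
  proof -
    have "(\<Sum>l<d. g l * L l j) = (\<Sum>i<d. a i * (\<Sum>l<d. G i l * completed F L l j))"
      using j by (simp add: eq completed_def)
    also have "\<dots> = (\<Sum>i<d. a i * kron i j)"
      using F_less[OF j] by (intro sum.cong) (auto simp: left_inverse)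
    finally show ?thesis using F_less[OF j] by simp
  qed
  have "(\<Sum>j<d. a j * coord z j) = (\<Sum>l<d. g l * (z l - c l))"
    unfolding eq[symmetric] by (simp add: coord_def)
  then have "(\<Sum>j<d. a j * coord z j) + s = (\<Sum>l<d. g l * z l) + (s - (\<Sum>l<d. g l * c l))"
    by (simp add: right_diff_distrib sum_subtractf)
  then have "((\<Sum>j<d. a j * coord z j) + s)\<^sup>2
      \<le> (\<Sum>m<W. ((\<Sum>i<d. g i * y m i) + (s - (\<Sum>l<d. g l * c l)))\<^sup>2)"
    by (simp only: dominated[OF z])
  also have "\<dots> = (\<Sum>j\<in>F. (a j)\<^sup>2) + real W * s\<^sup>2"
    unfolding quadratic_form by (simp add: gL)
  finally show ?thesis .
qed

text \<open>For \<open>a\<close> the unit vector of an inactive index and \<open>s = 0\<close> the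
  right-hand side of \<open>coord_quadratic\<close> is zero.\<close>

lemma coord_inactive: "z \<in> S \<Longrightarrow> j < d \<Longrightarrow> j \<notin> F \<Longrightarrow> coord z j = 0"
proof -
  assume z: "z \<in> S" and j: "j < d" "j \<notin> F"
  have "(\<Sum>i\<in>F. (kron j i)\<^sup>2) = 0"
    using j by (intro sum.neutral) (auto simp: kron_def)
  then show ?thesis
    using coord_quadratic[OF z, of "kron j" 0] j by simp
qed

text \<open>Testing with the coordinates of \<open>z\<close> itself and \<open>s = 1 / W\<close>
  makes both sides of \<open>coord_quadratic\<close> functions of the leverage: its square is at
  most itself, and it is positive.\<close>

lemma coord_norm: "z \<in> S \<Longrightarrow> (\<Sum>j\<in>F. (coord z j)\<^sup>2) + 1 / real W \<le> 1"
proof -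
  assume z: "z \<in> S"
  define T where "T = (\<Sum>j\<in>F. (coord z j)\<^sup>2)"
  have "(\<Sum>j<d. coord z j * coord z j) = T"
    using coord_inactive[OF z] sum_active[of "\<lambda>j. coord z j * coord z j"]
    by (simp add: T_def power2_eq_square)
  then have "(T + 1 / real W)\<^sup>2 \<le> T + real W * (1 / real W)\<^sup>2"
    using coord_quadratic[OF z, of "coord z" "1 / real W"] by (simp add: T_def)
  also have "\<dots> = T + 1 / real W"
    using W_pos by (simp add: power2_eq_square)
  finally have "(T + 1 / real W) * (T + 1 / real W) \<le> 1 * (T + 1 / real W)"
    by (simp add: power2_eq_square)
  moreover have "0 < T + 1 / real W"
    using W_pos by (simp add: T_def sum_nonneg add_nonneg_pos)
  ultimately show ?thesis
    unfolding T_def using mult_le_cancel_right_pos by blast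
qed

lemma center_Rspace: "c \<in> Rspace d"
proof -
  have "y m i = 0" if "m < W" "d \<le> i" for m i
    using y_in_S[OF that(1)] S_Rspace that(2) by (auto simp: Rspace_def)
  then show ?thesis by (simp add: Rspace_def center)
qed

lemma outer_inclusion:
  assumes z: "z \<in> S"
  shows "z - c \<in> mat_ellipsoid d L"
proof -
  have "(\<Sum>i<d. (coord z i)\<^sup>2) = (\<Sum>i\<in>F. (coord z i)\<^sup>2)"
    using coord_inactive[OF z] by (intro sum_active) auto
  also have "\<dots> \<le> 1"
    using coord_norm[OF z] zero_le_divide_1_iff[of "real W"] by linarith
  finally have "sqrt (\<Sum>i<d. (coord z i)\<^sup>2) \<le> 1" by simp
  moreover have "coord z \<in> Rspace d"
    by (simp add: Rspace_def coord_def)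
  moreover have "z - c = mat_apply d L (coord z)"
  proof
    fix i
    show "(z - c) i = mat_apply d L (coord z) i"
    proof (cases "i < d")
      case True
      have "(\<Sum>j<d. L i j * coord z j) = (\<Sum>j\<in>F. L i j * coord z j)"
        using coord_inactive[OF z] by (intro sum_active) auto
      then show ?thesis
        using True reconstruct_active[OF coord_inactive[OF z] True] by (simp add: mat_apply_def)
    next
      case False
      then show ?thesis
        using z S_Rspace center_Rspace by (auto simp: mat_apply_def Rspace_def)
    qed
  qed
  ultimately show ?thesis
    unfolding mat_ellipsoid_def by blast
qed

lemma sum_coord: "j < d \<Longrightarrow> (\<Sum>m<W. coord (y m) j) = 0"
proof -
  assume "j < d"
  then have "(\<Sum>m<W. coord (y m) j) = (\<Sum>m<W. \<Sum>l<d. G j l * (y m l - c l))"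
    by (simp add: coord_def)
  also have "\<dots> = (\<Sum>l<d. G j l * (\<Sum>m<W. y m l - c l))"
    by (subst sum.swap) (simp only: sum_distrib_left)
  finally have "(\<Sum>m<W. coord (y m) j) = (\<Sum>l<d. G j l * (\<Sum>m<W. y m l - c l))" .
  then show ?thesis by (simp add: sum_deviation)
qed

text \<open>In matrix form the left-hand side is \<open>G L L^T\<close>, and \<open>G L\<close> is
  the identity on active indices. This presents the columns of \<open>L\<close> as combinations of
  deviations, for the inner inclusion and for the dimension.\<close>

lemma coord_deviation:
  assumes j: "j \<in> F" and i: "i < d"
  shows "(\<Sum>m<W. coord (y m) j * (y m i - c i)) = L i j"
proof -
  have "(\<Sum>m<W. coord (y m) j * (y m i - c i))
      = (\<Sum>m<W. \<Sum>l<d. G j l * ((y m l - c l) * (y m i - c i)))"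
    using F_less[OF j] by (simp add: coord_def sum_distrib_right mult.assoc)
  also have "\<dots> = (\<Sum>l<d. G j l * (\<Sum>m<W. (y m l - c l) * (y m i - c i)))"
    by (subst sum.swap) (simp add: sum_distrib_left)
  also have "\<dots> = (\<Sum>l<d. G j l * (\<Sum>j'\<in>F. L l j' * L i j'))"
    using i by (simp add: scatter)
  also have "\<dots> = (\<Sum>l<d. \<Sum>j'\<in>F. G j l * completed F L l j' * L i j')"
    by (simp add: sum_distrib_left completed_def algebra_simps)
  also have "\<dots> = (\<Sum>j'\<in>F. (\<Sum>l<d. G j l * completed F L l j') * L i j')"
    by (subst sum.swap) (simp add: sum_distrib_right)
  also have "\<dots> = (\<Sum>j'\<in>F. kron j j' * L i j')"
    using F_less j by (simp add: left_inverse)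
  also have "\<dots> = L i j"
    using j by (simp add: kron_def if_distrib[where f = "\<lambda>x. x * _"] cong: if_cong)
  finally show ?thesis .
qed

lemma inner_inclusion:
  assumes v: "(\<Sum>i<d. (v i)\<^sup>2) \<le> 1"
  shows "c + (1 / real W) *\<^sub>R mat_apply d L v \<in> convex hull S"
proof -
  define \<mu> where "\<mu> m = (1 + (\<Sum>j\<in>F. v j * coord (y m) j)) / real W" for m
  have vF: "(\<Sum>j\<in>F. (v j)\<^sup>2) \<le> 1"
    using v F_sub sum_mono2[of "{..<d}" F "\<lambda>j. (v j)\<^sup>2"] by simp
  have pos: "0 \<le> \<mu> m" if m: "m < W" for m
  proof -
    have "(\<Sum>j\<in>F. v j * coord (y m) j)\<^sup>2 \<le> (\<Sum>j\<in>F. (v j)\<^sup>2) * (\<Sum>j\<in>F. (coord (y m) j)\<^sup>2)"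
      by (rule Cauchy_Schwarz_ineq_sum)
    also have "\<dots> \<le> 1 * 1"
    proof (intro mult_mono)
      show "(\<Sum>j\<in>F. (coord (y m) j)\<^sup>2) \<le> 1"
        using coord_norm[OF y_in_S[OF m]] zero_le_divide_1_iff[of "real W"] by linarith
    qed (use vF in \<open>auto simp: sum_nonneg\<close>)
    finally have "\<bar>\<Sum>j\<in>F. v j * coord (y m) j\<bar> \<le> 1"
      by (simp add: abs_square_le_1)
    then show ?thesis
      unfolding \<mu>_def by (simp add: abs_le_iff)
  qed
  \<comment> \<open>Exchanging the sums reduces the total weight to \<open>sum_coord\<close> and the
    barycenter to \<open>coord_deviation\<close>.\<close>
  have dev: "(\<Sum>m<W. (\<Sum>j\<in>F. v j * coord (y m) j) * f m) = (\<Sum>j\<in>F. v j * (\<Sum>m<W. coord (y m) j * f m))"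
    for f
    by (simp add: sum_distrib_right sum_distrib_left algebra_simps) (rule sum.swap)
  have one: "(\<Sum>m<W. \<mu> m) = 1"
  proof -
    have "(\<Sum>m<W. \<mu> m) = (real W + (\<Sum>m<W. (\<Sum>j\<in>F. v j * coord (y m) j) * 1)) / real W"
      unfolding \<mu>_def by (simp add: sum_divide_distrib[symmetric] sum.distrib)
    then show ?thesis
      unfolding dev using W_pos F_less by (simp add: sum_coord)
  qed
  have "(\<Sum>m<W. \<mu> m *\<^sub>R y m) = c + (1 / real W) *\<^sub>R mat_apply d L v"
  proof
    fix i
    have ev: "(\<Sum>m<W. \<mu> m *\<^sub>R y m) i = (\<Sum>m<W. \<mu> m * y m i)"
      by (simp add: sum_vect_apply scaleR_fun_def)
    show "(\<Sum>m<W. \<mu> m *\<^sub>R y m) i = (c + (1 / real W) *\<^sub>R mat_apply d L v) i"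
    proof (cases "i < d")
      case True
      have "(\<Sum>m<W. \<mu> m * y m i) = (\<Sum>m<W. \<mu> m * (y m i - c i)) + (\<Sum>m<W. \<mu> m) * c i"
        by (simp add: algebra_simps sum_subtractf sum_distrib_left)
      also have "(\<Sum>m<W. \<mu> m * (y m i - c i))
          = ((\<Sum>m<W. y m i - c i) + (\<Sum>m<W. (\<Sum>j\<in>F. v j * coord (y m) j) * (y m i - c i))) / real W"
        unfolding \<mu>_def by (simp add: sum_divide_distrib[symmetric] sum.distrib[symmetric] algebra_simps)
      also have "\<dots> = (\<Sum>j\<in>F. v j * L i j) / real W"
        unfolding dev using True by (simp add: sum_deviation coord_deviation)
      also have "(\<Sum>j\<in>F. v j * L i j) = mat_apply d L v i"
        using True sum_active[of "\<lambda>j. L i j * v j"] L_inactive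
        by (simp add: mat_apply_def mult.commute)
      finally show ?thesis
        unfolding ev using one by (simp add: scaleR_fun_def)
    next
      case False
      then have "y m i = 0" if "m < W" for m
        using y_in_S[OF that] S_Rspace by (auto simp: Rspace_def)
      then show ?thesis
        unfolding ev using False center_Rspace by (simp add: scaleR_fun_def mat_apply_def Rspace_def)
    qed
  qed
  moreover have "(\<Sum>m<W. \<mu> m *\<^sub>R y m) \<in> convex hull S"
    using one pos by (intro convex_sum) (auto intro: hull_inc y_in_S)
  ultimately show ?thesis by simp
qed

end

section \<open>Affine dimension and the effect of an arriving point\<close>

context rounding
begin

text \<open>The active columns of \<open>L\<close> form a basis of the direction space: they are
  independent since the completed matrix is invertible, they are combinations of differences by
  \<open>coord_deviation\<close>, and \<open>S\<close> lies in \<open>c\<close> plus their span by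
  \<open>reconstruct_active\<close>.\<close>

lemma affine_dim_eq: "affine_dim S = card F"
proof -
  define V where "V = {x - x' |x x'. x \<in> affine hull S \<and> x' \<in> affine hull S}"
  define col :: "nat \<Rightarrow> vect" where "col j = (\<lambda>i. if i < d then L i j else 0)" for j
  have eval: "(\<Sum>j\<in>F. a j *\<^sub>R col j) i = (if i < d then \<Sum>j\<in>F. L i j * a j else 0)" for a i
    by (simp add: sum_vect_apply scaleR_fun_def col_def mult.commute)
  have coef: "a j = 0" if eq: "(\<Sum>j\<in>F. a j *\<^sub>R col j) = 0" and j: "j \<in> F" for a j
  proof -
    have z: "(\<Sum>j'\<in>F. L i j' * a j') = 0" if "i < d" for i
      using fun_cong[OF eq, of i] that by (simp add: eval)
    have "a j = (\<Sum>j'\<in>F. kron j j' * a j')"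
      using j by (simp add: kron_def if_distrib[where f = "\<lambda>x. x * _"] cong: if_cong)
    also have "\<dots> = (\<Sum>j'\<in>F. (\<Sum>l<d. G j l * completed F L l j') * a j')"
      using F_less j by (simp add: left_inverse)
    also have "\<dots> = (\<Sum>j'\<in>F. \<Sum>l<d. G j l * (L l j' * a j'))"
      by (simp add: completed_def sum_distrib_right mult.assoc)
    also have "\<dots> = (\<Sum>l<d. G j l * (\<Sum>j'\<in>F. L l j' * a j'))"
      by (subst sum.swap) (simp only: sum_distrib_left)
    finally show ?thesis by (simp add: z)
  qed
  have inj: "inj_on col F"
  proof (rule inj_onI)
    fix j j' assume j: "j \<in> F" "j' \<in> F" "col j = col j'"
    show "j = j'"
    proof (rule ccontr)
      assume ne: "j \<noteq> j'"
      \<comment> \<open>Equal columns at distinct indices would give a linear relation with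
        coefficients 1 and -1.\<close>
      have "(\<Sum>l\<in>F. (kron l j - kron l j') *\<^sub>R col l)
          = (\<Sum>l\<in>F. if l = j then col l else 0) - (\<Sum>l\<in>F. if l = j' then col l else 0)"
        unfolding sum_subtractf[symmetric]
        by (intro sum.cong refl) (auto simp: kron_def)
      also have "\<dots> = 0" using j by simp
      finally have "kron j j - kron j j' = 0"
        using coef[of "\<lambda>l. kron l j - kron l j'" j] j(1) by simp
      then show False using ne by (simp add: kron_def)
    qed
  qed
  have indep: "independent (col ` F)"
  proof (rule independent_if_scalars_zero)
    fix f x assume 0: "(\<Sum>x\<in>col ` F. f x *\<^sub>R x) = 0" and "x \<in> col ` F"
    then obtain j where "x = col j" "j \<in> F" by blast
    then show "f x = 0"
      using coef[of "\<lambda>j. f (col j)" j] 0 by (simp add: sum.reindex[OF inj])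
  qed simp
  have c_hull: "c \<in> affine hull S"
  proof -
    have "c = (\<Sum>m<W. (1 / real W) *\<^sub>R y m)"
      by (rule ext) (simp add: sum_vect_apply scaleR_fun_def center sum_divide_distrib)
    also have "\<dots> \<in> convex hull S"
      using W_pos by (intro convex_sum) (auto intro: hull_inc y_in_S)
    finally show ?thesis
      using convex_hull_subset_affine_hull by blast
  qed
  have "col j \<in> span V" if j: "j \<in> F" for j
  proof -
    have "col j = (\<Sum>m<W. coord (y m) j *\<^sub>R (y m - c))"
    proof
      fix i
      show "col j i = (\<Sum>m<W. coord (y m) j *\<^sub>R (y m - c)) i"
      proof (cases "i < d")
        case True
        then show ?thesis
          using coord_deviation[OF j True] by (simp add: sum_vect_apply scaleR_fun_def col_def)
      next
        case False
        then have "y m i - c i = 0" if "m < W" for m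
          using y_in_S[OF that] S_Rspace center_Rspace by (auto simp: Rspace_def)
        then show ?thesis
          using False by (simp add: sum_vect_apply scaleR_fun_def col_def)
      qed
    qed
    also have "\<dots> \<in> span V"
    proof (intro span_sum span_scale span_base)
      fix m assume "m \<in> {..<W}"
      then show "y m - c \<in> V"
        unfolding V_def using c_hull by (auto intro: hull_inc y_in_S)
    qed
    finally show ?thesis .
  qed
  then have sub1: "span (col ` F) \<subseteq> span V"
    by (intro span_minimal) auto
  have "S \<subseteq> (+) c ` span (col ` F)"
  proof
    fix z assume z: "z \<in> S"
    have "z - c = (\<Sum>j\<in>F. coord z j *\<^sub>R col j)"
    proof
      fix i
      show "(z - c) i = (\<Sum>j\<in>F. coord z j *\<^sub>R col j) i"
      proof (cases "i < d")
        case True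
        then show ?thesis
          using reconstruct_active[OF coord_inactive[OF z] True] by (simp add: eval)
      next
        case False
        then show ?thesis
          using z S_Rspace center_Rspace by (auto simp: eval Rspace_def)
      qed
    qed
    also have "\<dots> \<in> span (col ` F)"
      by (intro span_sum span_scale span_base) auto
    finally have "z - c \<in> span (col ` F)" .
    then have "c + (z - c) \<in> (+) c ` span (col ` F)" by (rule imageI)
    then show "z \<in> (+) c ` span (col ` F)" by simp
  qed
  moreover have "affine ((+) c ` span (col ` F))"
    using subspace_imp_affine[OF subspace_span] by (simp add: affine_translation[symmetric])
  ultimately have hull: "affine hull S \<subseteq> (+) c ` span (col ` F)"
    by (rule hull_minimal)
  have "V \<subseteq> span (col ` F)"
  proof
    fix v assume "v \<in> V"
    then obtain x x' where v: "v = x - x'" "x \<in> affine hull S" "x' \<in> affine hull S"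
      by (auto simp: V_def)
    obtain s s' where s: "s \<in> span (col ` F)" "s' \<in> span (col ` F)" "x = c + s" "x' = c + s'"
      using v hull by blast
    then have "v = s - s'" using v by simp
    then show "v \<in> span (col ` F)" using s by (simp add: span_diff)
  qed
  then have "span V \<subseteq> span (col ` F)"
    by (intro span_minimal) auto
  with sub1 have "span (col ` F) = span V" by blast
  then have "dim V = card (col ` F)"
    using indep by (metis dim_eq_card)
  then show ?thesis
    by (simp add: affine_dim_def V_def card_image[OF inj])
qed

text \<open>The case of a point that is not kept. By \<open>cauchy_schwarz_plus\<close> the squared
  value of an affine functional at \<open>z\<close> is at most the leverage times the quadratic
  form.\<close>

lemma insert_dominated:
  assumes z: "z \<in> Rspace d"
    and inactive: "\<And>j. j < d \<Longrightarrow> j \<notin> F \<Longrightarrow> coord z j = 0"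
    and norm: "(\<Sum>j\<in>F. (coord z j)\<^sup>2) + 1 / real W \<le> 1"
  shows "rounding d (insert z S) W y c L G F"
proof
  fix z' g s assume "z' \<in> insert z S"
  then show "((\<Sum>i<d. g i * z' i) + s)\<^sup>2 \<le> (\<Sum>m<W. ((\<Sum>i<d. g i * y m i) + s)\<^sup>2)"
  proof
    assume z': "z' = z"
    define h where "h j = (\<Sum>i<d. g i * L i j)" for j
    define \<sigma> where "\<sigma> = (\<Sum>i<d. g i * c i) + s"
    have "(\<Sum>i<d. g i * (z i - c i)) = (\<Sum>i<d. \<Sum>j\<in>F. g i * L i j * coord z j)"
      using reconstruct_active[OF inactive] by (simp add: sum_distrib_left[symmetric] mult.assoc)
    also have "\<dots> = (\<Sum>j\<in>F. coord z j * h j)"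
      unfolding h_def by (subst sum.swap) (simp add: sum_distrib_left ac_simps)
    finally have "(\<Sum>i<d. g i * z i) + s = (\<Sum>j\<in>F. coord z j * h j) + \<sigma>"
      by (simp add: \<sigma>_def right_diff_distrib sum_subtractf)
    then have "((\<Sum>i<d. g i * z i) + s)\<^sup>2
        \<le> ((\<Sum>j\<in>F. (coord z j)\<^sup>2) + 1 / real W) * ((\<Sum>j\<in>F. (h j)\<^sup>2) + real W * \<sigma>\<^sup>2)"
      using cauchy_schwarz_plus[of "real W" "coord z" h F \<sigma>] W_pos by simp
    also have "\<dots> \<le> 1 * ((\<Sum>j\<in>F. (h j)\<^sup>2) + real W * \<sigma>\<^sup>2)"
      using norm by (intro mult_right_mono) (auto intro!: add_nonneg_nonneg sum_nonneg)
    finally show ?thesis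
      by (simp add: z' quadratic_form h_def \<sigma>_def)
  qed (rule dominated)
qed (use S_Rspace z W_pos y_in_S F_sub center L_inactive scatter left_inverse right_inverse in auto)

definition next_center :: "vect \<Rightarrow> vect"
  where "next_center z = (\<lambda>i. c i + (z i - c i) / real (Suc W))"

text \<open>The center moves by \<open>u\<close>, while \<open>z - c\<close> is \<open>W + 1\<close>
  times \<open>u\<close>. The old points contribute an extra \<open>W u v\<close> and the new one
  \<open>W^2 u v\<close>; together this is \<open>W (W + 1) u v\<close>.\<close>

lemma next_scatter:
  "(\<Sum>m<Suc W. ((y(W := z)) m i - next_center z i) * ((y(W := z)) m l - next_center z l))
    = (\<Sum>m<W. (y m i - c i) * (y m l - c l)) + real W / real (Suc W) * ((z i - c i) * (z l - c l))"
proof -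
  define u v where "u = (z i - c i) / real (Suc W)" and "v = (z l - c l) / real (Suc W)"
  have zu: "z i - c i = real (Suc W) * u" "z l - c l = real (Suc W) * v"
    by (simp_all add: u_def v_def)
  have "(\<Sum>m<Suc W. ((y(W := z)) m i - next_center z i) * ((y(W := z)) m l - next_center z l))
      = (\<Sum>m<W. ((y m i - c i) - u) * ((y m l - c l) - v)) + (z i - c i - u) * (z l - c l - v)"
    by (simp add: next_center_def u_def v_def diff_diff_eq)
  also have "(\<Sum>m<W. ((y m i - c i) - u) * ((y m l - c l) - v))
      = (\<Sum>m<W. (y m i - c i) * (y m l - c l) - v * (y m i - c i) - u * (y m l - c l) + u * v)"
    by (intro sum.cong refl) (simp add: algebra_simps)
  also have "\<dots> = (\<Sum>m<W. (y m i - c i) * (y m l - c l)) + real W * u * v"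
    by (simp add: sum.distrib sum_subtractf sum_distrib_left[symmetric] sum_points)
  also have "(z i - c i - u) * (z l - c l - v) = real W * real W * u * v"
    unfolding zu by (simp add: algebra_simps)
  also have "(\<Sum>m<W. (y m i - c i) * (y m l - c l)) + real W * u * v + real W * real W * u * v
      = (\<Sum>m<W. (y m i - c i) * (y m l - c l)) + real W / real (Suc W) * ((z i - c i) * (z l - c l))"
    unfolding zu by (simp add: field_simps)
  finally show ?thesis .
qed

text \<open>Domination is inherited: one more square is added on the right, and for \<open>z\<close>
  itself this square is the left-hand side. What remains for the two cases is a factor of the new
  scatter matrix and the inverse of its completion.\<close>

lemma next_rounding:
  assumes z: "z \<in> Rspace d" and F': "F \<subseteq> F'" "F' \<subseteq> {..<d}"
    and L': "\<And>i j. i < d \<Longrightarrow> j < d \<Longrightarrow> j \<notin> F' \<Longrightarrow> L' i j = 0"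
    and scatter': "\<And>i l. i < d \<Longrightarrow> l < d \<Longrightarrow>
      (\<Sum>j\<in>F'. L' i j * L' l j)
        = (\<Sum>j\<in>F. L i j * L l j) + real W / real (Suc W) * ((z i - c i) * (z l - c l))"
    and left: "\<And>i j. i < d \<Longrightarrow> j < d \<Longrightarrow> (\<Sum>l<d. G' i l * completed F' L' l j) = kron i j"
    and right: "\<And>i j. i < d \<Longrightarrow> j < d \<Longrightarrow> (\<Sum>l<d. completed F' L' i l * G' l j) = kron i j"
  shows "rounding d (insert z S) (Suc W) (y(W := z)) (next_center z) L' G' F'"
proof
  show "next_center z i = (\<Sum>m<Suc W. (y(W := z)) m i) / real (Suc W)" for i
  proof -
    show ?thesis
      by (simp add: next_center_def sum_points field_simps)
  qed
  fix z' g s assume "z' \<in> insert z S"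
  then show "((\<Sum>i<d. g i * z' i) + s)\<^sup>2 \<le> (\<Sum>m<Suc W. ((\<Sum>i<d. g i * (y(W := z)) m i) + s)\<^sup>2)"
  proof
    assume "z' = z"
    then show ?thesis by (simp add: sum_nonneg)
  next
    assume "z' \<in> S"
    then show ?thesis
      using dominated[of z' g s] by (simp add: add_increasing2)
  qed
next
  show "(y(W := z)) m \<in> insert z S" if "m < Suc W" for m
    using that y_in_S less_antisym[of m W] by auto
  show "(\<Sum>m<Suc W. ((y(W := z)) m i - next_center z i) * ((y(W := z)) m l - next_center z l))
      = (\<Sum>j\<in>F'. L' i j * L' l j)" if "i < d" "l < d" for i l
    unfolding next_scatter scatter'[OF that] by (simp add: scatter[OF that])
qed (use z S_Rspace F' L' left right in auto)

lemma coord_eq: "j < d \<Longrightarrow> (\<Sum>l<d. G j l * (z l - c l)) = coord z j"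
  by (simp add: coord_def)

text \<open>With \<open>p = coord z\<close> and \<open>\<omega> = W / (W + 1)\<close> the new factor
  is \<open>L (I + \<kappa> p p^T)\<close>, where the square of the bracket is to be
  \<open>I + \<omega> p p^T\<close>. This means
  \<open>1 + \<kappa> |p|^2 = sqrt (1 + \<omega> |p|^2)\<close>; rationalising the solution gives
  the form of \<open>\<kappa>\<close> used here, which avoids a division by \<open>|p|^2\<close>.
  The inverse is Sherman-Morrison with that root as \<open>\<gamma>\<close>.\<close>

lemma add_spanned:
  assumes z: "z \<in> Rspace d"
    and inactive: "\<And>j. j < d \<Longrightarrow> j \<notin> F \<Longrightarrow> coord z j = 0"
    and t: "t = real W / real (Suc W) * (\<Sum>j<d. (coord z j)\<^sup>2)"
    and \<kappa>: "\<kappa> = real W / real (Suc W) / (sqrt (1 + t) + 1)"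
    and L': "\<And>i j. i < d \<Longrightarrow> j < d \<Longrightarrow> L' i j = L i j + \<kappa> * (z i - c i) * coord z j"
    and G': "\<And>i j. i < d \<Longrightarrow> j < d \<Longrightarrow>
      G' i j = G i j - \<kappa> * coord z i / sqrt (1 + t) * (\<Sum>l<d. coord z l * G l j)"
  shows "rounding d (insert z S) (Suc W) (y(W := z)) (next_center z) L' G' F"
    and "1 + \<kappa> * (\<Sum>j<d. (coord z j)\<^sup>2) = sqrt (1 + t)"
proof -
  define p where "p = coord z"
  define P where "P = (\<Sum>j<d. (p j)\<^sup>2)"
  define w where "w i = z i - c i" for i
  define \<omega> where "\<omega> = real W / real (Suc W)"
  define q where "q = sqrt (1 + t)"
  have P0: "0 \<le> P" by (simp add: P_def sum_nonneg)
  have \<omega>0: "0 < \<omega>" using W_pos by (simp add: \<omega>_def)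
  have t': "t = \<omega> * P" by (simp add: t \<omega>_def P_def p_def)
  have t0: "0 \<le> t" using P0 \<omega>0 by (simp add: t')
  have q1: "1 \<le> q" and q2: "q * q = 1 + t"
    using t0 by (simp_all add: q_def)
  have \<kappa>': "\<kappa> * (q + 1) = \<omega>" using q1 by (simp add: \<kappa> \<omega>_def q_def[symmetric])
  have "(\<kappa> * P - (q - 1)) * (q + 1) = \<omega> * P - (q * q - 1)"
    unfolding \<kappa>'[symmetric] by (simp add: algebra_simps)
  then have \<kappa>P: "1 + \<kappa> * P = q"
    using q1 q2 t' by simp
  then show "1 + \<kappa> * (\<Sum>j<d. (coord z j)\<^sup>2) = sqrt (1 + t)"
    by (simp add: P_def p_def q_def)
  have PF: "(\<Sum>j\<in>F. (p j)\<^sup>2) = P"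
    unfolding P_def using inactive by (intro sum_active[symmetric]) (auto simp: p_def)
  have Lp: "(\<Sum>j\<in>F. L i j * p j) = w i" if "i < d" for i
    using reconstruct_active[OF inactive that] by (simp add: p_def w_def)
  have comp': "completed F L' i j = completed F L i j + \<kappa> * w i * p j" if "i < d" "j < d" for i j
    using that L' inactive by (simp add: completed_def w_def p_def)
  have Gw: "(\<Sum>l<d. G i l * w l) = p i" if "i < d" for i
    using coord_eq[OF that, of z] by (simp add: w_def p_def)
  have pp: "(\<Sum>l<d. p l * p l) = P" by (simp add: P_def power2_eq_square)
  define r where "r j = (\<Sum>l<d. p l * G l j)" for j
  have rH: "(\<Sum>l<d. r l * completed F L l j) = p j" if j: "j < d" for j
  proof -
    have "(\<Sum>l<d. r l * completed F L l j) = (\<Sum>l<d. \<Sum>i<d. p i * (G i l * completed F L l j))"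
      by (simp add: r_def sum_distrib_right mult.assoc)
    also have "\<dots> = (\<Sum>i<d. p i * (\<Sum>l<d. G i l * completed F L l j))"
      by (subst sum.swap) (simp only: sum_distrib_left)
    also have "\<dots> = (\<Sum>i<d. p i * kron i j)"
      using j by (simp add: left_inverse)
    finally show ?thesis using j by simp
  qed
  have rw: "(\<Sum>l<d. r l * w l) = P"
  proof -
    have "(\<Sum>l<d. r l * w l) = (\<Sum>l<d. \<Sum>i<d. p i * (G i l * w l))"
      by (simp add: r_def sum_distrib_right mult.assoc)
    also have "\<dots> = (\<Sum>i<d. p i * (\<Sum>l<d. G i l * w l))"
      by (subst sum.swap) (simp only: sum_distrib_left)
    finally show ?thesis by (simp add: Gw pp)
  qed
  show "rounding d (insert z S) (Suc W) (y(W := z)) (next_center z) L' G' F"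
  proof (rule next_rounding[OF z order_refl F_sub])
    show "L' i j = 0" if "i < d" "j < d" "j \<notin> F" for i j
      using that L' L_inactive inactive by simp
    show "(\<Sum>j\<in>F. L' i j * L' l j)
        = (\<Sum>j\<in>F. L i j * L l j) + real W / real (Suc W) * ((z i - c i) * (z l - c l))"
      if i: "i < d" "l < d" for i l
    proof -
      have "(\<Sum>j\<in>F. L' i j * L' l j) = (\<Sum>j\<in>F. L i j * L l j + \<kappa> * w l * (L i j * p j)
          + \<kappa> * w i * (L l j * p j) + \<kappa> * \<kappa> * w i * w l * (p j)\<^sup>2)"
        using i F_less by (intro sum.cong refl) (simp add: L' w_def p_def power2_eq_square algebra_simps)
      also have "\<dots> = (\<Sum>j\<in>F. L i j * L l j) + \<kappa> * w l * w i + \<kappa> * w i * w l + \<kappa> * \<kappa> * w i * w l * P"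
        by (simp only: sum.distrib sum_distrib_left[symmetric] Lp[OF i(1)] Lp[OF i(2)] PF)
      \<comment> \<open>The coefficient \<open>2 \<kappa> + \<kappa>^2 P\<close> is brought into the
        form \<open>\<kappa> (q + 1)\<close>, which equals \<open>\<omega>\<close>.\<close>
      also have "\<dots> = (\<Sum>j\<in>F. L i j * L l j) + \<kappa> * ((1 + \<kappa> * P) + 1) * (w i * w l)"
        by (simp add: algebra_simps)
      finally show ?thesis
        unfolding \<kappa>P \<kappa>' by (simp add: \<omega>_def w_def)
    qed
    show "(\<Sum>l<d. G' i l * completed F L' l j) = kron i j" if ij: "i < d" "j < d" for i j
    proof -
      have "(\<Sum>l<d. (G i l - \<kappa> * p i / q * r l) * (completed F L l j + \<kappa> * w l * p j)) = kron i j"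
      proof (rule rank_one_left_inverse[OF _ _ rH _ _ ij(2), where h = "\<lambda>l. \<kappa> * w l" and \<gamma> = q and \<alpha> = "\<kappa> * p i"])
        show "(\<Sum>l<d. G i l * (\<kappa> * w l)) = \<kappa> * p i"
          unfolding Gw[OF ij(1), symmetric] by (simp add: sum_distrib_left ac_simps)
        have "(\<Sum>l<d. r l * (\<kappa> * w l)) = \<kappa> * (\<Sum>l<d. r l * w l)"
          by (simp add: sum_distrib_left ac_simps)
        then show "(\<Sum>l<d. r l * (\<kappa> * w l)) = q - 1"
          using \<kappa>P by (simp add: rw)
      qed (use ij q1 left_inverse in auto)
      then show ?thesis
        using ij by (simp add: comp' G' p_def q_def r_def)
    qed
    show "(\<Sum>l<d. completed F L' i l * G' l j) = kron i j" if ij: "i < d" "j < d" for i j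
    proof -
      have "(\<Sum>l<d. (completed F L i l + \<kappa> * w i * p l) * (G l j - \<kappa> * p l / q * r j)) = kron i j"
      proof (rule rank_one_right_inverse[where h = "\<lambda>i. \<kappa> * w i" and \<gamma> = q and b = p and r = r and a' = "\<lambda>l. \<kappa> * p l / q"])
        have "(\<Sum>l<d. completed F L i l * (\<kappa> * p l / q)) = \<kappa> / q * (\<Sum>l<d. completed F L i l * p l)"
          by (simp add: sum_distrib_left ac_simps)
        then show "(\<Sum>l<d. completed F L i l * (\<kappa> * p l / q)) * q = \<kappa> * w i"
          using q1 reconstruct[OF ij(1), of z] by (simp add: p_def w_def)
        have "(\<Sum>l<d. p l * (\<kappa> * p l / q)) = \<kappa> / q * (\<Sum>l<d. p l * p l)"
          by (simp add: sum_distrib_left ac_simps)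
        then show "(\<Sum>l<d. p l * (\<kappa> * p l / q)) * q = q - 1"
          using q1 \<kappa>P by (simp add: pp)
      qed (use ij q1 right_inverse in \<open>auto simp: r_def\<close>)
      then show ?thesis
        using ij by (simp add: comp' G' p_def q_def r_def)
    qed
  qed
qed

text \<open>Column \<open>k\<close> of the completed matrix changes from the unit vector
  \<open>e\<close> to \<open>\<beta> (z - c)\<close>, a rank-one change with
  \<open>h = \<beta> (z - c) - e\<close> and \<open>b = e^T\<close>. The scatter matrix gains the
  outer square of the new column, which dictates \<open>\<beta>\<close>. The Sherman-Morrison
  denominator is \<open>\<beta> * coord z k\<close>, nonzero by the choice of
  \<open>k\<close>.\<close>

lemma add_unspanned:
  assumes z: "z \<in> Rspace d" and k: "k < d" "k \<notin> F" "coord z k \<noteq> 0"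
    and \<beta>: "\<beta> = sqrt (real W / real (Suc W))"
    and L': "\<And>i j. i < d \<Longrightarrow> j < d \<Longrightarrow> L' i j = L i j + \<beta> * (z i - c i) * kron j k"
    and G': "\<And>i j. i < d \<Longrightarrow> j < d \<Longrightarrow>
      G' i j = G i j - (\<beta> * coord z i - kron i k) / (\<beta> * coord z k) * (\<Sum>l<d. kron l k * G l j)"
  shows "rounding d (insert z S) (Suc W) (y(W := z)) (next_center z) L' G' (insert k F)"
proof -
  define p where "p = coord z"
  define w where "w i = z i - c i" for i
  define \<gamma> where "\<gamma> = \<beta> * p k"
  have \<beta>0: "0 < \<beta>" using W_pos by (simp add: \<beta>)
  have \<gamma>0: "\<gamma> \<noteq> 0" using \<beta>0 k by (simp add: \<gamma>_def p_def)
  have \<beta>2: "\<beta> * \<beta> = real W / real (Suc W)" by (simp add: \<beta>)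
  have comp': "completed (insert k F) L' i j = completed F L i j + (\<beta> * w i - kron i k) * kron j k"
    if "i < d" "j < d" for i j
    using that k L_inactive[of i k] L' by (auto simp: completed_def w_def kron_def)
  have Gw: "(\<Sum>l<d. G i l * w l) = p i" if "i < d" for i
    using coord_eq[OF that, of z] by (simp add: w_def p_def)
  have G'': "G' i j = G i j - (\<beta> * p i - kron i k) / \<gamma> * G k j" if "i < d" "j < d" for i j
    using that k by (simp add: G' p_def \<gamma>_def)
  have Gh: "(\<Sum>l<d. G i l * (\<beta> * w l - kron l k)) = \<beta> * p i - G i k" if "i < d" for i
  proof -
    have "(\<Sum>l<d. G i l * (\<beta> * w l - kron l k)) = \<beta> * (\<Sum>l<d. G i l * w l) - (\<Sum>l<d. G i l * kron l k)"
      by (simp add: right_diff_distrib sum_subtractf sum_distrib_left ac_simps)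
    then show ?thesis using k that by (simp add: Gw)
  qed
  \<comment> \<open>The completed matrix fixes the unit vector of the inactive index
    \<open>k\<close>, hence so does its inverse.\<close>
  have Gk: "G i k = kron i k" if "i < d" for i
  proof -
    have "G i k = (\<Sum>l<d. G i l * kron l k)" using k by simp
    also have "\<dots> = (\<Sum>l<d. G i l * completed F L l k)" using k by (simp add: completed_def)
    finally show ?thesis using left_inverse[OF that k(1)] by simp
  qed
  show ?thesis
  proof (rule next_rounding[OF z])
    show "L' i j = 0" if "i < d" "j < d" "j \<notin> insert k F" for i j
      using that L' L_inactive by (simp add: kron_def)
    show "(\<Sum>j\<in>insert k F. L' i j * L' l j)
        = (\<Sum>j\<in>F. L i j * L l j) + real W / real (Suc W) * ((z i - c i) * (z l - c l))"
      if i: "i < d" "l < d" for i l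
    proof -
      have "(\<Sum>j\<in>F. L' i j * L' l j) = (\<Sum>j\<in>F. L i j * L l j)"
        using i F_less k by (intro sum.cong refl) (auto simp: L' kron_def)
      moreover have "L' i k * L' l k = \<beta> * \<beta> * ((z i - c i) * (z l - c l))"
        using i k L_inactive by (simp add: L' kron_def)
      ultimately show ?thesis using k by (simp add: \<beta>2)
    qed
    show "(\<Sum>l<d. G' i l * completed (insert k F) L' l j) = kron i j" if ij: "i < d" "j < d" for i j
    proof -
      have "(\<Sum>l<d. (G i l - (\<beta> * p i - kron i k) / \<gamma> * G k l)
          * (completed F L l j + (\<beta> * w l - kron l k) * kron j k)) = kron i j"
      proof (rule rank_one_left_inverse[where h = "\<lambda>l. \<beta> * w l - kron l k" and \<gamma> = \<gamma>
            and \<alpha> = "\<beta> * p i - kron i k" and b = "\<lambda>j. kron j k" and r = "G k"])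
        show "(\<Sum>l<d. G k l * (\<beta> * w l - kron l k)) = \<gamma> - 1"
          using k Gh Gk by (simp add: \<gamma>_def kron_def)
      qed (use ij k \<gamma>0 left_inverse Gh Gk in \<open>auto simp: kron_def\<close>)
      then show ?thesis
        using ij k by (simp add: comp' G'')
    qed
    show "(\<Sum>l<d. completed (insert k F) L' i l * G' l j) = kron i j" if ij: "i < d" "j < d" for i j
    proof -
      have "(\<Sum>l<d. (completed F L i l + (\<beta> * w i - kron i k) * kron l k)
          * (G l j - (\<beta> * p l - kron l k) / \<gamma> * G k j)) = kron i j"
      proof (rule rank_one_right_inverse[where h = "\<lambda>i. \<beta> * w i - kron i k" and \<gamma> = \<gamma>
            and b = "\<lambda>l. kron l k" and r = "G k" and a' = "\<lambda>l. (\<beta> * p l - kron l k) / \<gamma>"])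
        have "(\<Sum>l<d. completed F L i l * ((\<beta> * p l - kron l k) / \<gamma>))
            = (\<beta> * (\<Sum>l<d. completed F L i l * p l) - (\<Sum>l<d. completed F L i l * kron l k)) / \<gamma>"
          by (simp add: sum_divide_distrib sum_distrib_left sum_subtractf[symmetric] algebra_simps)
        also have "\<dots> = (\<beta> * w i - kron i k) / \<gamma>"
          using reconstruct[OF ij(1), of z] k by (simp add: p_def w_def completed_def)
        finally show "(\<Sum>l<d. completed F L i l * ((\<beta> * p l - kron l k) / \<gamma>)) * \<gamma> = \<beta> * w i - kron i k"
          using \<gamma>0 by simp
        show "(\<Sum>l<d. kron l k * ((\<beta> * p l - kron l k) / \<gamma>)) * \<gamma> = \<gamma> - 1"
          unfolding sum_kron(3)[OF k(1)] using \<gamma>0 by (simp add: \<gamma>_def kron_def)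
      qed (use ij k \<gamma>0 right_inverse in auto)
      then show ?thesis
        using ij k by (simp add: comp' G'')
    qed
  qed (use k F_sub in auto)
qed

end

lemma rounding_singleton:
  assumes "z \<in> Rspace d"
  shows "rounding d {z} (Suc 0) (\<lambda>_. z) z (\<lambda>i j. 0) kron {}"
  by standard (use assms in \<open>auto simp: completed_def\<close>)

section \<open>Growth of the determinant and the bound on the number of kept points\<close>

section \<open>The number of kept points\<close>

text \<open>\<open>T\<close> carries the growth of the determinant, while \<open>B\<close> only has
  to be integral. The rows of \<open>T\<close> outside \<open>F\<close> are unit rows, which leaves
  room for new columns. The inequality is \<open>2 ^ (W - 1 - k) <= W (det T)^2\<close> freed from
  subtraction; for the first point it is an equality.\<close>

definition volume_bound :: "nat \<Rightarrow> nat \<Rightarrow> (nat \<Rightarrow> nat \<Rightarrow> real) \<Rightarrow> nat set \<Rightarrow> bool"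
  where "volume_bound d W L F \<longleftrightarrow> (\<exists>B T.
    (\<forall>i<d. \<forall>j<d. B i j \<in> \<int> \<and> completed F L i j = (\<Sum>l<d. B i l * T l j)) \<and>
    (\<forall>i<d. \<forall>j<d. i \<notin> F \<longrightarrow> T i j = kron i j) \<and>
    2 ^ W \<le> real W * 2 ^ Suc (card F) * (fdet d T)\<^sup>2)"

lemma volume_bound_singleton: "volume_bound d (Suc 0) (\<lambda>i j. 0) {}"
  unfolding volume_bound_def
  by (intro exI[of _ kron]) (simp add: completed_def fdet_id, simp add: kron_def)

context rounding
begin

text \<open>The new completed matrix is \<open>H (I + \<kappa> p p^T)\<close>, so \<open>B\<close>
  stays and \<open>T\<close> is multiplied by the bracket, whose determinant is
  \<open>1 + \<kappa> |p|^2 = sqrt (1 + t)\<close>.\<close>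

lemma volume_bound_spanned:
  assumes inactive: "\<And>j. j < d \<Longrightarrow> j \<notin> F \<Longrightarrow> coord z j = 0"
    and large: "1 < (\<Sum>j<d. (coord z j)\<^sup>2) + 1 / real W"
    and t: "t = real W / real (Suc W) * (\<Sum>j<d. (coord z j)\<^sup>2)"
    and \<kappa>: "1 + \<kappa> * (\<Sum>j<d. (coord z j)\<^sup>2) = sqrt (1 + t)"
    and L': "\<And>i j. i < d \<Longrightarrow> j < d \<Longrightarrow> L' i j = L i j + \<kappa> * (z i - c i) * coord z j"
    and vol: "volume_bound d W L F"
  shows "volume_bound d (Suc W) L' F"
proof -
  obtain B T where B: "\<And>i j. i < d \<Longrightarrow> j < d \<Longrightarrow> B i j \<in> \<int>"
    and BT: "\<And>i j. i < d \<Longrightarrow> j < d \<Longrightarrow> completed F L i j = (\<Sum>l<d. B i l * T l j)"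
    and T: "\<And>i j. i < d \<Longrightarrow> j < d \<Longrightarrow> i \<notin> F \<Longrightarrow> T i j = kron i j"
    and le: "2 ^ W \<le> real W * 2 ^ Suc (card F) * (fdet d T)\<^sup>2"
    using vol unfolding volume_bound_def by blast
  define p where "p = coord z"
  define x where "x l = (\<Sum>m<d. T l m * p m)" for l
  define T' where "T' i j = T i j + \<kappa> * x i * p j" for i j
  have Bx: "(\<Sum>l<d. B i l * x l) = z i - c i" if i: "i < d" for i
  proof -
    have "(\<Sum>l<d. B i l * x l) = (\<Sum>l<d. \<Sum>m<d. B i l * T l m * p m)"
      by (simp add: x_def sum_distrib_left mult.assoc)
    also have "\<dots> = (\<Sum>m<d. completed F L i m * p m)"
      using i by (subst sum.swap) (simp add: BT sum_distrib_right)
    finally show ?thesis using reconstruct[OF i, of z] by (simp add: p_def)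
  qed
  have 1: "completed F L' i j = (\<Sum>l<d. B i l * T' l j)" if "i < d" "j < d" for i j
  proof -
    have "(\<Sum>l<d. B i l * T' l j) = (\<Sum>l<d. B i l * T l j) + \<kappa> * p j * (\<Sum>l<d. B i l * x l)"
      by (simp add: T'_def distrib_left sum.distrib sum_distrib_left ac_simps)
    then show ?thesis
      using that L' inactive by (simp add: Bx BT[symmetric] completed_def p_def)
  qed
  have 2: "T' i j = kron i j" if "i < d" "j < d" "i \<notin> F" for i j
  proof -
    have "x i = p i"
      using that T by (simp add: x_def)
    then show ?thesis
      using that T inactive by (simp add: T'_def p_def)
  qed
  have "fdet d T' = fdet d (\<lambda>i j. \<Sum>l<d. T i l * (kron l j + \<kappa> * p l * p j))"
  proof (rule fdet_cong)
    fix i j assume "i < d" "j < d"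
    have "(\<Sum>l<d. T i l * (kron l j + \<kappa> * p l * p j))
        = (\<Sum>l<d. T i l * kron l j) + \<kappa> * x i * p j"
      by (simp add: x_def distrib_left sum.distrib sum_distrib_left sum_distrib_right ac_simps)
    then show "T' i j = (\<Sum>l<d. T i l * (kron l j + \<kappa> * p l * p j))"
      using \<open>j < d\<close> by (simp add: T'_def)
  qed
  also have "\<dots> = fdet d T * (1 + \<kappa> * (\<Sum>j<d. (coord z j)\<^sup>2))"
    unfolding fdet_mult fdet_id_plus_outer
    by (simp add: p_def power2_eq_square sum_distrib_left mult.assoc)
  finally have det: "fdet d T' = fdet d T * sqrt (1 + t)"
    by (simp add: \<kappa>)
  have t0: "0 \<le> t"
    unfolding t by (intro mult_nonneg_nonneg sum_nonneg) auto
  \<comment> \<open>Leverage above 1 means \<open>W |p|^2 + 1 > W\<close>, so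
    \<open>(W + 1) (1 + t) = W + 1 + W |p|^2\<close> exceeds \<open>2 W\<close>. This pays for the
    doubling of \<open>2 ^ W\<close>.\<close>
  have "2 * real W \<le> real (Suc W) * (1 + t)"
  proof -
    have "real (Suc W) * (1 + t) = real (Suc W) + real W * (\<Sum>j<d. (coord z j)\<^sup>2)"
      unfolding t by (simp add: field_simps)
    moreover have "real W * 1 \<le> real W * ((\<Sum>j<d. (coord z j)\<^sup>2) + 1 / real W)"
      using large by (intro mult_left_mono) auto
    ultimately show ?thesis
      using W_pos by (simp add: distrib_left)
  qed
  then have "2 * real W * (2 ^ Suc (card F) * (fdet d T)\<^sup>2)
      \<le> real (Suc W) * (1 + t) * (2 ^ Suc (card F) * (fdet d T)\<^sup>2)"
    by (rule mult_right_mono) simp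
  also have "\<dots> = real (Suc W) * 2 ^ Suc (card F) * (fdet d T')\<^sup>2"
    using t0 by (simp add: det power_mult_distrib)
  finally have "2 * real W * (2 ^ Suc (card F) * (fdet d T)\<^sup>2)
      \<le> real (Suc W) * 2 ^ Suc (card F) * (fdet d T')\<^sup>2" .
  moreover have "2 ^ Suc W \<le> 2 * real W * (2 ^ Suc (card F) * (fdet d T)\<^sup>2)"
    using le by (simp only: power_Suc[of _ W] mult.assoc)
  ultimately have 3: "2 ^ Suc W \<le> real (Suc W) * 2 ^ Suc (card F) * (fdet d T')\<^sup>2"
    by linarith
  show ?thesis
    unfolding volume_bound_def
    by (intro exI[of _ B] exI[of _ T'] conjI allI impI B 1 2 3)
qed

text \<open>The new column is \<open>\<beta> (z - c)\<close>, where \<open>c\<close> need not be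
  integral; so a seen point is inserted: \<open>z - c = (z - z\<^sub>0) + (z\<^sub>0 - c)\<close>.
  The first difference is integral and becomes column \<open>k\<close> of the integer matrix; the
  second is \<open>B x\<close> with \<open>x\<close> supported in \<open>F\<close>.\<close>

lemma volume_bound_unspanned:
  assumes k: "k < d" "k \<notin> F"
    and z\<^sub>0: "z\<^sub>0 \<in> S" "\<And>i. i < d \<Longrightarrow> z i - z\<^sub>0 i \<in> \<int>"
    and \<beta>: "\<beta> = sqrt (real W / real (Suc W))"
    and L': "\<And>i j. i < d \<Longrightarrow> j < d \<Longrightarrow> L' i j = L i j + \<beta> * (z i - c i) * kron j k"
    and vol: "volume_bound d W L F"
  shows "volume_bound d (Suc W) L' (insert k F)"
proof -
  obtain B T where B: "\<And>i j. i < d \<Longrightarrow> j < d \<Longrightarrow> B i j \<in> \<int>"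
    and BT: "\<And>i j. i < d \<Longrightarrow> j < d \<Longrightarrow> completed F L i j = (\<Sum>l<d. B i l * T l j)"
    and T: "\<And>i j. i < d \<Longrightarrow> j < d \<Longrightarrow> i \<notin> F \<Longrightarrow> T i j = kron i j"
    and le: "2 ^ W \<le> real W * 2 ^ Suc (card F) * (fdet d T)\<^sup>2"
    using vol unfolding volume_bound_def by blast
  define p where "p = coord z\<^sub>0"
  define x where "x l = (\<Sum>m<d. T l m * p m)" for l
  have x0: "x l = 0" if "l < d" "l \<notin> F" for l
    using that T coord_inactive[OF z\<^sub>0(1)] by (simp add: x_def p_def)
  have Bx: "(\<Sum>l<d. B i l * x l) = z\<^sub>0 i - c i" if i: "i < d" for i
  proof -
    have "(\<Sum>l<d. B i l * x l) = (\<Sum>l<d. \<Sum>m<d. B i l * T l m * p m)"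
      by (simp add: x_def sum_distrib_left mult.assoc)
    also have "\<dots> = (\<Sum>m<d. completed F L i m * p m)"
      using i by (subst sum.swap) (simp add: BT sum_distrib_right)
    finally show ?thesis using reconstruct[OF i, of z\<^sub>0] by (simp add: p_def)
  qed
  define B' where "B' i j = (if j = k then z i - z\<^sub>0 i else B i j)" for i j
  define T' where "T' i j = (if j = k then \<beta> * (kron i k + x i) else T i j)" for i j
  have 1: "completed (insert k F) L' i j = (\<Sum>l<d. B' i l * T' l j)" if ij: "i < d" "j < d" for i j
  proof (cases "j = k")
    case True
    have "(\<Sum>l<d. B' i l * T' l j) = (\<Sum>l<d. \<beta> * (B' i l * kron l k) + \<beta> * (B i l * x l))"
      using True k x0 by (intro sum.cong) (auto simp: T'_def B'_def algebra_simps)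
    also have "\<dots> = \<beta> * (z i - z\<^sub>0 i) + \<beta> * (z\<^sub>0 i - c i)"
      using k ij by (simp add: sum.distrib sum_distrib_left[symmetric] Bx B'_def)
    finally show ?thesis
      using True ij k L_inactive by (simp add: completed_def L' kron_def algebra_simps)
  next
    case False
    \<comment> \<open>Row \<open>k\<close> of \<open>T\<close> is a unit row, so off column
      \<open>k\<close> the replaced column of \<open>B\<close> is multiplied by zero.\<close>
    have "(\<Sum>l<d. B' i l * T' l j) = (\<Sum>l<d. B i l * T l j)"
      using False k ij T by (intro sum.cong) (auto simp: T'_def B'_def kron_def)
    then show ?thesis
      using False ij by (simp add: BT[symmetric] completed_def L' kron_def)
  qed
  have 2: "T' i j = kron i j" if "i < d" "j < d" "i \<notin> insert k F" for i j
    using that T[OF that(1,2)] x0[OF that(1)] by (auto simp: T'_def kron_def)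
  have "fdet d T' = \<beta> * fdet d T"
    using k T x0 by (intro fdet_replace_col[of k]) (auto simp: T'_def kron_def)
  then have det: "(fdet d T')\<^sup>2 = real W / real (Suc W) * (fdet d T)\<^sup>2"
    by (simp add: \<beta> power_mult_distrib)
  \<comment> \<open>The loss \<open>W / (W + 1)\<close> cancels against the factor
    \<open>real (Suc W)\<close>, and the larger \<open>card F\<close> pays for the doubling of
    \<open>2 ^ W\<close>.\<close>
  have 3: "2 ^ Suc W \<le> real (Suc W) * 2 ^ Suc (card (insert k F)) * (fdet d T')\<^sup>2"
    using le k unfolding det by simp
  have 4: "B' i j \<in> \<int>" if "i < d" "j < d" for i j
    using that B z\<^sub>0 by (simp add: B'_def)
  show ?thesis
    unfolding volume_bound_def
    by (intro exI[of _ B'] exI[of _ T'] conjI allI impI 1 2 3 4)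
qed

text \<open>The squared norm of row \<open>i\<close> of \<open>L\<close> is a diagonal entry of the
  scatter matrix; a sum of squared deviations from the mean is at most the sum of squares.\<close>

lemma active_entry_bound:
  assumes N: "\<And>z. z \<in> S \<Longrightarrow> \<bar>z i\<bar> \<le> N" and i: "i < d" and j: "j \<in> F"
  shows "\<bar>L i j\<bar> \<le> sqrt (real W) * N"
proof -
  have N0: "0 \<le> N" using N[OF y_in_S[OF W_pos]] by linarith
  have "(L i j)\<^sup>2 \<le> (\<Sum>j\<in>F. (L i j)\<^sup>2)"
    using j by (intro member_le_sum) auto
  also have "\<dots> = (\<Sum>m<W. (y m i - c i) * (y m i - c i))"
    using i by (simp add: scatter power2_eq_square)
  also have "\<dots> = (\<Sum>m<W. (y m i)\<^sup>2 - c i * y m i * 2 + (c i)\<^sup>2)"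
    by (intro sum.cong refl) (simp add: power2_eq_square algebra_simps)
  also have "\<dots> = (\<Sum>m<W. (y m i)\<^sup>2) - real W * (c i)\<^sup>2"
    by (simp add: sum.distrib sum_subtractf sum_distrib_left[symmetric] sum_distrib_right[symmetric]
        sum_points power2_eq_square algebra_simps)
  also have "\<dots> \<le> (\<Sum>m<W. (y m i)\<^sup>2)" by simp
  also have "\<dots> \<le> (\<Sum>m<W. N\<^sup>2)"
    using N y_in_S by (intro sum_mono abs_le_square_iff[THEN iffD1]) (use N0 in auto)
  finally have "(L i j)\<^sup>2 \<le> (sqrt (real W) * N)\<^sup>2"
    by (simp add: power_mult_distrib)
  then have "\<bar>L i j\<bar> \<le> \<bar>sqrt (real W) * N\<bar>"
    by (simp only: abs_le_square_iff)
  then show ?thesis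
    using N0 by simp
qed

text \<open>\<open>B\<close> is nonsingular because \<open>B T\<close> has the left inverse
  \<open>G\<close>, so \<open>|det B| >= 1\<close> and \<open>|det T| <= |det H|\<close>; the latter
  is estimated by \<open>fdet_bound\<close>.\<close>

lemma exponential_bound:
  assumes vol: "volume_bound d W L F"
    and N: "\<And>z i. z \<in> S \<Longrightarrow> i < d \<Longrightarrow> \<bar>z i\<bar> \<le> N"
  shows "2 ^ W \<le> real W * 2 ^ Suc (card F) * ((fact (card F))\<^sup>2 * (real W * N\<^sup>2) ^ card F)"
proof -
  obtain B T where B: "\<And>i j. i < d \<Longrightarrow> j < d \<Longrightarrow> B i j \<in> \<int>"
    and BT: "\<And>i j. i < d \<Longrightarrow> j < d \<Longrightarrow> completed F L i j = (\<Sum>l<d. B i l * T l j)"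
    and le: "2 ^ W \<le> real W * 2 ^ Suc (card F) * (fdet d T)\<^sup>2"
    using vol unfolding volume_bound_def by blast
  have det: "fdet d (completed F L) = fdet d B * fdet d T"
    unfolding fdet_mult[symmetric] by (rule fdet_cong) (rule BT)
  have "fdet d G * fdet d (completed F L) = fdet d kron"
    unfolding fdet_mult[symmetric] by (rule fdet_cong) (rule left_inverse)
  then have "fdet d B \<noteq> 0"
    unfolding det fdet_id by auto
  then have "1 \<le> \<bar>fdet d B\<bar>"
    using B by (intro Ints_nonzero_abs_ge1 fdet_Ints) auto
  then have "\<bar>fdet d T\<bar> \<le> \<bar>fdet d (completed F L)\<bar>"
    unfolding det abs_mult by (simp add: mult_le_cancel_right1)
  \<comment> \<open>\<open>N\<close> can be negative only for \<open>d = 0\<close>; the absolute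
    value covers this case.\<close>
  also have "\<dots> \<le> fact (card F) * (sqrt (real W) * \<bar>N\<bar>) ^ card F"
  proof (rule fdet_bound[OF F_sub])
    fix i j assume ij: "i < d" "j \<in> F"
    show "\<bar>completed F L i j\<bar> \<le> sqrt (real W) * \<bar>N\<bar>"
      unfolding completed_def using ij N
      by (auto intro!: active_entry_bound intro: order_trans[OF _ abs_ge_self])
  qed (auto simp: completed_def)
  finally have "\<bar>fdet d T\<bar> \<le> \<bar>fact (card F) * (sqrt (real W) * \<bar>N\<bar>) ^ card F\<bar>"
    by simp
  then have "(fdet d T)\<^sup>2 \<le> (fact (card F) * (sqrt (real W) * \<bar>N\<bar>) ^ card F)\<^sup>2"
    by (simp only: abs_le_square_iff)
  also have "\<dots> = (fact (card F))\<^sup>2 * ((sqrt (real W) * \<bar>N\<bar>)\<^sup>2) ^ card F"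
    by (metis power_mult_distrib power_mult mult.commute)
  also have "\<dots> = (fact (card F))\<^sup>2 * (real W * N\<^sup>2) ^ card F"
    by (simp add: power_mult_distrib)
  finally have "real W * 2 ^ Suc (card F) * (fdet d T)\<^sup>2
      \<le> real W * 2 ^ Suc (card F) * ((fact (card F))\<^sup>2 * (real W * N\<^sup>2) ^ card F)"
    by (intro mult_left_mono) auto
  with le show ?thesis by linarith
qed

end

text \<open>After taking logarithms, the \<open>ln W\<close> on the right is absorbed on the left by
  \<open>ln x <= x - 1\<close>. The maximum with 1 covers \<open>k = 0\<close> and
  \<open>d * N = 1\<close>, where the logarithmic term is zero.\<close>

lemma invert_exponential_bound:
  fixes W k d N :: nat
  assumes W: "0 < W" and kd: "k \<le> d"
    and le: "2 ^ W \<le> real W * 2 ^ Suc k * ((fact k)\<^sup>2 * (real W * (real N)\<^sup>2) ^ k)"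
  shows "real W \<le> 64 * max 1 (real k * ln (real d * real N))"
proof (cases "k = 0")
  case True
  then have "2 ^ W \<le> real (W * 2)" using le by simp
  then have 1: "2 ^ W \<le> W * 2" by (simp flip: of_nat_le_iff[where 'a = real])
  have "W \<le> 2"
  proof (rule ccontr)
    assume "\<not> W \<le> 2"
    then have "3 \<le> W" by simp
    then have "W * 2 < 2 ^ W"
      by (induction W rule: dec_induct) auto
    with 1 show False by simp
  qed
  then show ?thesis by (simp add: le_max_iff_disj)
next
  case False
  then have k1: "1 \<le> real k" by simp
  \<comment> \<open>For \<open>N = 0\<close> and positive \<open>k\<close> the right-hand side of
    the assumption is zero.\<close>
  have N: "0 < N"
  proof (rule ccontr)
    assume "\<not> 0 < N"
    then have "(2::real) ^ W \<le> 0" using le False by (simp add: power_0_left)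
    then show False using zero_less_power[of "2::real" W] by linarith
  qed
  have "(fact k :: real) \<le> real k ^ k"
    using fact_le_power[of k] by simp
  then have f: "ln (fact k :: real) \<le> real k * ln (real k)"
    using False by (simp add: ln_realpow[symmetric] flip: ln_le_cancel_iff)
  have "ln (2 ^ W) \<le> ln (real W * 2 ^ Suc k * ((fact k)\<^sup>2 * (real W * (real N)\<^sup>2) ^ k))"
    using le W N by (subst ln_le_cancel_iff) auto
  also have "\<dots> = ln (real W) + real (Suc k) * ln 2 + (2 * ln (fact k) + real k * (ln (real W) + 2 * ln (real N)))"
    using W N by (simp add: ln_mult ln_realpow del: power_Suc fact_Suc of_nat_Suc)
  finally have "real W * ln 2 \<le> ln (real W) + real (Suc k) * ln 2
      + (2 * (real k * ln (real k)) + real k * (ln (real W) + 2 * ln (real N)))"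
    using f by (simp add: ln_realpow)
  moreover have "(1 + real k) * ln (real W) \<le> 2 * real k * ln (real W)"
    using k1 W by (intro mult_right_mono) auto
  moreover have "2 * real k * ln (real W) \<le> real W / 4 - 2 * real k + 2 * real k * (ln 8 + ln (real k))"
  proof -
    \<comment> \<open>Scaling by \<open>8 k\<close> makes the linear term
      \<open>2 k * W / (8 k) = W / 4\<close>, half of the lower estimate \<open>W / 2\<close> for
      \<open>W ln 2\<close>.\<close>
    have "ln (real W / (8 * real k)) \<le> real W / (8 * real k) - 1"
      using W k1 by (intro ln_le_minus_one) auto
    then have "ln (real W) \<le> real W / (8 * real k) - 1 + (ln 8 + ln (real k))"
      using W k1 by (simp add: ln_div ln_mult)
    then have "2 * real k * ln (real W) \<le> 2 * real k * (real W / (8 * real k) - 1 + (ln 8 + ln (real k)))"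
      using k1 by (intro mult_left_mono) auto
    then show ?thesis using k1 by (simp add: algebra_simps)
  qed
  moreover have "ln (8::real) = 3 * ln 2"
    using ln_realpow[of "2::real" 3] by simp
  moreover have ln2: "2 / 3 \<le> ln (2::real)" "ln (2::real) \<le> 1"
    using ln2_ge_two_thirds ln_le_minus_one[of "2::real"] by auto
  ultimately have A: "real W * ln 2 \<le> real W / 4 - 2 * real k + (1 + real k) * ln 2
      + 2 * real k * (3 * ln 2) + 4 * real k * ln (real k) + 2 * real k * ln (real N)"
    by (simp add: algebra_simps)
  have "real W / 2 \<le> real W * ln 2"
    using ln2 mult_left_mono[of "1 / 2" "ln 2" "real W"] by simp
  moreover have "(1 + real k) * ln 2 \<le> (2 * real k) * 1"
    using ln2 k1 by (intro mult_mono) auto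
  moreover have "2 * real k * (3 * ln 2) \<le> 2 * real k * 3"
    using ln2 by (intro mult_left_mono) auto
  moreover have "2 * real k * ln (real N) \<le> 4 * real k * ln (real N)"
    using N by (intro mult_right_mono) auto
  moreover have "4 * real k * ln (real k) \<le> 4 * real k * ln (real d)"
    using kd k1 by (intro mult_left_mono) auto
  ultimately have B: "real W / 4 \<le> 6 * real k + 4 * real k * ln (real d) + 4 * real k * ln (real N)"
    using A by linarith
  have d: "0 < d" using kd False by simp
  define l where "l = ln (real d * real N)"
  have l: "l = ln (real d) + ln (real N)" using d N by (simp add: l_def ln_mult)
  have W_le: "real W \<le> 24 * real k + 16 * real k * l"
    using B by (simp add: l algebra_simps)
  show ?thesis
  proof (cases "d * N = 1")
    case True
    then have "d = 1" "N = 1" by auto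
    then show ?thesis using W_le kd by (simp add: l_def)
  next
    case False
    moreover have "0 < d * N" using d N by simp
    ultimately have "2 \<le> d * N" by linarith
    then have "2 \<le> real d * real N" by (metis of_nat_le_iff of_nat_mult of_nat_numeral)
    then have "ln 2 \<le> l" using d N unfolding l_def by (subst ln_le_cancel_iff) auto
    \<comment> \<open>Hence the term \<open>24 k\<close> is at most \<open>48 k l\<close>, which
      together with \<open>16 k l\<close> gives the constant 64.\<close>
    then have "1 \<le> 2 * l" using ln2 by linarith
    then have "24 * real k * 1 \<le> 24 * real k * (2 * l)" by (intro mult_left_mono) auto
    then have "real W \<le> 64 * (real k * l)" using W_le by linarith
    then show ?thesis by (simp add: l_def)
  qed
qed

section \<open>Addresses of named memory cells\<close>

section \<open>Programs\<close>

text \<open>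
  Symbolic names of memory cells.  In a program the indices of a name are registers, see \<open>cell\<close>;
  in a memory content they are the values of these registers, see \<open>inst\<close>.
\<close>

datatype loc = InZ nat | Ctr nat | Ell nat nat | Alp | Piv | Nrm | Coef | Quo
  | Crd nat | Sel nat | Act nat | Row nat | Inv nat nat

primrec valid :: "nat \<Rightarrow> loc \<Rightarrow> bool" where
  "valid d (InZ i) \<longleftrightarrow> i < d"
| "valid d (Ctr i) \<longleftrightarrow> i < d"
| "valid d (Ell i j) \<longleftrightarrow> i < d \<and> j < d"
| "valid d Alp \<longleftrightarrow> True"
| "valid d Piv \<longleftrightarrow> True"
| "valid d Nrm \<longleftrightarrow> True"
| "valid d Coef \<longleftrightarrow> True"
| "valid d Quo \<longleftrightarrow> True"
| "valid d (Crd i) \<longleftrightarrow> i < d"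
| "valid d (Sel i) \<longleftrightarrow> i < d"
| "valid d (Act i) \<longleftrightarrow> i < d"
| "valid d (Row i) \<longleftrightarrow> i < d"
| "valid d (Inv i j) \<longleftrightarrow> i < d \<and> j < d"

text \<open>The blocks up to \<open>Alp\<close> follow the prescribed input and output layout. The
  rest is private: \<open>Act\<close> is the indicator of \<open>F\<close>, \<open>Inv\<close> holds
  \<open>G\<close>, \<open>Crd\<close> the coordinates and later the column factor of the update of
  \<open>G\<close>, \<open>Sel\<close> the row vector \<open>b\<close> of the update,
  \<open>Row\<close> the product \<open>b G\<close>, and the single cells its scalars.\<close>

primrec addr :: "nat \<Rightarrow> loc \<Rightarrow> nat" where
  "addr d (InZ i) = i"
| "addr d (Ctr i) = d + i"
| "addr d (Ell i j) = 2 * d + i * d + j"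
| "addr d Alp = 2 * d + d * d"
| "addr d Piv = 2 * d + d * d + 1"
| "addr d Nrm = 2 * d + d * d + 2"
| "addr d Coef = 2 * d + d * d + 3"
| "addr d Quo = 2 * d + d * d + 4"
| "addr d (Crd i) = 2 * d + d * d + 5 + i"
| "addr d (Sel i) = 2 * d + d * d + 5 + d + i"
| "addr d (Act i) = 2 * d + d * d + 5 + 2 * d + i"
| "addr d (Row i) = 2 * d + d * d + 5 + 3 * d + i"
| "addr d (Inv i j) = 2 * d + d * d + 5 + 4 * d + i * d + j"

abbreviation base_exp :: "nat \<Rightarrow> iexp"
  where "base_exp m \<equiv> IAdd (IAdd (IMul (INum 2) Dim) (IMul Dim Dim)) (INum m)"

primrec cell_exp :: "loc \<Rightarrow> iexp" where
  "cell_exp (InZ r) = Reg r"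
| "cell_exp (Ctr r) = IAdd Dim (Reg r)"
| "cell_exp (Ell r r') = IAdd (IAdd (IMul (INum 2) Dim) (IMul (Reg r) Dim)) (Reg r')"
| "cell_exp Alp = base_exp 0"
| "cell_exp Piv = base_exp 1"
| "cell_exp Nrm = base_exp 2"
| "cell_exp Coef = base_exp 3"
| "cell_exp Quo = base_exp 4"
| "cell_exp (Crd r) = IAdd (base_exp 5) (Reg r)"
| "cell_exp (Sel r) = IAdd (IAdd (base_exp 5) Dim) (Reg r)"
| "cell_exp (Act r) = IAdd (IAdd (base_exp 5) (IMul (INum 2) Dim)) (Reg r)"
| "cell_exp (Row r) = IAdd (IAdd (base_exp 5) (IMul (INum 3) Dim)) (Reg r)"
| "cell_exp (Inv r r') =
    IAdd (IAdd (IAdd (base_exp 5) (IMul (INum 4) Dim)) (IMul (Reg r) Dim)) (Reg r')"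

text \<open>A copy of \<open>cell_exp\<close> that the simplifier does not unfold.\<close>

definition cell :: "loc \<Rightarrow> iexp"
  where "cell = cell_exp"

primrec inst :: "(nat \<Rightarrow> nat) \<Rightarrow> loc \<Rightarrow> loc" where
  "inst \<rho> (InZ r) = InZ (\<rho> r)"
| "inst \<rho> (Ctr r) = Ctr (\<rho> r)"
| "inst \<rho> (Ell r r') = Ell (\<rho> r) (\<rho> r')"
| "inst \<rho> Alp = Alp"
| "inst \<rho> Piv = Piv"
| "inst \<rho> Nrm = Nrm"
| "inst \<rho> Coef = Coef"
| "inst \<rho> Quo = Quo"
| "inst \<rho> (Crd r) = Crd (\<rho> r)"
| "inst \<rho> (Sel r) = Sel (\<rho> r)"
| "inst \<rho> (Act r) = Act (\<rho> r)"
| "inst \<rho> (Row r) = Row (\<rho> r)"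
| "inst \<rho> (Inv r r') = Inv (\<rho> r) (\<rho> r')"

lemma row_major_less: "i < d \<Longrightarrow> j < d \<Longrightarrow> i * d + j < d * (d :: nat)"
proof -
  assume "i < d" "j < d"
  then have "i * d + j < Suc i * d" by simp
  also have "\<dots> \<le> d * d" using \<open>i < d\<close> by (intro mult_le_mono1) simp
  finally show ?thesis .
qed

lemma row_major_inj:
  assumes "i * d + j = i' * d + j'" "j < d" "j' < (d :: nat)"
  shows "i = i'" "j = j'"
proof -
  have "(i * d + j) div d = (i' * d + j') div d" using assms(1) by simp
  then show "i = i'" using assms(2,3) by simp
  then show "j = j'" using assms(1) by simp
qed

lemma addr_inj:
  assumes "valid d l" "valid d l'" "addr d l = addr d l'"
  shows "l = l'"
proof -
  \<comment> \<open>\<open>m\<close> is the offset within a matrix block; its bound by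
    \<open>d * d\<close> separates the blocks by linear arithmetic.\<close>
  define m where "m l = (case l of Ell i j \<Rightarrow> i * d + j | Inv i j \<Rightarrow> i * d + j | _ \<Rightarrow> 0)" for l
  have "m l \<le> d * d" if "valid d l" for l
    using that by (cases l) (auto simp: m_def intro: less_imp_le row_major_less)
  moreover have "valid d (Ell i j) \<Longrightarrow> m (Ell i j) < d * d" "valid d (Inv i j) \<Longrightarrow> m (Inv i j) < d * d" for i j
    by (auto simp: m_def row_major_less)
  ultimately show ?thesis
    using assms by (cases l; cases l'; fastforce simp: m_def dest: row_major_inj)
qed

lemma ival_cell: "ival d \<sigma> (cell l) = addr d (inst (regs \<sigma>) l)"
  by (cases l) (simp_all add: cell_def)

lemma icost_cell_simps [simp]:
  "icost (cell (InZ r)) = 1" "icost (cell (Ctr r)) = 3" "icost (cell (Ell r r')) = 9"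
  "icost (cell Alp) = 9" "icost (cell Piv) = 9" "icost (cell Nrm) = 9" "icost (cell Coef) = 9"
  "icost (cell Quo) = 9" "icost (cell (Crd r)) = 11" "icost (cell (Sel r)) = 13"
  "icost (cell (Act r)) = 15" "icost (cell (Row r)) = 15" "icost (cell (Inv r r')) = 19"
  by (simp_all add: cell_def)

lemma icost_cell: "icost (cell l) \<le> 19"
  by (cases l) simp_all

text \<open>All addresses are below \<open>2 * d ^ 2 + 6 * d + 5\<close>, at most
  \<open>13 * d ^ 2\<close> for positive \<open>d\<close>; the space bound also exceeds the literals
  in address expressions.\<close>

lemma iok_cell:
  assumes d: "1 \<le> d" and s: "20 * (d * d) \<le> s" and v: "valid d (inst (regs \<sigma>) l)"
  shows "iok d s \<sigma> (cell l)"
proof -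
  have dd: "d \<le> d * d" "1 \<le> d * d" using d by simp_all
  show ?thesis
  proof (cases l)
    case (Ell r r')
    then have "regs \<sigma> r * d + regs \<sigma> r' < d * d"
      using v by (simp add: row_major_less)
    then show ?thesis using Ell v by (auto simp: cell_def) (use s dd in linarith)+
  next
    case (Inv r r')
    then have "regs \<sigma> r * d + regs \<sigma> r' < d * d"
      using v by (simp add: row_major_less)
    then show ?thesis using Inv v by (auto simp: cell_def) (use s dd in linarith)+
  qed (use v in \<open>auto simp: cell_def\<close>, (use s dd in linarith)+)
qed

text \<open>Names out of range read as 0, so that memory contents can be compared by equality of
  functions; cells without a name are ignored.\<close>

definition view :: "nat \<Rightarrow> state \<Rightarrow> loc \<Rightarrow> real"
  where "view d \<sigma> l = (if valid d l then mem \<sigma> (addr d l) else 0)"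

lemma mem_cell: "valid d (inst (regs \<sigma>) l) \<Longrightarrow> mem \<sigma> (ival d \<sigma> (cell l)) = view d \<sigma> (inst (regs \<sigma>) l)"
  by (simp add: ival_cell view_def)

lemma view_write:
  assumes "valid d l"
  shows "view d (\<sigma>\<lparr>mem := (mem \<sigma>)(addr d l := x)\<rparr>) = (view d \<sigma>)(l := x)"
  using assms addr_inj[OF _ assms] by (auto simp: view_def fun_eq_iff)

lemma view_regs [simp]: "view d (\<sigma>\<lparr>regs := \<rho>\<rparr>) = view d \<sigma>"
  by (simp add: view_def fun_eq_iff)

lemma view_feed: "view d (feed d x \<sigma>) = (\<lambda>l. case l of InZ i \<Rightarrow> if i < d then x i else 0 | _ \<Rightarrow> view d \<sigma> l)"
  by (auto simp: view_def feed_def fun_eq_iff split: loc.splits)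

section \<open>Timed total-correctness triples and counting loops\<close>

definition regs_ok :: "nat list \<Rightarrow> state \<Rightarrow> bool"
  where "regs_ok vs \<sigma> \<longleftrightarrow> (\<forall>r<length vs. regs \<sigma> r = vs ! r)"

lemma regs_ok_simps [simp]:
  "regs_ok [] \<sigma>" "regs_ok [i] \<sigma> \<longleftrightarrow> regs \<sigma> 0 = i"
  "regs_ok [i, j] \<sigma> \<longleftrightarrow> regs \<sigma> 0 = i \<and> regs \<sigma> (Suc 0) = j"
  by (auto simp: regs_ok_def less_Suc_eq)

text \<open>A total-correctness triple with time bound \<open>B\<close>. The list \<open>vs\<close>
  holds the counters of the enclosing loops, kept in the registers \<open>0, 1, ...\<close>; they
  are preserved, while all later registers are free for inner loops.\<close>

definition transforms :: "nat \<Rightarrow> nat \<Rightarrow> nat list \<Rightarrow> com \<Rightarrow> nat \<Rightarrow> (loc \<Rightarrow> real) \<Rightarrow> (loc \<Rightarrow> real) \<Rightarrow> bool"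
  where "transforms d s vs p B X Y \<longleftrightarrow> (\<forall>\<sigma>. regs_ok vs \<sigma> \<longrightarrow> view d \<sigma> = X \<longrightarrow>
    (\<exists>T \<tau>. exec d s p \<sigma> T \<tau> \<and> T \<le> B \<and> regs_ok vs \<tau> \<and> view d \<tau> = Y))"

lemma transforms_seq:
  "transforms d s vs p B X Y \<Longrightarrow> transforms d s vs p' B' Y Z \<Longrightarrow> transforms d s vs (Seq p p') (B + B') X Z"
  unfolding transforms_def
proof (intro allI impI)
  fix \<sigma> assume 1: "\<forall>\<sigma>. regs_ok vs \<sigma> \<longrightarrow> view d \<sigma> = X \<longrightarrow>
      (\<exists>T \<tau>. exec d s p \<sigma> T \<tau> \<and> T \<le> B \<and> regs_ok vs \<tau> \<and> view d \<tau> = Y)"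
    and 2: "\<forall>\<sigma>. regs_ok vs \<sigma> \<longrightarrow> view d \<sigma> = Y \<longrightarrow>
      (\<exists>T \<tau>. exec d s p' \<sigma> T \<tau> \<and> T \<le> B' \<and> regs_ok vs \<tau> \<and> view d \<tau> = Z)"
    and \<sigma>: "regs_ok vs \<sigma>" "view d \<sigma> = X"
  obtain T \<tau> where \<tau>: "exec d s p \<sigma> T \<tau>" "T \<le> B" "regs_ok vs \<tau>" "view d \<tau> = Y"
    using 1 \<sigma> by blast
  obtain U \<upsilon> where \<upsilon>: "exec d s p' \<tau> U \<upsilon>" "U \<le> B'" "regs_ok vs \<upsilon>" "view d \<upsilon> = Z"
    using 2 \<tau> by blast
  show "\<exists>T \<tau>. exec d s (Seq p p') \<sigma> T \<tau> \<and> T \<le> B + B' \<and> regs_ok vs \<tau> \<and> view d \<tau> = Z"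
    using exec.Seq[OF \<tau>(1) \<upsilon>(1)] \<tau>(2) \<upsilon> by (intro exI[of _ "T + U"] exI[of _ \<upsilon>]) simp
qed

lemma transforms_mono: "transforms d s vs p B X Y \<Longrightarrow> B \<le> B' \<Longrightarrow> transforms d s vs p B' X Y"
  unfolding transforms_def by (metis (no_types, lifting) le_trans)

lemma transforms_skip: "1 \<le> B \<Longrightarrow> transforms d s vs Skip B X X"
  unfolding transforms_def using exec.Skip by blast

lemma transforms_if:
  assumes b: "\<And>\<sigma>. regs_ok vs \<sigma> \<Longrightarrow> view d \<sigma> = X \<Longrightarrow> bok d s \<sigma> b \<and> bval d \<sigma> b = t"
    and p: "t \<Longrightarrow> transforms d s vs p B X Y" and p': "\<not> t \<Longrightarrow> transforms d s vs p' B X Y"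
  shows "transforms d s vs (IfElse b p p') (bcost b + 1 + B) X Y"
  unfolding transforms_def
proof (intro allI impI)
  fix \<sigma> assume \<sigma>: "regs_ok vs \<sigma>" "view d \<sigma> = X"
  show "\<exists>T \<tau>. exec d s (IfElse b p p') \<sigma> T \<tau> \<and> T \<le> bcost b + 1 + B \<and> regs_ok vs \<tau> \<and> view d \<tau> = Y"
  proof (cases t)
    case True
    then obtain T \<tau> where "exec d s p \<sigma> T \<tau>" "T \<le> B" "regs_ok vs \<tau>" "view d \<tau> = Y"
      using p \<sigma> unfolding transforms_def by blast
    then show ?thesis
      using exec.IfTrue[of d s \<sigma> b p T \<tau> p'] b[OF \<sigma>] True by (intro exI[of _ "bcost b + 1 + T"] exI[of _ \<tau>]) auto
  next
    case False
    then obtain T \<tau> where "exec d s p' \<sigma> T \<tau>" "T \<le> B" "regs_ok vs \<tau>" "view d \<tau> = Y"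
      using p' \<sigma> unfolding transforms_def by blast
    then show ?thesis
      using exec.IfFalse[of d s \<sigma> b p' T \<tau> p] b[OF \<sigma>] False by (intro exI[of _ "bcost b + 1 + T"] exI[of _ \<tau>]) auto
  qed
qed

definition for_loop :: "nat \<Rightarrow> com \<Rightarrow> com"
  where "for_loop r p = Seq (SetReg r (INum 0))
    (WhileDo (ILess (Reg r) Dim) (Seq p (SetReg r (IAdd (Reg r) (INum 1)))))"

locale ram =
  fixes d s :: nat
  assumes d_pos: "1 \<le> d" and space: "20 * (d * d) \<le> s"
begin

lemma d_less_s: "d < s" "Suc 0 < s" "0 < s"
proof -
  have "d \<le> d * d" using d_pos by simp
  then show "d < s" "Suc 0 < s" "0 < s" using space d_pos by linarith+
qed

lemma transforms_set:
  assumes "\<And>\<sigma>. regs_ok vs \<sigma> \<Longrightarrow> view d \<sigma> = X \<Longrightarrow>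
      valid d (inst (regs \<sigma>) l) \<and> rok d s \<sigma> e \<and> Y = X(inst (regs \<sigma>) l := rval d \<sigma> e)"
  shows "transforms d s vs (SetCell (cell l) e) (20 + rcost e) X Y"
  unfolding transforms_def
proof (intro allI impI)
  fix \<sigma> assume \<sigma>: "regs_ok vs \<sigma>" "view d \<sigma> = X"
  note a = assms[OF \<sigma>]
  have "exec d s (SetCell (cell l) e) \<sigma> (icost (cell l) + rcost e + 1)
      (\<sigma>\<lparr>mem := (mem \<sigma>)(ival d \<sigma> (cell l) := rval d \<sigma> e)\<rparr>)"
    using a iok_cell[OF d_pos space] by (intro exec.SetCell) auto
  moreover have "view d (\<sigma>\<lparr>mem := (mem \<sigma>)(ival d \<sigma> (cell l) := rval d \<sigma> e)\<rparr>) = Y"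
    using a \<sigma> by (simp add: ival_cell view_write)
  moreover have "regs_ok vs (\<sigma>\<lparr>mem := (mem \<sigma>)(ival d \<sigma> (cell l) := rval d \<sigma> e)\<rparr>)"
    using \<sigma> by (simp add: regs_ok_def)
  moreover have "icost (cell l) + rcost e + 1 \<le> 20 + rcost e"
    using icost_cell[of l] by simp
  ultimately show "\<exists>T \<tau>. exec d s (SetCell (cell l) e) \<sigma> T \<tau> \<and> T \<le> 20 + rcost e \<and>
      regs_ok vs \<tau> \<and> view d \<tau> = Y" by blast
qed

text \<open>Induction on the number of remaining iterations. Each adds 4 steps for the test and 4
  for the increment to the cost of the body; the failing test costs 4.\<close>

lemma while_loop:
  assumes body: "\<And>i. i < d \<Longrightarrow> transforms d s (vs @ [i]) p B (X i) (X (Suc i))"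
    and vs: "length vs = r"
  shows "i \<le> d \<Longrightarrow> regs_ok (vs @ [i]) \<sigma> \<Longrightarrow> view d \<sigma> = X i \<Longrightarrow>
    \<exists>T \<tau>. exec d s (WhileDo (ILess (Reg r) Dim) (Seq p (SetReg r (IAdd (Reg r) (INum 1))))) \<sigma> T \<tau> \<and>
      T \<le> (d - i) * (B + 8) + 4 \<and> regs_ok vs \<tau> \<and> view d \<tau> = X d"
proof (induction "d - i" arbitrary: i \<sigma>)
  case 0
  then have r: "regs \<sigma> r = d" and "i = d" using vs by (auto simp: regs_ok_def nth_append)
  then have "exec d s (WhileDo (ILess (Reg r) Dim) (Seq p (SetReg r (IAdd (Reg r) (INum 1))))) \<sigma> 4 \<sigma>"
    using exec.WhileFalse[of d s \<sigma> "ILess (Reg r) Dim"] d_less_s by (simp add: numeral_eq_Suc)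
  then show ?case
    using 0 \<open>i = d\<close> by (intro exI[of _ 4] exI[of _ \<sigma>]) (auto simp: regs_ok_def nth_append)
next
  case (Suc n)
  then have i: "i < d" by simp
  obtain T \<tau> where \<tau>: "exec d s p \<sigma> T \<tau>" "T \<le> B" "regs_ok (vs @ [i]) \<tau>" "view d \<tau> = X (Suc i)"
    using body[OF i] Suc.prems unfolding transforms_def by blast
  have r: "regs \<sigma> r = i" "regs \<tau> r = i"
    using Suc.prems(2) \<tau>(3) vs by (auto simp: regs_ok_def nth_append)
  define \<tau>' where "\<tau>' = \<tau>\<lparr>regs := (regs \<tau>)(r := Suc i)\<rparr>"
  have step: "exec d s (SetReg r (IAdd (Reg r) (INum 1))) \<tau> 4 \<tau>'"
    using exec.SetReg[of d s \<tau> "IAdd (Reg r) (INum 1)" r] r i d_less_s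
    by (simp add: \<tau>'_def numeral_eq_Suc)
  have ok: "regs_ok (vs @ [Suc i]) \<tau>'"
    using \<tau>(3) vs by (auto simp: \<tau>'_def regs_ok_def nth_append)
  have vw: "view d \<tau>' = X (Suc i)" by (simp add: \<tau>'_def \<tau>(4))
  have n: "n = d - Suc i" using Suc.hyps(2) by simp
  obtain U \<upsilon> where \<upsilon>:
    "exec d s (WhileDo (ILess (Reg r) Dim) (Seq p (SetReg r (IAdd (Reg r) (INum 1))))) \<tau>' U \<upsilon>"
    "U \<le> (d - Suc i) * (B + 8) + 4" "regs_ok vs \<upsilon>" "view d \<upsilon> = X d"
    using Suc.hyps(1)[OF n Suc_leI[OF i] ok vw] by blast
  have "exec d s (WhileDo (ILess (Reg r) Dim) (Seq p (SetReg r (IAdd (Reg r) (INum 1))))) \<sigma>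
      (bcost (ILess (Reg r) Dim) + 1 + (T + 4) + U) \<upsilon>"
    using r i d_less_s by (intro exec.WhileTrue[OF _ _ exec.Seq[OF \<tau>(1) step] \<upsilon>(1)]) auto
  moreover have "bcost (ILess (Reg r) Dim) + 1 + (T + 4) + U \<le> (d - i) * (B + 8) + 4"
  proof -
    have "d - i = Suc (d - Suc i)" using i by simp
    then show ?thesis using \<tau>(2) \<upsilon>(2) by simp
  qed
  ultimately show ?case using \<upsilon> by blast
qed

lemma transforms_for:
  assumes body: "\<And>i. i < d \<Longrightarrow> transforms d s (vs @ [i]) p B (X i) (X (Suc i))"
    and vs: "length vs = r"
  shows "transforms d s vs (for_loop r p) (d * (B + 14)) (X 0) (X d)"
  unfolding transforms_def
proof (intro allI impI)
  fix \<sigma> assume \<sigma>: "regs_ok vs \<sigma>" "view d \<sigma> = X 0"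
  let ?\<sigma> = "\<sigma>\<lparr>regs := (regs \<sigma>)(r := 0)\<rparr>"
  have init: "exec d s (SetReg r (INum 0)) \<sigma> 2 ?\<sigma>"
    using exec.SetReg[of d s \<sigma> "INum 0" r] d_less_s by (simp add: numeral_eq_Suc)
  have "regs_ok (vs @ [0]) ?\<sigma>"
    using \<sigma> vs by (auto simp: regs_ok_def nth_append)
  then obtain T \<tau> where \<tau>:
    "exec d s (WhileDo (ILess (Reg r) Dim) (Seq p (SetReg r (IAdd (Reg r) (INum 1))))) ?\<sigma> T \<tau>"
    "T \<le> (d - 0) * (B + 8) + 4" "regs_ok vs \<tau>" "view d \<tau> = X d"
    using while_loop[OF body vs, of 0 ?\<sigma>] \<sigma> by auto
  have "exec d s (for_loop r p) \<sigma> (2 + T) \<tau>"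
    unfolding for_loop_def by (rule exec.Seq[OF init \<tau>(1)])
  \<comment> \<open>The 2 steps of initialisation and the 4 of the last test are charged to the
    iterations, of which there is at least one.\<close>
  moreover have "2 + T \<le> d * (B + 14)"
    using \<tau>(2) d_pos by (simp add: algebra_simps)
  ultimately show "\<exists>T \<tau>. exec d s (for_loop r p) \<sigma> T \<tau> \<and> T \<le> d * (B + 14) \<and> regs_ok vs \<tau> \<and> view d \<tau> = X d"
    using \<tau> by blast
qed

end

section \<open>The update program: coordinates, pivot search, rank-one update\<close>

abbreviation val :: "loc \<Rightarrow> rexp"
  where "val l \<equiv> Cell (cell l)"

abbreviation assign :: "loc \<Rightarrow> rexp \<Rightarrow> com" (infix "::=" 61)
  where "l ::= e \<equiv> SetCell (cell l) e"

abbreviation seq_com :: "com \<Rightarrow> com \<Rightarrow> com" (infixr ";;" 60)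
  where "p ;; q \<equiv> Seq p q"

definition center_prog :: com
  where "center_prog = for_loop 0 (InZ 0 ::= RSub (val (InZ 0)) (val (Ctr 0)))"

definition coord_prog :: com
  where "coord_prog = for_loop 0 (Crd 0 ::= RNum 0 ;;
    for_loop 1 (Crd 0 ::= RAdd (val (Crd 0)) (RMul (val (Inv 0 1)) (val (InZ 1)))))"

text \<open>Comparisons are strict, so \<open>x \<noteq> 0\<close> is tested as
  \<open>0 < x * x\<close>. In the end \<open>Piv\<close> is the first nonzero inactive coordinate
  and \<open>Sel\<close> the unit vector of its index; both are zero if there is none.\<close>

definition scan_prog :: com
  where "scan_prog = Piv ::= RNum 0 ;; Nrm ::= RNum 0 ;;
    for_loop 0 (Nrm ::= RAdd (val Nrm) (RMul (val (Crd 0)) (val (Crd 0))) ;;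
      IfElse (BAnd (BNot (RLess (RNum 0) (RMul (val Piv) (val Piv))))
          (BAnd (RLess (val (Act 0)) (RNum 1)) (RLess (RNum 0) (RMul (val (Crd 0)) (val (Crd 0))))))
        (Sel 0 ::= RNum 1 ;; Piv ::= val (Crd 0))
        (Sel 0 ::= RNum 0 ;; Skip))"

text \<open>Since \<open>Alp\<close> is \<open>1 / W\<close>, the quotient
  \<open>1 / (1 + Alp)\<close> is \<open>W / (W + 1)\<close>. This program and
  \<open>spanned_prog\<close> leave the update in a common form for \<open>add_prog\<close>:
  \<open>L + Coef (z - c) Sel\<close> and \<open>G - Crd (Sel G)\<close>.\<close>

definition unspanned_prog :: com
  where "unspanned_prog = Coef ::= RSqrt (RDiv (RNum 1) (RAdd (RNum 1) (val Alp))) ;;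
    Quo ::= RMul (val Coef) (val Piv) ;;
    for_loop 0 (Crd 0 ::= RDiv (RSub (RMul (val Coef) (val (Crd 0))) (val (Sel 0))) (val Quo) ;;
      Act 0 ::= RAdd (val (Act 0)) (val (Sel 0)))"

text \<open>\<open>Coef\<close> is the \<open>\<kappa>\<close> and \<open>Quo\<close> the root
  \<open>sqrt (1 + t)\<close> of \<open>add_spanned\<close>; \<open>Sel\<close> now holds the whole
  coordinate vector instead of a unit vector.\<close>

definition spanned_prog :: com
  where "spanned_prog = Quo ::= RSqrt (RAdd (RNum 1) (RDiv (val Nrm) (RAdd (RNum 1) (val Alp)))) ;;
    Coef ::= RDiv (RDiv (RNum 1) (RAdd (RNum 1) (val Alp))) (RAdd (val Quo) (RNum 1)) ;;
    for_loop 0 (Sel 0 ::= val (Crd 0) ;;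
      Crd 0 ::= RDiv (RMul (val Coef) (val (Crd 0))) (val Quo))"

definition row_prog :: com
  where "row_prog = for_loop 0 (Row 0 ::= RNum 0 ;;
    for_loop 1 (Row 0 ::= RAdd (val (Row 0)) (RMul (val (Sel 1)) (val (Inv 1 0)))))"

definition rank_one_prog :: com
  where "rank_one_prog = for_loop 0 (for_loop 1
    (Ell 0 1 ::= RAdd (val (Ell 0 1)) (RMul (RMul (val Coef) (val (InZ 0))) (val (Sel 1))) ;;
     Inv 0 1 ::= RSub (val (Inv 0 1)) (RMul (val (Crd 0)) (val (Row 1)))))"

text \<open>\<open>Alp / (1 + Alp)\<close> is \<open>1 / (W + 1)\<close>, both the step length of
  the mean and the new factor. The center has to move before \<open>Alp\<close> changes.\<close>

definition move_prog :: com
  where "move_prog =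
    for_loop 0 (Ctr 0 ::= RAdd (val (Ctr 0)) (RDiv (RMul (val (InZ 0)) (val Alp)) (RAdd (RNum 1) (val Alp)))) ;;
    Alp ::= RDiv (val Alp) (RAdd (RNum 1) (val Alp))"

definition first_prog :: com
  where "first_prog = for_loop 0 (Ctr 0 ::= val (InZ 0) ;; Inv 0 0 ::= RNum 1) ;; Alp ::= RNum 1"

text \<open>\<open>Row\<close> is computed first because \<open>rank_one_prog\<close> overwrites
  \<open>Inv\<close>.\<close>

definition add_prog :: com
  where "add_prog = row_prog ;; rank_one_prog ;; move_prog"

text \<open>The value 0 of \<open>Alp\<close> in the start state marks the first point, so the
  initialisation can be empty.\<close>

definition rounding_prog :: com
  where "rounding_prog = IfElse (RLess (RNum 0) (val Alp))
    (center_prog ;; coord_prog ;; scan_prog ;;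
      IfElse (RLess (RNum 0) (RMul (val Piv) (val Piv))) (unspanned_prog ;; add_prog)
        (IfElse (RLess (RNum 1) (RAdd (val Nrm) (val Alp))) (spanned_prog ;; add_prog) Skip))
    first_prog"

text \<open>In the following loop invariants \<open>n\<close> is the number of completed iterations.\<close>

definition centered :: "nat \<Rightarrow> (loc \<Rightarrow> real) \<Rightarrow> loc \<Rightarrow> real"
  where "centered n X l = (case l of InZ k \<Rightarrow> if k < n then X (InZ k) - X (Ctr k) else X l | _ \<Rightarrow> X l)"

definition with_coords :: "nat \<Rightarrow> nat \<Rightarrow> (loc \<Rightarrow> real) \<Rightarrow> loc \<Rightarrow> real"
  where "with_coords d n X l = (case l of Crd k \<Rightarrow>
    if k < n then \<Sum>j<d. X (Inv k j) * X (InZ j) else X l | _ \<Rightarrow> X l)"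

text \<open>The value 0 means that no inactive index with a nonzero coordinate has been met yet.\<close>

primrec pivot :: "(loc \<Rightarrow> real) \<Rightarrow> nat \<Rightarrow> real" where
  "pivot X 0 = 0"
| "pivot X (Suc k) = (if pivot X k = 0 \<and> X (Act k) < 1 \<and> X (Crd k) \<noteq> 0 then X (Crd k) else pivot X k)"

definition scanned :: "nat \<Rightarrow> (loc \<Rightarrow> real) \<Rightarrow> loc \<Rightarrow> real"
  where "scanned n X l = (case l of Piv \<Rightarrow> pivot X n | Nrm \<Rightarrow> \<Sum>k<n. (X (Crd k))\<^sup>2
    | Sel k \<Rightarrow> if k < n then of_bool (pivot X k = 0 \<and> X (Act k) < 1 \<and> X (Crd k) \<noteq> 0) else X l
    | _ \<Rightarrow> X l)"

definition unspanned_step :: "nat \<Rightarrow> (loc \<Rightarrow> real) \<Rightarrow> loc \<Rightarrow> real"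
  where "unspanned_step n X l = (case l of
      Crd k \<Rightarrow> if k < n then (X Coef * X (Crd k) - X (Sel k)) / X Quo else X l
    | Act k \<Rightarrow> if k < n then X (Act k) + X (Sel k) else X l
    | _ \<Rightarrow> X l)"

definition spanned_step :: "nat \<Rightarrow> (loc \<Rightarrow> real) \<Rightarrow> loc \<Rightarrow> real"
  where "spanned_step n X l = (case l of
      Crd k \<Rightarrow> if k < n then X Coef * X (Crd k) / X Quo else X l
    | Sel k \<Rightarrow> if k < n then X (Crd k) else X l
    | _ \<Rightarrow> X l)"

definition with_row :: "nat \<Rightarrow> nat \<Rightarrow> (loc \<Rightarrow> real) \<Rightarrow> loc \<Rightarrow> real"
  where "with_row d n X l = (case l of Row k \<Rightarrow>
    if k < n then \<Sum>j<d. X (Sel j) * X (Inv j k) else X l | _ \<Rightarrow> X l)"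

definition rank_one_step :: "nat \<Rightarrow> nat \<Rightarrow> nat \<Rightarrow> (loc \<Rightarrow> real) \<Rightarrow> loc \<Rightarrow> real"
  where "rank_one_step d n m X l = (case l of
      Ell i j \<Rightarrow> if i < n \<and> j < d \<or> i = n \<and> j < m then X l + X Coef * X (InZ i) * X (Sel j) else X l
    | Inv i j \<Rightarrow> if i < n \<and> j < d \<or> i = n \<and> j < m then X l - X (Crd i) * X (Row j) else X l
    | _ \<Rightarrow> X l)"

definition moved :: "nat \<Rightarrow> (loc \<Rightarrow> real) \<Rightarrow> loc \<Rightarrow> real"
  where "moved n X l = (case l of
    Ctr k \<Rightarrow> if k < n then X (Ctr k) + X (InZ k) * X Alp / (1 + X Alp) else X l | _ \<Rightarrow> X l)"

definition first_step :: "nat \<Rightarrow> (loc \<Rightarrow> real) \<Rightarrow> loc \<Rightarrow> real"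
  where "first_step n X l = (case l of
      Ctr k \<Rightarrow> if k < n then X (InZ k) else X l
    | Inv i j \<Rightarrow> if i < n \<and> i = j then 1 else X l
    | _ \<Rightarrow> X l)"

definition added :: "nat \<Rightarrow> (loc \<Rightarrow> real) \<Rightarrow> loc \<Rightarrow> real"
  where "added d X = (let Y = moved d (rank_one_step d d 0 (with_row d d X))
    in Y(Alp := Y Alp / (1 + Y Alp)))"

definition unspanned_start :: "(loc \<Rightarrow> real) \<Rightarrow> loc \<Rightarrow> real"
  where "unspanned_start X = X(Coef := sqrt (1 / (1 + X Alp)), Quo := sqrt (1 / (1 + X Alp)) * X Piv)"

definition spanned_start :: "(loc \<Rightarrow> real) \<Rightarrow> loc \<Rightarrow> real"
  where "spanned_start X = X(Quo := sqrt (1 + X Nrm / (1 + X Alp)),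
    Coef := 1 / (1 + X Alp) / (sqrt (1 + X Nrm / (1 + X Alp)) + 1))"

definition scanned_input :: "nat \<Rightarrow> (loc \<Rightarrow> real) \<Rightarrow> loc \<Rightarrow> real"
  where "scanned_input d X = scanned d (with_coords d d (centered d X))"

definition updated :: "nat \<Rightarrow> (loc \<Rightarrow> real) \<Rightarrow> loc \<Rightarrow> real"
  where "updated d X =
    (if 0 < X Alp then
      (let Y = scanned_input d X in
        if Y Piv \<noteq> 0 then added d (unspanned_step d (unspanned_start Y))
        else if 1 < Y Nrm + X Alp then added d (spanned_step d (spanned_start Y))
        else Y)
     else (first_step d X)(Alp := 1))"

section \<open>Correctness and running time of the program pieces\<close>

context ram
begin

lemma iok_cell' [simp]: "valid d (inst (regs \<sigma>) l) \<Longrightarrow> iok d s \<sigma> (cell l)"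
  by (rule iok_cell[OF d_pos space])

text \<open>One cost for all assignments, 20 for the address and the store and 180 for the
  expression, so that the cost of a program follows from its loop structure.\<close>

lemma transforms_assign:
  assumes "\<And>\<sigma>. regs_ok vs \<sigma> \<Longrightarrow> view d \<sigma> = X \<Longrightarrow>
      valid d (inst (regs \<sigma>) l) \<and> rok d s \<sigma> e \<and> Y = X(inst (regs \<sigma>) l := rval d \<sigma> e)"
    and "rcost e \<le> 180"
  shows "transforms d s vs (l ::= e) 200 X Y"
  by (rule transforms_mono[OF transforms_set[OF assms(1)]]) (use assms(2) in auto)

lemma d_le_square: "d \<le> d * d"
  using d_pos by simp

lemma linear_le_quadratic:
  assumes "a + b \<le> c"
  shows "a + d * b \<le> c * (d * d)" "d * b + a \<le> c * (d * d)"
proof -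
  have "a * 1 + b * d \<le> a * (d * d) + b * (d * d)"
    using d_pos by (intro add_mono mult_left_mono) auto
  also have "\<dots> \<le> c * (d * d)"
    using assms by (simp flip: distrib_right)
  finally show "a + d * b \<le> c * (d * d)" "d * b + a \<le> c * (d * d)"
    by (simp_all add: mult.commute)
qed

lemma transforms_center: "transforms d s [] center_prog (1000 * (d * d)) X (centered d X)"
proof -
  have "transforms d s [] center_prog (d * (200 + 14)) (centered 0 X) (centered d X)"
    unfolding center_prog_def
    by (intro transforms_for transforms_assign)
      (auto simp: mem_cell fun_eq_iff less_Suc_eq centered_def split: loc.splits)
  moreover have "centered 0 X = X"
    by (auto simp: fun_eq_iff centered_def split: loc.splits)
  ultimately show ?thesis
    using d_le_square by (auto elim!: transforms_mono)
qed

lemma transforms_coord: "transforms d s [] coord_prog (1000 * (d * d)) X (with_coords d d X)"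
proof -
  have "transforms d s [] coord_prog (d * ((200 + d * (200 + 14)) + 14)) (with_coords d 0 X) (with_coords d d X)"
    unfolding coord_prog_def
  proof (intro transforms_for transforms_seq transforms_assign)
    fix i assume i: "i < d"
    \<comment> \<open>Invariant of the inner loop: the first \<open>i\<close> coordinates are
      complete, and \<open>Crd i\<close> holds a partial sum.\<close>
    define Y where "Y n = (with_coords d i X)(Crd i := \<Sum>j<n. X (Inv i j) * X (InZ j))" for n
    have "transforms d s ([] @ [i]) (for_loop 1 (Crd 0 ::= RAdd (val (Crd 0)) (RMul (val (Inv 0 1)) (val (InZ 1)))))
        (d * (200 + 14)) (Y 0) (Y d)"
      using i by (intro transforms_for transforms_assign)
        (auto simp: mem_cell Y_def with_coords_def)
    moreover have "Y d = with_coords d (Suc i) X"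
      by (auto simp: Y_def with_coords_def fun_eq_iff less_Suc_eq split: loc.splits)
    ultimately show "transforms d s ([] @ [i]) (for_loop 1 (Crd 0 ::= RAdd (val (Crd 0)) (RMul (val (Inv 0 1)) (val (InZ 1)))))
        (d * (200 + 14)) ((with_coords d i X)(Crd i := 0)) (with_coords d (Suc i) X)"
      by (simp add: Y_def)
  qed auto
  moreover have "with_coords d 0 X = X"
    by (auto simp: fun_eq_iff with_coords_def split: loc.splits)
  ultimately show ?thesis
    using d_le_square by (auto elim!: transforms_mono simp: distrib_left)
qed

lemma transforms_row: "transforms d s [] row_prog (1000 * (d * d)) X (with_row d d X)"
proof -
  have "transforms d s [] row_prog (d * ((200 + d * (200 + 14)) + 14)) (with_row d 0 X) (with_row d d X)"
    unfolding row_prog_def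
  proof (intro transforms_for transforms_seq transforms_assign)
    fix i assume i: "i < d"
    define Y where "Y n = (with_row d i X)(Row i := \<Sum>j<n. X (Sel j) * X (Inv j i))" for n
    have "transforms d s ([] @ [i]) (for_loop 1 (Row 0 ::= RAdd (val (Row 0)) (RMul (val (Sel 1)) (val (Inv 1 0)))))
        (d * (200 + 14)) (Y 0) (Y d)"
      using i by (intro transforms_for transforms_assign)
        (auto simp: mem_cell Y_def with_row_def)
    moreover have "Y d = with_row d (Suc i) X"
      by (auto simp: Y_def with_row_def fun_eq_iff less_Suc_eq split: loc.splits)
    ultimately show "transforms d s ([] @ [i]) (for_loop 1 (Row 0 ::= RAdd (val (Row 0)) (RMul (val (Sel 1)) (val (Inv 1 0)))))
        (d * (200 + 14)) ((with_row d i X)(Row i := 0)) (with_row d (Suc i) X)"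
      by (simp add: Y_def)
  qed auto
  moreover have "with_row d 0 X = X"
    by (auto simp: fun_eq_iff with_row_def split: loc.splits)
  ultimately show ?thesis
    using d_le_square by (auto elim!: transforms_mono simp: distrib_left)
qed

lemma transforms_scan: "transforms d s [] scan_prog (3000 * (d * d)) X (scanned d X)"
proof -
  have zero: "X(Piv := 0, Nrm := 0) = scanned 0 X"
    by (auto simp: fun_eq_iff scanned_def split: loc.splits)
  have body: "transforms d s ([] @ [i])
      (Nrm ::= RAdd (val Nrm) (RMul (val (Crd 0)) (val (Crd 0))) ;;
      IfElse (BAnd (BNot (RLess (RNum 0) (RMul (val Piv) (val Piv))))
          (BAnd (RLess (val (Act 0)) (RNum 1)) (RLess (RNum 0) (RMul (val (Crd 0)) (val (Crd 0))))))
        (Sel 0 ::= RNum 1 ;; Piv ::= val (Crd 0))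
        (Sel 0 ::= RNum 0 ;; Skip)) 1000 (scanned i X) (scanned (Suc i) X)" if i: "i < d" for i
  proof -
    define Y where "Y = (scanned i X)(Nrm := \<Sum>k<Suc i. (X (Crd k))\<^sup>2)"
    define t where "t \<longleftrightarrow> pivot X i = 0 \<and> X (Act i) < 1 \<and> X (Crd i) \<noteq> 0"
    have 1: "transforms d s ([] @ [i]) (Nrm ::= RAdd (val Nrm) (RMul (val (Crd 0)) (val (Crd 0)))) 200 (scanned i X) Y"
      using i by (intro transforms_assign) (auto simp: mem_cell Y_def scanned_def power2_eq_square)
    have t1: "transforms d s ([] @ [i]) (Sel 0 ::= RNum 1 ;; Piv ::= val (Crd 0)) (200 + 200) Y (scanned (Suc i) X)" if t
    proof (intro transforms_seq transforms_assign)
      show "valid d (inst (regs \<sigma>) (Sel 0)) \<and> rok d s \<sigma> (RNum 1) \<and> Y(Sel i := 1) = Y(inst (regs \<sigma>) (Sel 0) := rval d \<sigma> (RNum 1))"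
        if "regs_ok ([] @ [i]) \<sigma>" for \<sigma>
        using that i by auto
      show "valid d (inst (regs \<sigma>) Piv) \<and> rok d s \<sigma> (val (Crd 0)) \<and>
          scanned (Suc i) X = (Y(Sel i := 1))(inst (regs \<sigma>) Piv := rval d \<sigma> (val (Crd 0)))"
        if "regs_ok ([] @ [i]) \<sigma>" "view d \<sigma> = Y(Sel i := 1)" for \<sigma>
        using that i \<open>t\<close> by (auto simp: t_def Y_def mem_cell scanned_def fun_eq_iff less_Suc_eq split: loc.splits)
    qed auto
    have t0: "transforms d s ([] @ [i]) (Sel 0 ::= RNum 0 ;; Skip) (200 + 1) Y (scanned (Suc i) X)" if "\<not> t"
    proof (intro transforms_seq transforms_assign)
      show "valid d (inst (regs \<sigma>) (Sel 0)) \<and> rok d s \<sigma> (RNum 0) \<and>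
          scanned (Suc i) X = Y(inst (regs \<sigma>) (Sel 0) := rval d \<sigma> (RNum 0))"
        if "regs_ok ([] @ [i]) \<sigma>" for \<sigma>
        using that i \<open>\<not> t\<close> by (auto simp: t_def Y_def scanned_def fun_eq_iff less_Suc_eq split: loc.splits)
    qed (auto simp: transforms_skip)
    have 2: "transforms d s ([] @ [i]) (IfElse (BAnd (BNot (RLess (RNum 0) (RMul (val Piv) (val Piv))))
          (BAnd (RLess (val (Act 0)) (RNum 1)) (RLess (RNum 0) (RMul (val (Crd 0)) (val (Crd 0))))))
        (Sel 0 ::= RNum 1 ;; Piv ::= val (Crd 0))
        (Sel 0 ::= RNum 0 ;; Skip)) (bcost (BAnd (BNot (RLess (RNum 0) (RMul (val Piv) (val Piv))))
          (BAnd (RLess (val (Act 0)) (RNum 1)) (RLess (RNum 0) (RMul (val (Crd 0)) (val (Crd 0)))))) + 1 + 400)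
        Y (scanned (Suc i) X)"
    proof (rule transforms_if[where t = t])
      fix \<sigma> assume "regs_ok ([] @ [i]) \<sigma>" "view d \<sigma> = Y"
      then show "bok d s \<sigma> (BAnd (BNot (RLess (RNum 0) (RMul (val Piv) (val Piv))))
            (BAnd (RLess (val (Act 0)) (RNum 1)) (RLess (RNum 0) (RMul (val (Crd 0)) (val (Crd 0)))))) \<and>
          bval d \<sigma> (BAnd (BNot (RLess (RNum 0) (RMul (val Piv) (val Piv))))
            (BAnd (RLess (val (Act 0)) (RNum 1)) (RLess (RNum 0) (RMul (val (Crd 0)) (val (Crd 0)))))) = t"
        using i by (auto simp: mem_cell t_def Y_def scanned_def zero_less_mult_iff linorder_neq_iff)
    next
      show "transforms d s ([] @ [i]) (Sel 0 ::= RNum 1 ;; Piv ::= val (Crd 0)) 400 Y (scanned (Suc i) X)" if t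
        using t1[OF that] by simp
      show "transforms d s ([] @ [i]) (Sel 0 ::= RNum 0 ;; Skip) 400 Y (scanned (Suc i) X)" if "\<not> t"
        using t0[OF that] by (rule transforms_mono) simp
    qed
    show ?thesis
      by (rule transforms_mono[OF transforms_seq[OF 1 2]]) simp
  qed
  have "transforms d s [] scan_prog (200 + (200 + d * (1000 + 14))) X (scanned d X)"
    unfolding scan_prog_def
  proof (intro transforms_seq)
    show "transforms d s [] (Piv ::= RNum 0) 200 X (X(Piv := 0))"
      by (intro transforms_assign) auto
    show "transforms d s [] (Nrm ::= RNum 0) 200 (X(Piv := 0)) (scanned 0 X)"
      unfolding zero[symmetric] by (intro transforms_assign) auto
  qed (intro transforms_for body, simp_all)
  then show ?thesis
    by (auto elim!: transforms_mono intro!: linear_le_quadratic)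
qed

lemma transforms_unspanned:
  assumes "0 < X Alp" "X Piv \<noteq> 0"
  shows "transforms d s [] unspanned_prog (1000 * (d * d)) X (unspanned_step d (unspanned_start X))"
proof -
  define Y where "Y = unspanned_start X"
  have Q: "Y Quo \<noteq> 0" using assms by (simp add: Y_def unspanned_start_def)
  have "transforms d s [] unspanned_prog (200 + (200 + d * ((200 + 200) + 14))) X (unspanned_step d Y)"
    unfolding unspanned_prog_def
  proof (intro transforms_seq)
    show "transforms d s [] (Coef ::= RSqrt (RDiv (RNum 1) (RAdd (RNum 1) (val Alp)))) 200 X
        (X(Coef := sqrt (1 / (1 + X Alp))))"
      using assms by (intro transforms_assign) (auto simp: mem_cell)
    show "transforms d s [] (Quo ::= RMul (val Coef) (val Piv)) 200 (X(Coef := sqrt (1 / (1 + X Alp))))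
        (unspanned_step 0 Y)"
      by (intro transforms_assign)
        (auto simp: mem_cell Y_def unspanned_start_def unspanned_step_def fun_eq_iff split: loc.splits)
  next
    show "transforms d s [] (for_loop 0
        (Crd 0 ::= RDiv (RSub (RMul (val Coef) (val (Crd 0))) (val (Sel 0))) (val Quo) ;;
         Act 0 ::= RAdd (val (Act 0)) (val (Sel 0)))) (d * ((200 + 200) + 14)) (unspanned_step 0 Y) (unspanned_step d Y)"
    proof (intro transforms_for transforms_seq transforms_assign)
      fix i \<sigma> assume i: "i < d" and "regs_ok ([] @ [i]) \<sigma>" "view d \<sigma> = unspanned_step i Y"
      then show "valid d (inst (regs \<sigma>) (Crd 0)) \<and>
          rok d s \<sigma> (RDiv (RSub (RMul (val Coef) (val (Crd 0))) (val (Sel 0))) (val Quo)) \<and>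
          (unspanned_step i Y)(Crd i := (Y Coef * Y (Crd i) - Y (Sel i)) / Y Quo) =
          (unspanned_step i Y)(inst (regs \<sigma>) (Crd 0) :=
            rval d \<sigma> (RDiv (RSub (RMul (val Coef) (val (Crd 0))) (val (Sel 0))) (val Quo)))"
        using Q by (auto simp: mem_cell unspanned_step_def)
    next
      fix i \<sigma> assume i: "i < d" and "regs_ok ([] @ [i]) \<sigma>"
        "view d \<sigma> = (unspanned_step i Y)(Crd i := (Y Coef * Y (Crd i) - Y (Sel i)) / Y Quo)"
      then show "valid d (inst (regs \<sigma>) (Act 0)) \<and> rok d s \<sigma> (RAdd (val (Act 0)) (val (Sel 0))) \<and>
          unspanned_step (Suc i) Y = ((unspanned_step i Y)(Crd i := (Y Coef * Y (Crd i) - Y (Sel i)) / Y Quo))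
            (inst (regs \<sigma>) (Act 0) := rval d \<sigma> (RAdd (val (Act 0)) (val (Sel 0))))"
        by (auto simp: mem_cell unspanned_step_def fun_eq_iff less_Suc_eq split: loc.splits)
    qed auto
  qed
  then show ?thesis
    unfolding Y_def by (auto elim!: transforms_mono intro!: linear_le_quadratic)
qed

lemma transforms_spanned:
  assumes "0 < X Alp" "0 \<le> X Nrm"
  shows "transforms d s [] spanned_prog (1000 * (d * d)) X (spanned_step d (spanned_start X))"
proof -
  define Y where "Y = spanned_start X"
  have q: "0 < 1 + X Nrm / (1 + X Alp)"
    using assms by (intro add_pos_nonneg divide_nonneg_pos) auto
  then have Q: "0 < Y Quo" by (simp add: Y_def spanned_start_def)
  have "transforms d s [] spanned_prog (200 + (200 + d * ((200 + 200) + 14))) X (spanned_step d Y)"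
    unfolding spanned_prog_def
  proof (intro transforms_seq)
    show "transforms d s [] (Quo ::= RSqrt (RAdd (RNum 1) (RDiv (val Nrm) (RAdd (RNum 1) (val Alp))))) 200 X
        (X(Quo := sqrt (1 + X Nrm / (1 + X Alp))))"
      using assms q by (intro transforms_assign) (auto simp: mem_cell)
    show "transforms d s [] (Coef ::= RDiv (RDiv (RNum 1) (RAdd (RNum 1) (val Alp))) (RAdd (val Quo) (RNum 1)))
        200 (X(Quo := sqrt (1 + X Nrm / (1 + X Alp)))) (spanned_step 0 Y)"
    proof (intro transforms_assign)
      fix \<sigma> assume "view d \<sigma> = X(Quo := sqrt (1 + X Nrm / (1 + X Alp)))"
      moreover have "sqrt (1 + X Nrm / (1 + X Alp)) + 1 \<noteq> 0"
        using q by (smt (verit) real_sqrt_gt_zero)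
      ultimately show "valid d (inst (regs \<sigma>) Coef) \<and>
          rok d s \<sigma> (RDiv (RDiv (RNum 1) (RAdd (RNum 1) (val Alp))) (RAdd (val Quo) (RNum 1))) \<and>
          spanned_step 0 Y = (X(Quo := sqrt (1 + X Nrm / (1 + X Alp))))(inst (regs \<sigma>) Coef :=
            rval d \<sigma> (RDiv (RDiv (RNum 1) (RAdd (RNum 1) (val Alp))) (RAdd (val Quo) (RNum 1))))"
        using assms
        by (auto simp: mem_cell Y_def spanned_start_def spanned_step_def fun_eq_iff split: loc.splits)
    qed auto
  next
    show "transforms d s [] (for_loop 0 (Sel 0 ::= val (Crd 0) ;;
        Crd 0 ::= RDiv (RMul (val Coef) (val (Crd 0))) (val Quo))) (d * ((200 + 200) + 14))
        (spanned_step 0 Y) (spanned_step d Y)"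
    proof (intro transforms_for transforms_seq transforms_assign)
      fix i \<sigma> assume i: "i < d" and "regs_ok ([] @ [i]) \<sigma>" "view d \<sigma> = spanned_step i Y"
      then show "valid d (inst (regs \<sigma>) (Sel 0)) \<and> rok d s \<sigma> (val (Crd 0)) \<and>
          (spanned_step i Y)(Sel i := Y (Crd i)) =
          (spanned_step i Y)(inst (regs \<sigma>) (Sel 0) := rval d \<sigma> (val (Crd 0)))"
        by (auto simp: mem_cell spanned_step_def)
    next
      fix i \<sigma> assume i: "i < d" and "regs_ok ([] @ [i]) \<sigma>"
        "view d \<sigma> = (spanned_step i Y)(Sel i := Y (Crd i))"
      then show "valid d (inst (regs \<sigma>) (Crd 0)) \<and> rok d s \<sigma> (RDiv (RMul (val Coef) (val (Crd 0))) (val Quo)) \<and>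
          spanned_step (Suc i) Y = ((spanned_step i Y)(Sel i := Y (Crd i)))
            (inst (regs \<sigma>) (Crd 0) := rval d \<sigma> (RDiv (RMul (val Coef) (val (Crd 0))) (val Quo)))"
        using Q by (auto simp: mem_cell spanned_step_def fun_eq_iff less_Suc_eq split: loc.splits)
    qed auto
  qed
  then show ?thesis
    unfolding Y_def by (auto elim!: transforms_mono intro!: linear_le_quadratic)
qed

lemma transforms_rank_one: "transforms d s [] rank_one_prog (1000 * (d * d)) X (rank_one_step d d 0 X)"
proof -
  have "transforms d s [] rank_one_prog (d * ((d * ((200 + 200) + 14)) + 14)) (rank_one_step d 0 0 X) (rank_one_step d d 0 X)"
    unfolding rank_one_prog_def
  proof (intro transforms_for)
    fix i assume i: "i < d"
    have "transforms d s ([] @ [i]) (for_loop 1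
        (Ell 0 1 ::= RAdd (val (Ell 0 1)) (RMul (RMul (val Coef) (val (InZ 0))) (val (Sel 1))) ;;
         Inv 0 1 ::= RSub (val (Inv 0 1)) (RMul (val (Crd 0)) (val (Row 1)))))
        (d * ((200 + 200) + 14)) (rank_one_step d i 0 X) (rank_one_step d i d X)"
    proof (intro transforms_for transforms_seq transforms_assign)
      fix j \<sigma> assume "j < d" "regs_ok (([] @ [i]) @ [j]) \<sigma>" "view d \<sigma> = rank_one_step d i j X"
      then show "valid d (inst (regs \<sigma>) (Ell 0 1)) \<and>
          rok d s \<sigma> (RAdd (val (Ell 0 1)) (RMul (RMul (val Coef) (val (InZ 0))) (val (Sel 1)))) \<and>
          (rank_one_step d i j X)(Ell i j := X (Ell i j) + X Coef * X (InZ i) * X (Sel j)) =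
          (rank_one_step d i j X)(inst (regs \<sigma>) (Ell 0 1) :=
            rval d \<sigma> (RAdd (val (Ell 0 1)) (RMul (RMul (val Coef) (val (InZ 0))) (val (Sel 1)))))"
        using i by (auto simp: mem_cell rank_one_step_def)
    next
      fix j \<sigma> assume "j < d" "regs_ok (([] @ [i]) @ [j]) \<sigma>"
        "view d \<sigma> = (rank_one_step d i j X)(Ell i j := X (Ell i j) + X Coef * X (InZ i) * X (Sel j))"
      then show "valid d (inst (regs \<sigma>) (Inv 0 1)) \<and>
          rok d s \<sigma> (RSub (val (Inv 0 1)) (RMul (val (Crd 0)) (val (Row 1)))) \<and>
          rank_one_step d i (Suc j) X =
          ((rank_one_step d i j X)(Ell i j := X (Ell i j) + X Coef * X (InZ i) * X (Sel j)))
            (inst (regs \<sigma>) (Inv 0 1) := rval d \<sigma> (RSub (val (Inv 0 1)) (RMul (val (Crd 0)) (val (Row 1)))))"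
        using i by (auto simp: mem_cell rank_one_step_def fun_eq_iff less_Suc_eq split: loc.splits)
    qed auto
    \<comment> \<open>A finished row \<open>i\<close> is an unstarted row \<open>i + 1\<close>,
      which links the inner loop to the outer one.\<close>
    moreover have "rank_one_step d i d X = rank_one_step d (Suc i) 0 X"
      by (auto simp: rank_one_step_def fun_eq_iff less_Suc_eq split: loc.splits)
    ultimately show "transforms d s ([] @ [i]) (for_loop 1
        (Ell 0 1 ::= RAdd (val (Ell 0 1)) (RMul (RMul (val Coef) (val (InZ 0))) (val (Sel 1))) ;;
         Inv 0 1 ::= RSub (val (Inv 0 1)) (RMul (val (Crd 0)) (val (Row 1)))))
        (d * ((200 + 200) + 14)) (rank_one_step d i 0 X) (rank_one_step d (Suc i) 0 X)"
      by simp
  qed simp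
  moreover have "rank_one_step d 0 0 X = X"
    by (auto simp: fun_eq_iff rank_one_step_def split: loc.splits)
  ultimately show ?thesis
    using d_le_square by (auto elim!: transforms_mono simp: distrib_left)
qed

lemma transforms_move:
  assumes "0 < X Alp"
  shows "transforms d s [] move_prog (1000 * (d * d)) X
    ((moved d X)(Alp := moved d X Alp / (1 + moved d X Alp)))"
proof -
  have "transforms d s [] move_prog (d * (200 + 14) + 200) (moved 0 X)
      ((moved d X)(Alp := moved d X Alp / (1 + moved d X Alp)))"
    unfolding move_prog_def
  proof (rule transforms_seq)
    show "transforms d s [] (for_loop 0 (Ctr 0 ::=
        RAdd (val (Ctr 0)) (RDiv (RMul (val (InZ 0)) (val Alp)) (RAdd (RNum 1) (val Alp)))))
        (d * (200 + 14)) (moved 0 X) (moved d X)"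
      using assms by (intro transforms_for transforms_assign)
        (auto simp: mem_cell fun_eq_iff less_Suc_eq moved_def split: loc.splits)
    show "transforms d s [] (Alp ::= RDiv (val Alp) (RAdd (RNum 1) (val Alp))) 200 (moved d X)
        ((moved d X)(Alp := moved d X Alp / (1 + moved d X Alp)))"
      using assms by (intro transforms_assign) (auto simp: mem_cell moved_def)
  qed
  moreover have "moved 0 X = X"
    by (auto simp: fun_eq_iff moved_def split: loc.splits)
  ultimately show ?thesis
    by (auto elim!: transforms_mono intro!: linear_le_quadratic)
qed

lemma transforms_first:
  "transforms d s [] first_prog (1000 * (d * d)) X ((first_step d X)(Alp := 1))"
proof -
  have "transforms d s [] first_prog (d * ((200 + 200) + 14) + 200) (first_step 0 X) ((first_step d X)(Alp := 1))"
    unfolding first_prog_def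
  proof (rule transforms_seq)
    show "transforms d s [] (Alp ::= RNum 1) 200 (first_step d X) ((first_step d X)(Alp := 1))"
      by (intro transforms_assign) auto
    show "transforms d s [] (for_loop 0 (Ctr 0 ::= val (InZ 0) ;; Inv 0 0 ::= RNum 1))
        (d * ((200 + 200) + 14)) (first_step 0 X) (first_step d X)"
    proof (intro transforms_seq transforms_for transforms_assign)
      fix i \<sigma> assume "i < d" "regs_ok ([] @ [i]) \<sigma>" "view d \<sigma> = first_step i X"
      then show "valid d (inst (regs \<sigma>) (Ctr 0)) \<and> rok d s \<sigma> (val (InZ 0)) \<and>
          (first_step i X)(Ctr i := X (InZ i)) = (first_step i X)(inst (regs \<sigma>) (Ctr 0) := rval d \<sigma> (val (InZ 0)))"
        by (auto simp: mem_cell first_step_def)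
    next
      fix i \<sigma> assume "i < d" "regs_ok ([] @ [i]) \<sigma>" "view d \<sigma> = (first_step i X)(Ctr i := X (InZ i))"
      then show "valid d (inst (regs \<sigma>) (Inv 0 0)) \<and> rok d s \<sigma> (RNum 1) \<and>
          first_step (Suc i) X = ((first_step i X)(Ctr i := X (InZ i)))(inst (regs \<sigma>) (Inv 0 0) := rval d \<sigma> (RNum 1))"
        by (auto simp: mem_cell first_step_def fun_eq_iff less_Suc_eq split: loc.splits)
    qed auto
  qed
  moreover have "first_step 0 X = X"
    by (auto simp: fun_eq_iff first_step_def split: loc.splits)
  ultimately show ?thesis
    by (auto elim!: transforms_mono intro!: linear_le_quadratic)
qed

lemma transforms_add:
  assumes "0 < X Alp"
  shows "transforms d s [] add_prog (3000 * (d * d)) X (added d X)"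
proof -
  define Y where "Y = rank_one_step d d 0 (with_row d d X)"
  have "Y Alp = X Alp" by (simp add: Y_def rank_one_step_def with_row_def)
  then have "transforms d s [] move_prog (1000 * (d * d)) Y (added d X)"
    unfolding added_def Y_def[symmetric] Let_def using assms by (intro transforms_move) simp
  then have "transforms d s [] add_prog (1000 * (d * d) + (1000 * (d * d) + 1000 * (d * d))) X (added d X)"
    unfolding add_prog_def Y_def
    by (rule transforms_seq[OF transforms_row transforms_seq[OF transforms_rank_one]])
  then show ?thesis by simp
qed

lemma scanned_input_simps:
  "scanned_input d X Alp = X Alp" "0 \<le> scanned_input d X Nrm"
  by (simp_all add: scanned_input_def scanned_def with_coords_def centered_def sum_nonneg)

text \<open>The costs 1000, 1000, 3000 and 4500 of the successive pieces add up to 9500 times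
  \<open>d * d\<close>; the constant cost of the first test fits into the remainder as
  \<open>d * d\<close> is at least 1.\<close>

lemma transforms_rounding:
  "transforms d s [] rounding_prog (10000 * (d * d)) X
    (updated d X)"
proof -
  let ?Z = "(if 0 < X Alp then
      (let Y = scanned_input d X in
        if Y Piv \<noteq> 0 then added d (unspanned_step d (unspanned_start Y))
        else if 1 < Y Nrm + X Alp then added d (spanned_step d (spanned_start Y))
        else Y)
     else (first_step d X)(Alp := 1))"
  define Y where "Y = scanned_input d X"
  define Z where "Z = (if Y Piv \<noteq> 0 then added d (unspanned_step d (unspanned_start Y))
        else if 1 < Y Nrm + X Alp then added d (spanned_step d (spanned_start Y))
        else Y)"
  have Y: "Y Alp = X Alp" "0 \<le> Y Nrm" by (simp_all add: Y_def scanned_input_simps)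
  have DD: "1 \<le> d * d" using d_pos by simp
  let ?b1 = "RLess (RNum 0) (RMul (val Piv) (val Piv))"
  let ?b2 = "RLess (RNum 1) (RAdd (val Nrm) (val Alp))"
  have big: "transforms d s [] (center_prog ;; coord_prog ;; scan_prog ;;
      IfElse ?b1 (unspanned_prog ;; add_prog) (IfElse ?b2 (spanned_prog ;; add_prog) Skip))
      (9500 * (d * d)) X Z" if pos: "0 < X Alp"
  proof -
    have un: "transforms d s [] (unspanned_prog ;; add_prog) (4000 * (d * d)) Y Z" if "Y Piv \<noteq> 0"
    proof -
      have "transforms d s [] (unspanned_prog ;; add_prog) (1000 * (d * d) + 3000 * (d * d)) Y
          (added d (unspanned_step d (unspanned_start Y)))"
        using that pos Y
        by (intro transforms_seq[OF transforms_unspanned transforms_add])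
          (auto simp: unspanned_step_def unspanned_start_def)
      then show ?thesis using that by (simp add: Z_def)
    qed
    have sp: "transforms d s [] (spanned_prog ;; add_prog) (4000 * (d * d)) Y Z"
      if "Y Piv = 0" "1 < Y Nrm + X Alp"
    proof -
      have "transforms d s [] (spanned_prog ;; add_prog) (1000 * (d * d) + 3000 * (d * d)) Y
          (added d (spanned_step d (spanned_start Y)))"
        using that pos Y
        by (intro transforms_seq[OF transforms_spanned transforms_add])
          (auto simp: spanned_step_def spanned_start_def)
      then show ?thesis using that by (simp add: Z_def)
    qed
    have inner: "transforms d s [] (IfElse ?b2 (spanned_prog ;; add_prog) Skip)
        (bcost ?b2 + 1 + 4000 * (d * d)) Y Z" if p: "Y Piv = 0"
    proof (rule transforms_if[where t = "1 < Y Nrm + X Alp"])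
      show "bok d s \<sigma> ?b2 \<and> bval d \<sigma> ?b2 = (1 < Y Nrm + X Alp)" if "view d \<sigma> = Y" for \<sigma>
        using that Y by (simp add: mem_cell)
      show "transforms d s [] Skip (4000 * (d * d)) Y Z" if "\<not> 1 < Y Nrm + X Alp"
      proof -
        have "1 \<le> 4000 * (d * d)" using DD by simp
        then show ?thesis using p that by (simp add: Z_def transforms_skip)
      qed
    qed (rule sp[OF p])
    have "transforms d s [] (IfElse ?b1 (unspanned_prog ;; add_prog) (IfElse ?b2 (spanned_prog ;; add_prog) Skip))
        (bcost ?b1 + 1 + (bcost ?b2 + 1 + 4000 * (d * d))) Y Z"
    proof (rule transforms_if[where t = "Y Piv \<noteq> 0"])
      show "bok d s \<sigma> ?b1 \<and> bval d \<sigma> ?b1 = (Y Piv \<noteq> 0)" if "view d \<sigma> = Y" for \<sigma>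
        using that by (auto simp: mem_cell zero_less_mult_iff linorder_neq_iff)
      show "transforms d s [] (unspanned_prog ;; add_prog) (bcost ?b2 + 1 + 4000 * (d * d)) Y Z" if "Y Piv \<noteq> 0"
        using un[OF that] by (rule transforms_mono) simp
    qed (use inner in simp)
    then have "transforms d s [] (IfElse ?b1 (unspanned_prog ;; add_prog) (IfElse ?b2 (spanned_prog ;; add_prog) Skip))
        (4500 * (d * d)) Y Z"
    proof (rule transforms_mono)
      have "bcost ?b1 + bcost ?b2 \<le> 498" by simp
      then show "bcost ?b1 + 1 + (bcost ?b2 + 1 + 4000 * (d * d)) \<le> 4500 * (d * d)"
        using DD by linarith
    qed
    then have "transforms d s [] (center_prog ;; coord_prog ;; scan_prog ;;
      IfElse ?b1 (unspanned_prog ;; add_prog) (IfElse ?b2 (spanned_prog ;; add_prog) Skip))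
      (1000 * (d * d) + (1000 * (d * d) + (3000 * (d * d) + 4500 * (d * d)))) X Z"
      unfolding Y_def scanned_input_def
      by (intro transforms_seq[OF transforms_center transforms_seq[OF transforms_coord transforms_seq[OF transforms_scan]]])
    then show ?thesis by simp
  qed
  have "transforms d s [] rounding_prog (bcost (RLess (RNum 0) (val Alp)) + 1 + 9500 * (d * d)) X ?Z"
    unfolding rounding_prog_def
  proof (rule transforms_if[where t = "0 < X Alp"])
    show "bok d s \<sigma> (RLess (RNum 0) (val Alp)) \<and> bval d \<sigma> (RLess (RNum 0) (val Alp)) = (0 < X Alp)"
      if "view d \<sigma> = X" for \<sigma>
      using that by (simp add: mem_cell)
    show "transforms d s [] first_prog (9500 * (d * d)) X ?Z" if "\<not> 0 < X Alp"
      using transforms_first[of X] that by (auto elim!: transforms_mono)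
    have "?Z = Z" if "0 < X Alp"
      using that by (simp only: Z_def Y_def Let_def if_True)
    then show "transforms d s [] (center_prog ;; coord_prog ;; scan_prog ;;
        IfElse ?b1 (unspanned_prog ;; add_prog) (IfElse ?b2 (spanned_prog ;; add_prog) Skip))
        (9500 * (d * d)) X ?Z" if "0 < X Alp"
      using big[OF that] that by (simp only:)
  qed
  then show ?thesis
    unfolding updated_def
  proof (rule transforms_mono)
    have "bcost (RLess (RNum 0) (val Alp)) = 12" by simp
    then show "bcost (RLess (RNum 0) (val Alp)) + 1 + 9500 * (d * d) \<le> 10000 * (d * d)"
      using DD by linarith
  qed
qed

end

section \<open>Preservation of the invariant along the stream\<close>

section \<open>Correctness of the algorithm\<close>

text \<open>In the second case \<open>pivot\<close> is zero up to the index \<open>k\<close> and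
  nonzero afterwards, so the selection condition of \<open>scanned\<close>, which uses the running
  value of \<open>pivot\<close>, singles out \<open>k\<close>.\<close>

lemma pivot_cases:
  obtains "pivot X n = 0" "\<And>k. k < n \<Longrightarrow> \<not> (X (Act k) < 1 \<and> X (Crd k) \<noteq> 0)"
  | k where "k < n" "X (Act k) < 1" "X (Crd k) \<noteq> 0" "pivot X n = X (Crd k)"
    "\<And>j. j < n \<Longrightarrow> pivot X j = 0 \<and> X (Act j) < 1 \<and> X (Crd j) \<noteq> 0 \<longleftrightarrow> j = k"
proof -
  have "(pivot X n = 0 \<and> (\<forall>k<n. \<not> (X (Act k) < 1 \<and> X (Crd k) \<noteq> 0))) \<or>
    (\<exists>k<n. X (Act k) < 1 \<and> X (Crd k) \<noteq> 0 \<and> pivot X n = X (Crd k) \<and>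
      (\<forall>j<n. pivot X j = 0 \<and> X (Act j) < 1 \<and> X (Crd j) \<noteq> 0 \<longleftrightarrow> j = k))"
  proof (induction n)
    case (Suc n)
    show ?case
    proof (cases "pivot X n = 0")
      case True
      then have none: "\<not> (X (Act k) < 1 \<and> X (Crd k) \<noteq> 0)" if "k < n" for k
        using Suc that by auto
      show ?thesis
      proof (cases "X (Act n) < 1 \<and> X (Crd n) \<noteq> 0")
        case yes: True
        then show ?thesis
          using True none by (intro disjI2 exI[of _ n]) (auto simp: less_Suc_eq)
      next
        case False
        then show ?thesis
          using True none by (intro disjI1) (auto simp: less_Suc_eq)
      qed
    next
      case False
      then obtain k where "k < n" "X (Act k) < 1" "X (Crd k) \<noteq> 0" "pivot X n = X (Crd k)"
        "\<forall>j<n. pivot X j = 0 \<and> X (Act j) < 1 \<and> X (Crd j) \<noteq> 0 \<longleftrightarrow> j = k"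
        using Suc by auto
      then show ?thesis
        using False by (intro disjI2 exI[of _ k]) (auto simp: less_Suc_eq)
    qed
  qed simp
  then show ?thesis using that by blast
qed

text \<open>Only cells that must survive between two points are constrained, so feeding the next
  point preserves the relation.\<close>

definition represents ::
  "nat \<Rightarrow> (loc \<Rightarrow> real) \<Rightarrow> nat \<Rightarrow> vect \<Rightarrow> (nat \<Rightarrow> nat \<Rightarrow> real) \<Rightarrow> (nat \<Rightarrow> nat \<Rightarrow> real) \<Rightarrow> nat set \<Rightarrow> bool"
  where "represents d X W c L G F \<longleftrightarrow> X Alp = 1 / real W \<and>
    (\<forall>i<d. X (Ctr i) = c i \<and> X (Act i) = of_bool (i \<in> F)) \<and>
    (\<forall>i<d. \<forall>j<d. X (Ell i j) = L i j \<and> X (Inv i j) = G i j)"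

text \<open>The kept points \<open>y\<close> are quantified away: they exist for the analysis only,
  and the space is quadratic in \<open>d\<close> however large \<open>W\<close> is.\<close>

definition stream_invariant :: "nat \<Rightarrow> vect set \<Rightarrow> (loc \<Rightarrow> real) \<Rightarrow> bool"
  where "stream_invariant d S X \<longleftrightarrow> (\<exists>W y c L G F.
    rounding d S W y c L G F \<and> volume_bound d W L F \<and> represents d X W c L G F)"

lemma stream_invariant_first:
  assumes z: "z \<in> Rspace d" and X: "X Alp = 0" "\<And>i. i < d \<Longrightarrow> X (InZ i) = z i"
    "\<And>i. i < d \<Longrightarrow> X (Act i) = 0" "\<And>i j. i < d \<Longrightarrow> j < d \<Longrightarrow> X (Ell i j) = 0 \<and> X (Inv i j) = 0"
  shows "stream_invariant d {z} (updated d X)"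
proof -
  have "represents d (updated d X) (Suc 0) z (\<lambda>i j. 0) kron {}"
    using X by (auto simp: represents_def updated_def first_step_def kron_def)
  then show ?thesis
    unfolding stream_invariant_def using rounding_singleton[OF z] volume_bound_singleton by blast
qed

lemma added_simps:
  "added d X Alp = X Alp / (1 + X Alp)"
  "i < d \<Longrightarrow> added d X (Ctr i) = X (Ctr i) + X (InZ i) * (X Alp / (1 + X Alp))"
  "i < d \<Longrightarrow> added d X (Act i) = X (Act i)"
  "i < d \<Longrightarrow> j < d \<Longrightarrow> added d X (Ell i j) = X (Ell i j) + X Coef * X (InZ i) * X (Sel j)"
  "i < d \<Longrightarrow> j < d \<Longrightarrow>
    added d X (Inv i j) = X (Inv i j) - X (Crd i) * (\<Sum>l<d. X (Sel l) * X (Inv l j))"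
  by (simp_all add: added_def moved_def rank_one_step_def with_row_def)

lemma stream_invariant_updated:
  assumes inv: "stream_invariant d S X" and z: "z \<in> Rspace d"
    and Ints: "\<And>x i. x \<in> insert z S \<Longrightarrow> i < d \<Longrightarrow> x i \<in> \<int>"
    and X: "\<And>i. i < d \<Longrightarrow> X (InZ i) = z i"
  shows "stream_invariant d (insert z S) (updated d X)"
proof -
  obtain W y c L G F where R: "rounding d S W y c L G F" and vol: "volume_bound d W L F"
    and rep: "represents d X W c L G F"
    using inv unfolding stream_invariant_def by blast
  interpret rounding d S W y c L G F by (rule R)
  define P where "P = with_coords d d (centered d X)"
  define Y where "Y = scanned_input d X"
  have Y_scan: "Y = scanned d P" by (simp add: Y_def P_def scanned_input_def)
  have alp: "X Alp = 1 / real W" "0 < X Alp"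
    using rep W_pos by (auto simp: represents_def)
  \<comment> \<open>The program knows \<open>W\<close> only through \<open>Alp\<close>; these
    identities translate its quotients.\<close>
  have frac: "1 / (1 + X Alp) = real W / real (Suc W)" "X Alp / (1 + X Alp) = 1 / real (Suc W)"
    using W_pos by (simp_all add: alp field_simps)
  have P_Act: "P (Act i) = of_bool (i \<in> F)" if "i < d" for i
    using rep that by (simp add: P_def with_coords_def centered_def represents_def)
  have P_Crd: "P (Crd j) = coord z j" if "j < d" for j
    using rep that X by (simp add: P_def with_coords_def centered_def represents_def coord_def)
  have Y_In: "Y (InZ i) = z i - c i" if "i < d" for i
    using rep that X by (simp add: Y_scan P_def scanned_def with_coords_def centered_def represents_def)
  have Y_Ctr: "Y (Ctr i) = c i" if "i < d" for i
    using rep that by (simp add: Y_scan P_def scanned_def with_coords_def centered_def represents_def)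
  have Y_mat: "Y (Ell i j) = L i j" "Y (Inv i j) = G i j" if "i < d" "j < d" for i j
    using rep that by (simp_all add: Y_scan P_def scanned_def with_coords_def centered_def represents_def)
  have Y_Act: "Y (Act i) = of_bool (i \<in> F)" if "i < d" for i
    using P_Act[OF that] by (simp add: Y_scan scanned_def)
  have Y_Crd: "Y (Crd i) = coord z i" if "i < d" for i
    using P_Crd[OF that] by (simp add: Y_scan scanned_def)
  have Y_Alp: "Y Alp = X Alp" by (simp add: Y_scan P_def scanned_def with_coords_def centered_def)
  have Y_Nrm: "Y Nrm = (\<Sum>j<d. (coord z j)\<^sup>2)"
    by (simp add: Y_scan scanned_def P_Crd)
  have Y_Piv: "Y Piv = pivot P d" by (simp add: Y_scan scanned_def)
  have upd: "updated d X = (if Y Piv \<noteq> 0 then added d (unspanned_step d (unspanned_start Y))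
        else if 1 < Y Nrm + X Alp then added d (spanned_step d (spanned_start Y)) else Y)"
    using alp by (simp add: updated_def Y_def Let_def)
  show ?thesis
  proof (cases rule: pivot_cases[of P d])
    \<comment> \<open>Some inactive coordinate is nonzero: \<open>z\<close> is outside the affine
      hull.\<close>
    case (2 k)
    then have k: "k < d" "k \<notin> F" "coord z k \<noteq> 0"
      using P_Act P_Crd by (auto simp: of_bool_def split: if_splits)
    define \<beta> where "\<beta> = sqrt (real W / real (Suc W))"
    define Z where "Z = updated d X"
    have piv: "Y Piv = coord z k" using 2 k by (simp add: Y_Piv P_Crd)
    have Z: "Z = added d (unspanned_step d (unspanned_start Y))"
      using piv k by (simp add: Z_def upd)
    have sel: "Y (Sel j) = kron j k" if "j < d" for j
      using 2(5)[OF that] that by (simp add: Y_scan scanned_def kron_def)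
    define L' where "L' i j = Z (Ell i j)" for i j
    define G' where "G' i j = Z (Inv i j)" for i j
    note defs = unspanned_step_def unspanned_start_def
    have L': "L' i j = L i j + \<beta> * (z i - c i) * kron j k" if "i < d" "j < d" for i j
      using that by (simp add: L'_def Z added_simps defs Y_mat Y_In Y_Alp sel frac \<beta>_def)
    have G': "G' i j = G i j - (\<beta> * coord z i - kron i k) / (\<beta> * coord z k) * (\<Sum>l<d. kron l k * G l j)"
      if "i < d" "j < d" for i j
      using that by (simp add: G'_def Z added_simps defs Y_mat Y_Crd Y_Alp sel frac \<beta>_def piv)
    have "represents d Z (Suc W) (next_center z) L' G' (insert k F)"
      using k by (auto simp: represents_def L'_def G'_def Z added_simps(1-3) defs
          Y_Ctr Y_In Y_Act Y_Alp sel next_center_def frac kron_def)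
    moreover have "rounding d (insert z S) (Suc W) (y(W := z)) (next_center z) L' G' (insert k F)"
      by (rule add_unspanned[OF z k \<beta>_def L' G'])
    \<comment> \<open>Any seen point may serve as reference; a first kept point exists because
      \<open>0 < W\<close>.\<close>
    moreover have "volume_bound d (Suc W) L' (insert k F)"
      using y_in_S[OF W_pos] Ints
      by (intro volume_bound_unspanned[OF k(1,2) _ _ \<beta>_def L' vol, where z\<^sub>0 = "y 0"]) auto
    ultimately show ?thesis
      unfolding stream_invariant_def Z_def by blast
  next
    case 1
    then have piv: "Y Piv = 0" by (simp add: Y_Piv)
    \<comment> \<open>Without a pivot \<open>z\<close> is in the affine hull, and the leverage
      decides.\<close>
    have inactive: "coord z j = 0" if "j < d" "j \<notin> F" for j
      using 1(2)[OF that(1)] that P_Act P_Crd by simp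
    show ?thesis
    proof (cases "1 < Y Nrm + X Alp")
      case True
      define Z where "Z = updated d X"
      have Z: "Z = added d (spanned_step d (spanned_start Y))"
        using piv True by (simp add: Z_def upd)
      define t where "t = real W / real (Suc W) * (\<Sum>j<d. (coord z j)\<^sup>2)"
      define \<kappa> where "\<kappa> = real W / real (Suc W) / (sqrt (1 + t) + 1)"
      have t': "Y Nrm / (1 + X Alp) = t"
        unfolding Y_Nrm t_def frac(1)[symmetric] by simp
      define L' where "L' i j = Z (Ell i j)" for i j
      define G' where "G' i j = Z (Inv i j)" for i j
      note defs = spanned_step_def spanned_start_def
      have L': "L' i j = L i j + \<kappa> * (z i - c i) * coord z j" if "i < d" "j < d" for i j
        using that by (simp add: L'_def Z added_simps defs Y_mat Y_In Y_Alp Y_Crd t' frac \<kappa>_def)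
      have G': "G' i j = G i j - \<kappa> * coord z i / sqrt (1 + t) * (\<Sum>l<d. coord z l * G l j)"
        if "i < d" "j < d" for i j
        using that by (simp add: G'_def Z added_simps defs Y_mat Y_Crd Y_Alp t' frac \<kappa>_def)
      have "represents d Z (Suc W) (next_center z) L' G' F"
        by (auto simp: represents_def L'_def G'_def Z added_simps(1-3) defs
            Y_Ctr Y_In Y_Act Y_Alp next_center_def frac)
      moreover note step = add_spanned[OF z inactive t_def \<kappa>_def L' G']
      moreover have "volume_bound d (Suc W) L' F"
        by (rule volume_bound_spanned[OF inactive _ t_def step(2) L' vol])
          (use True in \<open>simp_all add: Y_Nrm alp\<close>)
      ultimately show ?thesis
        unfolding stream_invariant_def Z_def by blast
    next
      case False
      have "(\<Sum>j\<in>F. (coord z j)\<^sup>2) = (\<Sum>j<d. (coord z j)\<^sup>2)"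
        using inactive by (intro sum_active[symmetric]) auto
      then have "rounding d (insert z S) W y c L G F"
        using False by (intro insert_dominated[OF z inactive]) (auto simp: Y_Nrm alp)
      moreover have "represents d (updated d X) W c L G F"
        using False piv alp by (auto simp: upd represents_def Y_Alp Y_Ctr Y_Act Y_mat)
      ultimately show ?thesis
        unfolding stream_invariant_def using vol by blast
    qed
  qed
qed

text \<open>A linear image of the unit ball. Convexity of the squared norm holds coordinatewise,
  with defect \<open>u (1 - u) (v i - w i)^2\<close>.\<close>

lemma convex_mat_ellipsoid: "convex (mat_ellipsoid d M)"
  unfolding mat_ellipsoid_def
proof (intro convex_linear_image linear_mat_apply)
  show "convex {v \<in> Rspace d. sqrt (\<Sum>i<d. (v i)\<^sup>2) \<le> 1}"
    unfolding convex_alt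
  proof (intro ballI allI impI)
    fix v w :: vect and u :: real
    assume v: "v \<in> {v \<in> Rspace d. sqrt (\<Sum>i<d. (v i)\<^sup>2) \<le> 1}"
      and w: "w \<in> {v \<in> Rspace d. sqrt (\<Sum>i<d. (v i)\<^sup>2) \<le> 1}" and u: "0 \<le> u \<and> u \<le> 1"
    have "(\<Sum>i<d. ((1 - u) * v i + u * w i)\<^sup>2) \<le> (\<Sum>i<d. (1 - u) * (v i)\<^sup>2 + u * (w i)\<^sup>2)"
    proof (rule sum_mono)
      fix i
      have "(1 - u) * (v i)\<^sup>2 + u * (w i)\<^sup>2 - ((1 - u) * v i + u * w i)\<^sup>2 = u * (1 - u) * (v i - w i)\<^sup>2"
        by (simp add: power2_eq_square algebra_simps)
      also have "\<dots> \<ge> 0" using u by simp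
      finally show "((1 - u) * v i + u * w i)\<^sup>2 \<le> (1 - u) * (v i)\<^sup>2 + u * (w i)\<^sup>2" by simp
    qed
    also have "\<dots> = (1 - u) * (\<Sum>i<d. (v i)\<^sup>2) + u * (\<Sum>i<d. (w i)\<^sup>2)"
      by (simp add: sum.distrib sum_distrib_left)
    also have "\<dots> \<le> (1 - u) * 1 + u * 1"
      using u v w by (intro add_mono mult_left_mono) auto
    finally show "(1 - u) *\<^sub>R v + u *\<^sub>R w \<in> {v \<in> Rspace d. sqrt (\<Sum>i<d. (v i)\<^sup>2) \<le> 1}"
      using v w by (simp add: Rspace_def scaleR_fun_def)
  qed
qed

lemma stream_invariant_output:
  assumes inv: "stream_invariant d S (view d \<sigma>)"
    and N: "\<forall>x\<in>S. \<forall>i<d. \<bar>x i\<bar> \<le> real N"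
  defines "c \<equiv> out_center d \<sigma>" and "E \<equiv> out_ellipsoid d \<sigma>" and "\<alpha> \<equiv> out_factor d \<sigma>"
  shows "0 < \<alpha>" "\<alpha> \<le> 1" "(\<lambda>x. c + \<alpha> *\<^sub>R x) ` E \<subseteq> convex hull S"
    "convex hull S \<subseteq> (\<lambda>x. c + x) ` E"
    "1 / \<alpha> \<le> 64 * max 1 (real (affine_dim S) * ln (real d * real N))"
proof -
  obtain W y c' L G F where R: "rounding d S W y c' L G F" and vol: "volume_bound d W L F"
    and rep: "represents d (view d \<sigma>) W c' L G F"
    using inv unfolding stream_invariant_def by blast
  interpret rounding d S W y c' L G F by (rule R)
  have \<alpha>: "\<alpha> = 1 / real W"
    using rep by (simp add: \<alpha>_def out_factor_def represents_def view_def)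
  have c: "c = c'"
    using rep center_Rspace
    by (auto simp: fun_eq_iff c_def out_center_def represents_def view_def Rspace_def)
  have "mat_apply d (\<lambda>i j. mem \<sigma> (2 * d + i * d + j)) = mat_apply d L"
    using rep by (auto simp: fun_eq_iff mat_apply_def represents_def view_def intro!: sum.cong)
  then have E: "E = mat_ellipsoid d L"
    by (simp add: E_def out_ellipsoid_def mat_ellipsoid_def)
  show "0 < \<alpha>" "\<alpha> \<le> 1" using W_pos by (simp_all add: \<alpha>)
  show "(\<lambda>x. c + \<alpha> *\<^sub>R x) ` E \<subseteq> convex hull S"
    using inner_inclusion by (auto simp: E mat_ellipsoid_def c \<alpha>)
  \<comment> \<open>Leverages control the points only; convexity of the ellipsoid extends the
    inclusion to the hull.\<close>
  show "convex hull S \<subseteq> (\<lambda>x. c + x) ` E"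
  proof (rule hull_minimal)
    show "S \<subseteq> (\<lambda>x. c + x) ` E"
    proof
      fix x assume "x \<in> S"
      then have "x - c \<in> E" using outer_inclusion by (simp add: E c)
      then have "c + (x - c) \<in> (\<lambda>x. c + x) ` E" by (rule imageI)
      then show "x \<in> (\<lambda>x. c + x) ` E" by simp
    qed
    show "convex ((\<lambda>x. c + x) ` E)"
      unfolding E by (intro convex_translation convex_mat_ellipsoid)
  qed
  have "real W \<le> 64 * max 1 (real (card F) * ln (real d * real N))"
  proof (rule invert_exponential_bound[OF W_pos])
    show "card F \<le> d" using card_mono[OF _ F_sub] by simp
  qed (rule exponential_bound[OF vol, of "real N"], use N in blast)
  then show "1 / \<alpha> \<le> 64 * max 1 (real (affine_dim S) * ln (real d * real N))"
    by (simp add: \<alpha> affine_dim_eq)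
qed

text \<open>The maximum with 1 is due to \<open>1 / \<alpha> \<ge> 1\<close>: the product next to it
  vanishes for a single point and for \<open>d = N = 1\<close>.\<close>

theorem theorem3:
  shows "\<exists>(A :: streaming_alg) (C :: nat) (k :: nat).
    \<forall>(d :: nat) (N :: nat) (n :: nat) (z :: nat \<Rightarrow> vect).
      1 \<le> d \<longrightarrow> 1 \<le> n \<longrightarrow>
      (\<forall>t\<in>{1..n}. z t \<in> Rspace d \<and> (\<forall>i<d. z t i \<in> \<int> \<and> \<bar>z t i\<bar> \<le> real N)) \<longrightarrow>
      (\<exists>(T :: nat \<Rightarrow> nat) (\<sigma> :: nat \<Rightarrow> state).
        stream_run A d (C * d\<^sup>2) z n T \<sigma> \<and>
        real (total_time d n T)
          \<le> real C * (real n * (real d)\<^sup>2 * ln (real n * real d * real N + 3) ^ k) \<and>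
        (\<forall>t\<in>{1..n}.
          let c = out_center d (\<sigma> t);
              E = out_ellipsoid d (\<sigma> t);
              \<alpha> = out_factor d (\<sigma> t);
              K = convex hull (z ` {1..t});
              d\<^sub>t = affine_dim (z ` {1..t})
          in origin_ellipsoid d E \<and>
             0 < \<alpha> \<and> \<alpha> \<le> 1 \<and>
             (\<lambda>x. c + \<alpha> *\<^sub>R x) ` E \<subseteq> K \<and>
             K \<subseteq> (\<lambda>x. c + x) ` E \<and>
             1 / \<alpha> \<le> real C * max 1 (real d\<^sub>t * ln (real d * real N))))"
proof (rule exI[of _ "\<lparr>init_prog = Skip, update_prog = rounding_prog\<rparr>"],
    rule exI[of _ "20000 :: nat"], rule exI[of _ "0 :: nat"], intro allI impI)
  \<comment> \<open>One constant covers the space required by \<open>ram\<close>, the time of at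
    most \<open>10001 d^2\<close> per point including reading, and the factor 64. The exponent 0 of
    the logarithm is possible because the time per point is bounded in terms of \<open>d\<close>
    alone.\<close>
  fix d N n :: nat and z :: "nat \<Rightarrow> vect"
  assume d: "1 \<le> d" and n: "1 \<le> n"
    and z: "\<forall>t\<in>{1..n}. z t \<in> Rspace d \<and> (\<forall>i<d. z t i \<in> \<int> \<and> \<bar>z t i\<bar> \<le> real N)"
  define s where "s = 20000 * d\<^sup>2"
  interpret ram d s
    by standard (use d in \<open>auto simp: s_def power2_eq_square\<close>)
  \<comment> \<open>The program terminates within its bounds from every state, so a function
    \<open>f\<close> of the state can be chosen and the run defined by recursion.\<close>
  have "\<exists>Tt. exec d s rounding_prog \<tau> (fst Tt) (snd Tt) \<and> fst Tt \<le> 10000 * (d * d) \<and>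
      view d (snd Tt) = updated d (view d \<tau>)" for \<tau>
    using transforms_rounding[of "view d \<tau>"] unfolding transforms_def by fastforce
  then obtain f where f: "\<And>\<tau>. exec d s rounding_prog \<tau> (fst (f \<tau>)) (snd (f \<tau>))"
    "\<And>\<tau>. fst (f \<tau>) \<le> 10000 * (d * d)" "\<And>\<tau>. view d (snd (f \<tau>)) = updated d (view d \<tau>)"
    by metis
  define \<sigma> where "\<sigma> = rec_nat start_state (\<lambda>t \<tau>. snd (f (feed d (z (Suc t)) \<tau>)))"
  define T where "T t = (case t of 0 \<Rightarrow> 1 | Suc t \<Rightarrow> fst (f (feed d (z (Suc t)) (\<sigma> t))))" for t
  have \<sigma>0: "\<sigma> 0 = start_state" and \<sigma>S: "\<sigma> (Suc t) = snd (f (feed d (z (Suc t)) (\<sigma> t)))" for t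
    by (simp_all add: \<sigma>_def)
  have run: "stream_run \<lparr>init_prog = Skip, update_prog = rounding_prog\<rparr> d s z n T \<sigma>"
    using f(1) d_less_s exec.Skip[of d s start_state] by (simp add: stream_run_def T_def \<sigma>0 \<sigma>S)
  have "total_time d n T \<le> 1 + (\<Sum>t=1..n. 10001 * (d * d))"
    unfolding total_time_def
  proof (intro add_mono sum_mono)
    fix t assume "t \<in> {1..n}"
    then obtain u where "t = Suc u" by (cases t) auto
    then have "T t \<le> 10000 * (d * d)" using f(2) by (simp add: T_def)
    then show "d + T t \<le> 10001 * (d * d)" using d_le_square by linarith
  qed (simp add: T_def)
  also have "\<dots> \<le> 20000 * (n * d\<^sup>2)"
  proof -
    have "1 \<le> n * (d * d)" using d n by simp
    moreover have "(\<Sum>t=1..n. 10001 * (d * d)) = 10001 * (n * (d * d))" by simp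
    ultimately show ?thesis unfolding power2_eq_square by linarith
  qed
  finally have "real (total_time d n T) \<le> real (20000 * (n * d\<^sup>2))"
    by (simp only: of_nat_le_iff)
  then have time: "real (total_time d n T)
      \<le> real 20000 * (real n * (real d)\<^sup>2 * ln (real n * real d * real N + 3) ^ 0)"
    by simp
  \<comment> \<open>The induction starts after the first point, since the invariant demands a kept
    point.\<close>
  have inv: "stream_invariant d (z ` {1..Suc t}) (view d (\<sigma> (Suc t)))" if "Suc t \<le> n" for t
    using that
  proof (induction t)
    case 0
    have "z 1 \<in> Rspace d" using z n by simp
    then have "stream_invariant d {z 1} (updated d (view d (feed d (z 1) start_state)))"
      by (rule stream_invariant_first) (simp_all add: view_feed view_def start_state_def)
    then show ?case by (simp add: \<sigma>S \<sigma>0 f(3))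
  next
    case (Suc t)
    let ?X = "view d (\<sigma> (Suc t))"
    have "stream_invariant d (insert (z (Suc (Suc t))) (z ` {1..Suc t}))
        (updated d (view d (feed d (z (Suc (Suc t))) (\<sigma> (Suc t)))))"
    proof (rule stream_invariant_updated)
      \<comment> \<open>Feeding overwrites only the cells \<open>InZ\<close>, which
        \<open>represents\<close> does not mention.\<close>
      show "stream_invariant d (z ` {1..Suc t}) (view d (feed d (z (Suc (Suc t))) (\<sigma> (Suc t))))"
        using Suc by (simp add: stream_invariant_def represents_def view_feed)
      show "z (Suc (Suc t)) \<in> Rspace d" using z Suc.prems by simp
      show "x i \<in> \<int>" if "x \<in> insert (z (Suc (Suc t))) (z ` {1..Suc t})" "i < d" for x i
        using that z Suc.prems by auto
    qed (simp add: view_feed)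
    moreover have "insert (z (Suc (Suc t))) (z ` {1..Suc t}) = z ` {1..Suc (Suc t)}"
      by (simp add: atLeastAtMostSuc_conv)
    ultimately show ?case by (simp add: \<sigma>S f(3))
  qed
  have out: "let c = out_center d (\<sigma> t);
              E = out_ellipsoid d (\<sigma> t);
              \<alpha> = out_factor d (\<sigma> t);
              K = convex hull (z ` {1..t});
              d\<^sub>t = affine_dim (z ` {1..t})
          in origin_ellipsoid d E \<and>
             0 < \<alpha> \<and> \<alpha> \<le> 1 \<and>
             (\<lambda>x. c + \<alpha> *\<^sub>R x) ` E \<subseteq> K \<and>
             K \<subseteq> (\<lambda>x. c + x) ` E \<and>
             1 / \<alpha> \<le> real 20000 * max 1 (real d\<^sub>t * ln (real d * real N))"
    if t: "t \<in> {1..n}" for t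
  proof -
    have I: "stream_invariant d (z ` {1..t}) (view d (\<sigma> t))"
      using t inv[of "t - 1"] by simp
    have N: "\<forall>x\<in>z ` {1..t}. \<forall>i<d. \<bar>x i\<bar> \<le> real N"
      using z t by auto
    note O = stream_invariant_output[OF I N]
    have "64 * max 1 (real (affine_dim (z ` {1..t})) * ln (real d * real N))
        \<le> real 20000 * max 1 (real (affine_dim (z ` {1..t})) * ln (real d * real N))"
      by (intro mult_right_mono) auto
    then show ?thesis
      unfolding Let_def using O origin_ellipsoid_mat_ellipsoid
      by (auto simp: out_ellipsoid_def)
  qed
  show "\<exists>T \<sigma>. stream_run \<lparr>init_prog = Skip, update_prog = rounding_prog\<rparr> d (20000 * d\<^sup>2) z n T \<sigma> \<and>
        real (total_time d n T)
          \<le> real 20000 * (real n * (real d)\<^sup>2 * ln (real n * real d * real N + 3) ^ 0) \<and>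
        (\<forall>t\<in>{1..n}.
          let c = out_center d (\<sigma> t);
              E = out_ellipsoid d (\<sigma> t);
              \<alpha> = out_factor d (\<sigma> t);
              K = convex hull (z ` {1..t});
              d\<^sub>t = affine_dim (z ` {1..t})
          in origin_ellipsoid d E \<and>
             0 < \<alpha> \<and> \<alpha> \<le> 1 \<and>
             (\<lambda>x. c + \<alpha> *\<^sub>R x) ` E \<subseteq> K \<and>
             K \<subseteq> (\<lambda>x. c + x) ` E \<and>
             1 / \<alpha> \<le> real 20000 * max 1 (real d\<^sub>t * ln (real d * real N)))"
    using run time out unfolding s_def by blast
qed

end
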